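(* Let $N\in\{6,10,12,18\}$ and let $k$ be an even integer. Let $n_0$ be the maximal order of vanishing at $\infty$ of a nonzero form in $M_k^\sharp(N)$ and let $n_1$ be the maximal order of vanishing at $\infty$ of a nonzero form in $S_{2-k}^\sharp(N)$. Then for all integers $m\ge -n_0$ and $n\ge -n_1$, \[a_k^{(N)}(m,n) = -\,b_{2-k}^{(N)}(n,m).\]
   Context: For a positive integer $N$ and an even integer $k$, $M_k^\sharp(N)$ denotes the space of weakly holomorphic modular forms of weight $k$ for $\Gamma_0(N)$ whose poles are allowed only at the cusp $\infty$ (i.e. holomorphic on the upper half plane and at every cusp other than $\infty$), and $S_k^\sharp(N)\subseteq M_k^\sharp(N)$ is the subspace of forms vanishing at every cusp other than $\infty$. Write $q=e^{2\pi i z}$. If $n_0$ is the maximal order of vanishing at $\infty$ of a nonzero form in $M_k^\sharp(N)$, then for each integer $m\ge -n_0$ there is a unique form $f_{k,m}^{(N)}\in M_k^\sharp(N)$ with Fourier expansion $f_{k,m}^{(N)}(z)=q^{-m}+\sum_{n>n_0}a_k^{(N)}(m,n)q^n$; we write $a_k^{(N)}(m,n)$ for the coefficient of $q^n$ in $f_{k,m}^{(N)}$ for every integer $n$ (so it is $1$ if $n=-m$ and $0$ for other $n\le n_0$). Similarly, if $n_1$ is the maximal order of vanishing at $\infty$ of a nonzero form in $S_k^\sharp(N)$, then for each integer $m\ge -n_1$ there is a unique $g_{k,m}^{(N)}\in S_k^\sharp(N)$ with $g_{k,m}^{(N)}(z)=q^{-m}+\sum_{n>n_1}b_k^{(N)}(m,n)q^n$;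 $b_k^{(N)}(m,n)$ denotes the coefficient of $q^n$ in $g_{k,m}^{(N)}$ for every integer $n$. *)

theory Defs
  imports "HOL-Complex_Analysis.Complex_Analysis"
begin

definition upper_half_plane :: "complex set" where
  "upper_half_plane = {z. Im z > 0}"

definition SL2Z :: "(int^2^2) set" where
  "SL2Z = {A. det A = 1}"

definition Gamma0 :: "nat \<Rightarrow> (int^2^2) set" where
  "Gamma0 N = {A \<in> SL2Z. int N dvd A $ 2 $ 1}"

definition automorphy_factor :: "int^2^2 \<Rightarrow> complex \<Rightarrow> complex" where
  "automorphy_factor A z = of_int (A $ 2 $ 1) * z + of_int (A $ 2 $ 2)"

definition moebius_action :: "int^2^2 \<Rightarrow> complex \<Rightarrow> complex" where
  "moebius_action A z =
     (of_int (A $ 1 $ 1) * z + of_int (A $ 1 $ 2)) / automorphy_factor A z"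

definition slash :: "int \<Rightarrow> (complex \<Rightarrow> complex) \<Rightarrow> int^2^2 \<Rightarrow> complex \<Rightarrow> complex" where
  "slash k f A z = automorphy_factor A z powi (- k) * f (moebius_action A z)"

text \<open>
  On the upper half plane, \<open>f\<close> is given by the convergent Laurent series \<open>F\<close> in
  $e^{2\pi i z/h}$. A formal Laurent series has only finitely many terms of negative
  exponent, so the existence of \<open>F\<close> expresses meromorphy at the cusp.
\<close>
definition has_q_expansion :: "nat \<Rightarrow> (complex \<Rightarrow> complex) \<Rightarrow> complex fls \<Rightarrow> bool" where
  "has_q_expansion h f F \<longleftrightarrow>
     fls_conv_radius F \<ge> 1 \<and>
     (\<forall>z\<in>upper_half_plane. f z = eval_fls F (exp (2 * of_real pi * \<i> * z / of_nat h)))"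

text \<open>
  Modular forms are functions on the upper half plane; being total functions in HOL, they are
  normalised to be 0 elsewhere, so that equality of forms is equality of functions.
  The behaviour at the cusp $A\infty$ is read off from the expansion of \<open>slash k f A\<close> in
  powers of $e^{2\pi i z/N}$; the width of every cusp of $\Gamma_0(N)$ divides $N$
  (and \<open>k\<close> is even in all uses).
\<close>
definition weakly_holomorphic_forms :: "int \<Rightarrow> nat \<Rightarrow> (complex \<Rightarrow> complex) set" where
  "weakly_holomorphic_forms k N = {f.
     f holomorphic_on upper_half_plane \<and>
     (\<forall>z. z \<notin> upper_half_plane \<longrightarrow> f z = 0) \<and>
     (\<forall>A\<in>Gamma0 N. \<forall>z\<in>upper_half_plane. slash k f A z = f z) \<and>
     (\<forall>A\<in>SL2Z. \<exists>F. has_q_expansion N (slash k f A) F)}"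

text \<open>
  The cusp $A\infty$ is $\Gamma_0(N)$-equivalent to $\infty$ iff \<open>A \<in> Gamma0 N\<close>, because
  the stabiliser of $\infty$ in $SL_2(\mathbb{Z})$ is contained in $\Gamma_0(N)$. Hence
  \<open>A \<in> SL2Z - Gamma0 N\<close> ranges over all cusps other than $\infty$.
\<close>
definition M_sharp :: "int \<Rightarrow> nat \<Rightarrow> (complex \<Rightarrow> complex) set" where
  "M_sharp k N = {f \<in> weakly_holomorphic_forms k N.
     \<forall>A\<in>SL2Z - Gamma0 N. \<forall>F. has_q_expansion N (slash k f A) F \<longrightarrow>
       (\<forall>j<0. fls_nth F j = 0)}"

definition S_sharp :: "int \<Rightarrow> nat \<Rightarrow> (complex \<Rightarrow> complex) set" where
  "S_sharp k N = {f \<in> M_sharp k N.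
     \<forall>A\<in>SL2Z - Gamma0 N. \<forall>F. has_q_expansion N (slash k f A) F \<longrightarrow>
       fls_nth F 0 = 0}"

definition q_expansion :: "(complex \<Rightarrow> complex) \<Rightarrow> complex fls" where
  "q_expansion f = (THE F. has_q_expansion 1 f F)"

definition q_coeff :: "(complex \<Rightarrow> complex) \<Rightarrow> int \<Rightarrow> complex" where
  "q_coeff f n = fls_nth (q_expansion f) n"

definition max_order_infinity :: "(complex \<Rightarrow> complex) set \<Rightarrow> int" where
  "max_order_infinity V =
     (GREATEST r. \<exists>f\<in>V. f \<noteq> (\<lambda>z. 0) \<and> fls_subdegree (q_expansion f) = r)"

definition reduced_form :: "(complex \<Rightarrow> complex) set \<Rightarrow> int \<Rightarrow> complex \<Rightarrow> complex" where
  "reduced_form V m = (THE f. f \<in> V \<and>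
     (\<forall>n\<le>max_order_infinity V. q_coeff f n = (if n = - m then 1 else 0)))"

definition f_form :: "nat \<Rightarrow> int \<Rightarrow> int \<Rightarrow> complex \<Rightarrow> complex" where
  "f_form N k m = reduced_form (M_sharp k N) m"

definition g_form :: "nat \<Rightarrow> int \<Rightarrow> int \<Rightarrow> complex \<Rightarrow> complex" where
  "g_form N k m = reduced_form (S_sharp k N) m"

definition a_coeff :: "nat \<Rightarrow> int \<Rightarrow> int \<Rightarrow> int \<Rightarrow> complex" where
  "a_coeff N k m n = q_coeff (f_form N k m) n"

definition b_coeff :: "nat \<Rightarrow> int \<Rightarrow> int \<Rightarrow> int \<Rightarrow> complex" where
  "b_coeff N k m n = q_coeff (g_form N k m) n"

end

theory Submission
  imports Defs
begin

text \<open>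
  Let \<open>f\<close> lie in the first space and \<open>g\<close> in the second. Their product has weight 2 and vanishes
  at every cusp other than infinity. Its trace \<open>H\<close> to level 1 has the same constant term, and a
  primitive of \<open>H\<close> changes under the modular group by an additive character, which is trivial
  because \<open>\<i>\<close> and $e^{2\pi i/3}$ are fixed by $z \mapsto -1/z$ and $z \mapsto -1/(z+1)$. So the
  primitive has period 1 and the constant term of \<open>f g\<close> is 0. For the two reduced bases this constant
  term is $a(m,n) + b(n,m)$, provided that $n_0 + n_1 = -1$.

  The vanishing of the constant term also gives $n_0 + n_1 \le -1$, so it remains to exhibit forms
  whose orders add up to $-1$, together with a function having a simple pole at infinity that
  generates the rest of both bases. They are built from \<open>E\<close>, a product of differences
  $\wp(xz) - \wp(Nz/2)$ for the lattice generated by $Nz$ and 1. Such a difference has no zero in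
  the upper half plane, because $\wp - \wp(t/2)$ has a double zero at $t/2$, so that its product with its
  translate by $t/2$ is constant. The quotient of a form of order one less by \<open>E\<close> is the required
  function $\phi$. In weights divisible by that of \<open>E\<close> the powers of \<open>E\<close> and their products with $\phi'$
  suffice. For $N = 10$, where \<open>E\<close> has weight 4, the other weights need a form of weight 2
  and order 2, and a function of order $-3$ in $S_0^\sharp(10)$.
\<close>

subsection \<open>The $q$-coordinate and the summand of the Weierstrass function\<close>

text \<open>The upper bound on orders is free: two paired forms whose orders added up to 0 would
  have a product with a nonzero constant term. So no count of zeros is proved, and everything rests
  on forms that attain the bound. All four levels have genus 0, which is why a function with a
  single simple pole exists. The obstacle is that \<open>E\<close> must have all its zeros at
  infinity. Inside the upper half plane this comes from Liouville's theorem in the elliptic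
  variable, for each fixed lattice; at the other cusps it becomes an inequality between finite sums
  of inverse squares of sines. The orders are dictated by the count that a form of weight
  \<open>w\<close> has \<open>w * index / 12\<close> zeros: the indices 12, 24, 36 of the levels 6,
  12, 18 give the orders 2, 4, 6 in weight 2. Level 10 has index 18 and elliptic points of order 2,
  at which all forms of weight 2 vanish; a form without zeros in the upper half plane therefore
  needs weight 4 and has order 6.\<close>

definition qe :: "complex \<Rightarrow> complex" where
  "qe z = exp (2 * of_real pi * \<i> * z)"

text \<open>For \<open>norm u < 1\<close> this is the sum of \<open>of_nat n * u ^ n\<close>. At
  \<open>u = qe z\<close> it is, up to the factor \<open>(2 * of_real pi * \<i>)\<^sup>2\<close>,
  the sum of \<open>1 / (z + of_int n)\<^sup>2\<close> over all integers, that is, one row of the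
  Weierstrass function.\<close>

definition koebe :: "complex \<Rightarrow> complex" where
  "koebe u = u / (1 - u)\<^sup>2"

lemma qe_nonzero [simp]: "qe z \<noteq> 0"
  by (simp add: qe_def)

lemma qe_0 [simp]: "qe 0 = 1"
  by (simp add: qe_def)

lemma qe_add: "qe (z + w) = qe z * qe w"
  by (simp add: qe_def ring_distribs exp_add)

lemma qe_minus: "qe (- z) = inverse (qe z)"
  by (simp add: qe_def exp_minus)

lemma qe_eq_1_iff: "qe z = 1 \<longleftrightarrow> z \<in> \<int>"
proof
  assume "qe z = 1"
  then obtain n :: int where n: "Re (2 * of_real pi * \<i> * z) = 0"
      "Im (2 * of_real pi * \<i> * z) = of_int (2 * n) * pi"
    by (auto simp: qe_def exp_eq_1)
  hence "z = of_int n"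
    by (auto simp: complex_eq_iff)
  thus "z \<in> \<int>" by simp
next
  assume "z \<in> \<int>"
  then obtain n where n: "z = of_int n" by (elim Ints_cases)
  have "exp (2 * of_real pi * \<i> * of_int n) = 1"
    unfolding exp_eq_1 by (auto intro: exI[of _ n])
  thus "qe z = 1" by (simp add: qe_def n)
qed

lemma qe_Ints: "z \<in> \<int> \<Longrightarrow> qe z = 1"
  by (simp add: qe_eq_1_iff)

lemma qe_of_int [simp]: "qe (of_int n) = 1"
  by (simp add: qe_Ints)

lemma qe_add_int [simp]: "qe (z + of_int n) = qe z"
  by (simp add: qe_add)

lemma norm_qe: "norm (qe z) = exp (- 2 * pi * Im z)"
  by (simp add: qe_def norm_exp_eq_Re)

lemma qe_of_nat_mult: "qe (of_nat n * z) = qe z ^ n"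
  by (simp add: qe_def mult_ac flip: exp_of_nat_mult)

lemma qe_of_int_mult: "qe (of_int n * z) = qe z powi n"
  by (simp add: qe_def exp_power_int mult_ac)

lemma holomorphic_qe [holomorphic_intros]: "f holomorphic_on A \<Longrightarrow> (\<lambda>z. qe (f z)) holomorphic_on A"
  unfolding qe_def by (intro holomorphic_intros)

lemma koebe_inverse: "koebe (inverse u) = koebe u"
proof (cases "u = 0 \<or> u = 1")
  case False
  then have "u \<noteq> 0" "1 - u \<noteq> 0" "u - 1 \<noteq> 0" by auto
  then show ?thesis
    unfolding koebe_def by (simp add: divide_simps power2_eq_square) algebra
qed (auto simp: koebe_def)

lemma norm_koebe_le:
  assumes "norm u \<le> 1/2" shows "norm (koebe u) \<le> 4 * norm u"
proof -
  have "1/2 \<le> norm (1 - u)"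
    using norm_triangle_ineq2[of 1 u] assms by simp
  then have "(1/2)^2 \<le> norm (1 - u) ^ 2"
    by (intro power_mono) auto
  then have "1/4 \<le> norm ((1 - u)^2)"
    unfolding norm_power by (simp add: power2_eq_square)
  then have "norm u / norm ((1 - u)^2) \<le> norm u / (1/4)"
    by (intro divide_left_mono) (auto intro!: mult_pos_pos)
  then show ?thesis by (simp add: koebe_def norm_divide)
qed

text \<open>Two differentiations of the reflection formula of the Gamma function: the logarithmic
  derivative gives a cotangent for \<open>Digamma w - Digamma (1 - w)\<close>, and its derivative
  the inverse square of the sine.\<close>

lemma Polygamma_1_reflection:
  fixes z :: complex assumes z: "z \<notin> \<int>"
  shows "Polygamma 1 z + Polygamma 1 (1 - z) = (of_real pi / sin (of_real pi * z))\<^sup>2"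
proof -
  have nz: "z \<notin> \<int>\<^sub>\<le>\<^sub>0" "1 - z \<notin> \<int>\<^sub>\<le>\<^sub>0" if z: "z \<notin> \<int>" for z :: complex
  proof -
    have "1 - z \<notin> \<int>" using z Ints_diff[of 1 "1 - z"] by auto
    then show "z \<notin> \<int>\<^sub>\<le>\<^sub>0" "1 - z \<notin> \<int>\<^sub>\<le>\<^sub>0"
      using z nonpos_Ints_subset_Ints by blast+
  qed
  have s: "sin (of_real pi * z) \<noteq> 0" if "z \<notin> \<int>" for z :: complex
    using that by (auto simp: sin_eq_0 Ints_def mult.commute)
  have o: "open (- \<int> :: complex set)" by (simp add: open_Compl)
  have psi: "Digamma w - Digamma (1 - w) = - of_real pi * cos (of_real pi * w) / sin (of_real pi * w)"
    if w: "w \<notin> \<int>" for w :: complex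
  proof -
    have 1: "((\<lambda>w. Gamma w * Gamma (1 - w)) has_field_derivative
      Gamma w * Gamma (1 - w) * (Digamma w - Digamma (1 - w))) (at w)"
      using nz[OF w] by (auto intro!: derivative_eq_intros simp: algebra_simps)
    have 2: "((\<lambda>w. of_real pi / sin (of_real pi * w)) has_field_derivative
       - (of_real pi)\<^sup>2 * cos (of_real pi * w) / (sin (of_real pi * w))\<^sup>2) (at w)"
      using s[OF w] by (auto intro!: derivative_eq_intros simp: power2_eq_square)
    have "Gamma w * Gamma (1 - w) * (Digamma w - Digamma (1 - w))
       = - (of_real pi)\<^sup>2 * cos (of_real pi * w) / (sin (of_real pi * w))\<^sup>2"
      by (rule DERIV_unique[OF 1]) (use 2 in \<open>simp add: Gamma_reflection_complex\<close>)
    also have "\<dots> = of_real pi / sin (of_real pi * w) * (- of_real pi * cos (of_real pi * w) / sin (of_real pi * w))"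
      by (simp add: power2_eq_square)
    finally show ?thesis unfolding Gamma_reflection_complex using s[OF w]
      by (subst (asm) mult_cancel_left) auto
  qed
  have "((\<lambda>w. Digamma w - Digamma (1 - w)) has_field_derivative
      Polygamma 1 z + Polygamma 1 (1 - z)) (at z)"
    using nz[OF z] by (auto intro!: derivative_eq_intros)
  moreover have "((\<lambda>w. - of_real pi * cos (of_real pi * w) / sin (of_real pi * w)) has_field_derivative
      (of_real pi / sin (of_real pi * z))\<^sup>2) (at z)"
    using s[OF z] sin_cos_squared_add[of "of_real pi * z"] by (auto intro!: derivative_eq_intros simp: divide_simps power2_eq_square)
      algebra+
  ultimately show ?thesis
    by (intro DERIV_unique[of "\<lambda>w. Digamma w - Digamma (1 - w)" _ z])
       (use has_field_derivative_cong_eventually psi o z in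
        \<open>auto elim!: has_field_derivative_transform_within_open[where S = "- \<int>"]\<close>)
qed

text \<open>Enumerating the negative integers as \<open>- 1 - int n\<close> counts 0 only once and
  fits the series of \<open>Polygamma\<close> at \<open>1 - z\<close>.\<close>

lemma has_sum_int_split:
  fixes f :: "int \<Rightarrow> 'a :: {banach}"
  assumes "summable (\<lambda>n. norm (f (int n)))" "summable (\<lambda>n. norm (f (- 1 - int n)))"
  shows "(f has_sum ((\<Sum>n. f (int n)) + (\<Sum>n. f (- 1 - int n)))) UNIV"
proof -
  have A: "(f has_sum (\<Sum>n. f (int n))) (range int)"
    by (subst has_sum_reindex)
       (use norm_summable_imp_has_sum[OF assms(1)] summable_norm_cancel[OF assms(1)] in \<open>auto simp: o_def\<close>)
  have B: "(f has_sum (\<Sum>n. f (- 1 - int n))) (range (\<lambda>n. - 1 - int n))"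
    by (subst has_sum_reindex)
       (use norm_summable_imp_has_sum[OF assms(2)] summable_norm_cancel[OF assms(2)] in \<open>auto simp: o_def inj_on_def\<close>)
  have "range int \<union> range (\<lambda>n. - 1 - int n) = UNIV"
  proof -
    have "m \<in> range int \<union> range (\<lambda>n. - 1 - int n)" for m
      by (cases "m \<ge> 0") (auto simp: image_iff intro: exI[of _ "nat m"] exI[of _ "nat (- 1 - m)"])
    then show ?thesis by blast
  qed
  moreover have "range int \<inter> range (\<lambda>n. - 1 - int n) = {}" by auto
  ultimately show ?thesis using has_sum_Un_disjoint[OF A B] by simp
qed

text \<open>Lipschitz's formula in weight 2. The nonnegative integers sum to
  \<open>Polygamma 1 z\<close>, the negative ones to \<open>Polygamma 1 (1 - z)\<close>, and the
  reflection formula turns the total into a function that is rational in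
  \<open>qe z\<close>.\<close>

lemma koebe_qe_pfd:
  assumes z: "z \<notin> \<int>"
  shows "((\<lambda>n. 1 / (z + of_int n)\<^sup>2) has_sum ((2 * of_real pi * \<i>)\<^sup>2 * koebe (qe z))) UNIV"
proof -
  have z0: "z \<noteq> 0" "1 - z \<noteq> 0" using z by auto
  have c: "summable (\<lambda>n. norm (1 / (w + of_nat n)\<^sup>2))" for w :: complex
  proof -
    have "summable (\<lambda>n. inverse (of_nat n ^ 2 :: real))"
      using inverse_power_summable[of 2, where ?'a = real] by simp
    then have s: "summable (\<lambda>n. 4 * inverse (of_nat n ^ 2 :: real))" by (rule summable_mult)
    have "eventually (\<lambda>n. norm (norm (1 / (w + of_nat n)\<^sup>2)) \<le> 4 * inverse (of_nat n ^ 2 :: real)) sequentially"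
      using eventually_ge_at_top[of "nat \<lceil>2 * norm w\<rceil> + 1"]
    proof eventually_elim
      case (elim n)
      then have n: "real n \<ge> 2 * norm w" "n > 0" by linarith+
      have "real n / 2 \<le> norm (w + of_nat n)"
        using norm_triangle_ineq2[of "of_nat n" "- w"] n by (simp add: add.commute)
      then have "(real n / 2)^2 \<le> norm (w + of_nat n)^2"
        by (intro power_mono) auto
      moreover have "(real n / 2)^2 > 0" using n by simp
      ultimately have "1 / norm (w + of_nat n)^2 \<le> 1 / (real n / 2)^2"
        by (intro divide_left_mono) (auto intro!: mult_pos_pos)
      then show ?case by (simp add: norm_divide norm_power divide_simps)
    qed
    then show ?thesis by (rule summable_comparison_test_ev[OF _ s])
  qed
  have e: "- 1 - of_nat n + z = - ((1 - z) + of_nat n)" for n by simp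
  have p: "(\<lambda>n. 1 / (w + of_nat n)\<^sup>2) sums Polygamma 1 w" if "w \<noteq> 0" for w :: complex
    using Polygamma_LIMSEQ[of w 1] that by (simp add: inverse_eq_divide power2_eq_square)
  have "((\<lambda>n. 1 / (z + of_int n)\<^sup>2) has_sum ((\<Sum>n. 1 / (z + of_int (int n))\<^sup>2) + (\<Sum>n. 1 / (z + of_int (- 1 - int n))\<^sup>2))) UNIV"
    using c[of z] c[of "1 - z"] by (intro has_sum_int_split) (auto simp: norm_minus_commute norm_divide norm_power algebra_simps)
  also have "(\<Sum>n. 1 / (z + of_int (int n))\<^sup>2) = Polygamma 1 z"
    using p[OF z0(1)] by (simp add: sums_iff)
  also have "(\<lambda>n. 1 / (z + of_int (- 1 - int n))\<^sup>2) = (\<lambda>n. 1 / ((1 - z) + of_nat n)\<^sup>2)"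
  proof
    fix n show "1 / (z + of_int (- 1 - int n))\<^sup>2 = 1 / ((1 - z) + of_nat n)\<^sup>2"
      using power2_commute[of "1 + of_nat n" z] by (simp add: algebra_simps)
  qed
  also have "suminf \<dots> = Polygamma 1 (1 - z)"
    using p[OF z0(2)] by (simp add: sums_iff)
  also have "Polygamma 1 z + Polygamma 1 (1 - z) = (of_real pi / sin (of_real pi * z))\<^sup>2"
    by (rule Polygamma_1_reflection[OF z])
  also have "\<dots> = (2 * of_real pi * \<i>)\<^sup>2 * koebe (qe z)"
  proof -
    \<comment> \<open>A square root of \<open>qe z\<close>, in which both the sine and the Koebe
      function are rational.\<close>
    define v where "v = exp (\<i> * (of_real pi * z))"
    have [simp]: "v \<noteq> 0" by (simp add: v_def)
    have q: "qe z = v^2" by (simp add: qe_def v_def power2_eq_square mult_ac flip: exp_add)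
    have "v^2 \<noteq> 1" using z q by (simp add: qe_eq_1_iff flip: q)
    then have nz: "1 - v^2 \<noteq> 0" "v^2 - 1 \<noteq> 0" by auto
    have s: "sin (of_real pi * z) = (v - inverse v) / (2 * \<i>)"
      by (simp add: sin_exp_eq v_def exp_minus)
    also have "\<dots> = (v^2 - 1) / (2 * \<i> * v)" by (simp add: field_simps power2_eq_square)
    finally show ?thesis using nz unfolding q koebe_def
      by (simp add: power_divide power_mult_distrib power2_commute[of 1 "v\<^sup>2"])
  qed
  finally show ?thesis .
qed

subsection \<open>The Weierstrass function as a series in $q$\<close>

text \<open>
  Up to the factor $(2\pi i)^2$ and an additive term depending only on \<open>t\<close>, this is the
  Weierstrass function of the lattice generated by \<open>t\<close> and 1. Its values at lattice points are junk.
\<close>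
definition wpq :: "complex \<Rightarrow> complex \<Rightarrow> complex" where
  "wpq z t = (\<Sum>\<^sub>\<infinity>m::int. koebe (qe (z + of_int m * t)))"

text \<open>For large \<open>m\<close> one of \<open>qe (z + of_int m * t)\<close> and its inverse
  is small, and \<open>koebe\<close> does not distinguish them. The bound depends on
  \<open>z\<close> and \<open>t\<close> only through \<open>B\<close> and \<open>d\<close>, as a
  dominating series for locally uniform convergence must.\<close>

lemma norm_koebe_qe_le:
  assumes d: "d > 0" and t: "Im t \<ge> d" and z: "\<bar>Im z\<bar> \<le> B" and m: "of_int \<bar>m\<bar> * d \<ge> B + 1"
  shows "norm (koebe (qe (z + of_int m * t))) \<le> 4 * exp (2 * pi * B) * exp (- 2 * pi * d) ^ nat \<bar>m\<bar>"
proof -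
  define u where "u = (if m \<ge> 0 then qe (z + of_int m * t) else qe (- (z + of_int m * t)))"
  have k: "koebe (qe (z + of_int m * t)) = koebe u"
    by (auto simp: u_def qe_minus koebe_inverse simp del: minus_add_distrib)
  have i: "of_int \<bar>m\<bar> * Im t \<ge> of_int \<bar>m\<bar> * d" using t by (intro mult_left_mono) auto
  have n: "norm u \<le> exp (- 2 * pi * (of_int \<bar>m\<bar> * d - B))"
  proof (cases "m \<ge> 0")
    case True
    then show ?thesis using i z by (auto simp: u_def norm_qe)
  next
    case False
    then have a: "real_of_int \<bar>m\<bar> = - real_of_int m" by simp
    have "- (real_of_int m * d) \<le> - (real_of_int m * Im t)" using i unfolding a by simp
    then have "- (real_of_int m * d) - B \<le> - Im z - real_of_int m * Im t" using z by linarith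
    then show ?thesis using False by (simp add: u_def norm_qe a)
  qed
  have "exp (- 2 * pi * (of_int \<bar>m\<bar> * d - B)) \<le> exp (- 2 * pi)"
    using m by simp
  also have "\<dots> \<le> exp (- 1)" using pi_ge_two by simp
  also have "exp (- 1 :: real) \<le> 1 / 2"
    using exp_ge_add_one_self[of 1] by (simp add: exp_minus field_simps)
  finally have "norm (koebe u) \<le> 4 * norm u" using n by (intro norm_koebe_le) simp
  also have "\<dots> \<le> 4 * exp (- 2 * pi * (of_int \<bar>m\<bar> * d - B))" using n by simp
  also have "\<dots> = 4 * (exp (2 * pi * B) * exp (real (nat \<bar>m\<bar>) * (- 2 * pi * d)))"
    by (simp add: algebra_simps flip: exp_add)
  also have "exp (real (nat \<bar>m\<bar>) * (- 2 * pi * d)) = exp (- 2 * pi * d) ^ nat \<bar>m\<bar>"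
    by (rule exp_of_nat_mult)
  finally show ?thesis by (simp add: k)
qed

lemma norm_koebe_le':
  assumes "norm u \<le> r" "r < 1" shows "norm (koebe u) \<le> norm u / (1 - r)\<^sup>2"
proof -
  have "1 - r \<le> norm (1 - u)"
    using norm_triangle_ineq2[of 1 u] assms by simp
  then have "(1 - r)\<^sup>2 \<le> norm (1 - u) ^ 2"
    using assms by (intro power_mono) auto
  then show ?thesis unfolding koebe_def norm_divide norm_power
    using assms by (intro divide_left_mono mult_pos_pos) (auto simp: zero_less_power2)
qed

section \<open>Convergence, periods and analyticity of the Weierstrass series\<close>

lemma summable_on_power_abs_int:
  fixes r :: real assumes "0 \<le> r" "r < 1"
  shows "(\<lambda>m::int. r ^ nat \<bar>m\<bar>) summable_on UNIV"
proof -
  have "summable (\<lambda>n. norm (r ^ nat \<bar>int n\<bar>))" using assms by (simp add: summable_geometric)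
  moreover have "summable (\<lambda>n. norm (r ^ nat \<bar>- 1 - int n\<bar>))"
  proof -
    have "nat \<bar>- 1 - int n\<bar> = Suc n" for n by simp
    then have "(\<lambda>n. norm (r ^ nat \<bar>- 1 - int n\<bar>)) = (\<lambda>n. r * r ^ n)" using assms by auto
    then show ?thesis using assms by (simp add: summable_mult summable_geometric)
  qed
  ultimately show ?thesis by (intro has_sum_imp_summable[OF has_sum_int_split])
qed

lemma finite_int_bounded: "finite {m::int. real_of_int \<bar>m\<bar> < C}"
proof (rule finite_subset)
  show "{m::int. real_of_int \<bar>m\<bar> < C} \<subseteq> {- \<lceil>C\<rceil>..\<lceil>C\<rceil>}"
  proof
    fix m :: int assume "m \<in> {m. real_of_int \<bar>m\<bar> < C}"
    then have "\<bar>m\<bar> < \<lceil>C\<rceil>" by (simp add: less_ceiling_iff)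
    then show "m \<in> {- \<lceil>C\<rceil>..\<lceil>C\<rceil>}" by auto
  qed
qed auto

lemma summable_on_int_cofinite_bound:
  fixes f g :: "int \<Rightarrow> real"
  assumes g: "g summable_on UNIV" and f: "\<And>m. real_of_int \<bar>m\<bar> \<ge> C \<Longrightarrow> 0 \<le> f m \<and> f m \<le> g m"
  shows "f summable_on UNIV"
proof -
  have "f summable_on {m. real_of_int \<bar>m\<bar> \<ge> C}"
    by (rule summable_on_comparison_test[of g])
       (use f summable_on_subset_banach[OF g] in auto)
  moreover have "f summable_on {m. real_of_int \<bar>m\<bar> < C}"
    using finite_int_bounded by (intro summable_on_finite)
  ultimately have "f summable_on ({m. real_of_int \<bar>m\<bar> \<ge> C} \<union> {m. real_of_int \<bar>m\<bar> < C})"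
    by (rule summable_on_union)
  also have "{m. real_of_int \<bar>m\<bar> \<ge> C} \<union> {m. real_of_int \<bar>m\<bar> < C} = (UNIV :: int set)" by auto
  finally show ?thesis .
qed

lemma wpq_abs_summable:
  assumes t: "Im t > 0"
  shows "(\<lambda>m::int. norm (koebe (qe (z + of_int m * t)))) summable_on UNIV"
proof (rule summable_on_int_cofinite_bound[where C = "(\<bar>Im z\<bar> + 1) / Im t"])
  show "(\<lambda>m. 4 * exp (2 * pi * \<bar>Im z\<bar>) * exp (- 2 * pi * Im t) ^ nat \<bar>m\<bar>) summable_on UNIV"
    using t by (intro summable_on_cmult_right summable_on_power_abs_int) auto
  fix m :: int assume "(\<bar>Im z\<bar> + 1) / Im t \<le> real_of_int \<bar>m\<bar>"
  then have "\<bar>Im z\<bar> + 1 \<le> real_of_int \<bar>m\<bar> * Im t"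
    using t by (subst (asm) pos_divide_le_eq) auto
  from norm_koebe_qe_le[OF t order_refl order_refl this]
  show "0 \<le> norm (koebe (qe (z + of_int m * t))) \<and> norm (koebe (qe (z + of_int m * t)))
     \<le> 4 * exp (2 * pi * \<bar>Im z\<bar>) * exp (- 2 * pi * Im t) ^ nat \<bar>m\<bar>"
    by (intro conjI norm_ge_zero)
qed

lemma wpq_has_sum:
  "Im t > 0 \<Longrightarrow> ((\<lambda>m. koebe (qe (z + of_int m * t))) has_sum wpq z t) UNIV"
  unfolding wpq_def by (rule has_sum_infsum[OF abs_summable_summable[OF wpq_abs_summable]])

lemma wpq_add_int [simp]: "wpq (z + of_int n) t = wpq z t"
proof -
  have "qe (z + of_int n + of_int m * t) = qe (z + of_int m * t)" for m
    using qe_add_int[of "z + of_int m * t" n] by (simp add: add_ac)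
  then show ?thesis by (simp add: wpq_def)
qed

lemma wpq_add_tau [simp]: "wpq (z + of_int n * t) t = wpq z t"
proof -
  have "wpq (z + of_int n * t) t = (\<Sum>\<^sub>\<infinity>m\<in>UNIV. koebe (qe (z + of_int (m + n) * t)))"
    by (simp add: wpq_def algebra_simps)
  also have "\<dots> = wpq z t" unfolding wpq_def
    by (rule infsum_reindex_bij_witness[of _ "\<lambda>m. m - n" "\<lambda>m. m + n"]) auto
  finally show ?thesis .
qed

lemma wpq_minus [simp]: "wpq (- z) t = wpq z t"
  unfolding wpq_def
proof (rule infsum_reindex_bij_witness[of _ uminus uminus])
  fix m :: int
  have "qe (z + of_int (- m) * t) = inverse (qe (- z + of_int m * t))"
    using qe_minus[of "- z + of_int m * t"] by simp
  then show "koebe (qe (z + of_int (- m) * t)) = koebe (qe (- z + of_int m * t))"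
    by (simp add: koebe_inverse)
qed auto

text \<open>Point and lattice vary together, because Weierstrass values will be functions of the
  modular variable. On a compact disc all but finitely many terms are dominated by a geometric
  series and the others are bounded by continuity, so that the Weierstrass test applies.\<close>

lemma wpq_holomorphic:
  assumes S: "open S" and z: "z holomorphic_on S" and t: "t holomorphic_on S"
    and pos: "\<And>s. s \<in> S \<Longrightarrow> Im (t s) > 0"
    and nl: "\<And>s m. s \<in> S \<Longrightarrow> z s + of_int m * t s \<notin> \<int>"
  shows "(\<lambda>s. wpq (z s) (t s)) holomorphic_on S"
proof -
  let ?f = "\<lambda>m s. koebe (qe (z s + of_int m * t s))"
  have fh: "?f m holomorphic_on S" for m
    unfolding koebe_def using nl[of _ m] by (intro holomorphic_intros z t) (auto simp: qe_eq_1_iff)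
  have "(\<lambda>s. wpq (z s) (t s)) analytic_on {s0}" if s0: "s0 \<in> S" for s0
  proof -
    obtain r where r: "r > 0" "cball s0 r \<subseteq> S" using S s0 open_contains_cball by blast
    have ct: "continuous_on (cball s0 r) t" "continuous_on (cball s0 r) z"
      using z t r holomorphic_on_imp_continuous_on continuous_on_subset by blast+
    have "\<exists>x\<in>cball s0 r. \<forall>y\<in>cball s0 r. Im (t x) \<le> Im (t y)"
      using r ct by (intro continuous_attains_inf continuous_intros) auto
    then obtain d where d: "d > 0" "\<And>s. s \<in> cball s0 r \<Longrightarrow> d \<le> Im (t s)"
      using pos r by blast
    have "\<exists>x\<in>cball s0 r. \<forall>y\<in>cball s0 r. \<bar>Im (z y)\<bar> \<le> \<bar>Im (z x)\<bar>"
      using r ct by (intro continuous_attains_sup continuous_intros) auto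
    then obtain B where B: "\<And>s. s \<in> cball s0 r \<Longrightarrow> \<bar>Im (z s)\<bar> \<le> B" by blast
    have "\<exists>M. \<forall>s\<in>cball s0 r. norm (?f m s) \<le> M" for m
    proof -
      have "continuous_on (cball s0 r) (?f m)"
        using fh r holomorphic_on_imp_continuous_on continuous_on_subset by blast
      then have "compact (?f m ` cball s0 r)" by (intro compact_continuous_image) auto
      then have "bounded (?f m ` cball s0 r)" by (rule compact_imp_bounded)
      then show ?thesis unfolding bounded_iff by auto
    qed
    then obtain M0 where M0: "\<And>m s. s \<in> cball s0 r \<Longrightarrow> norm (?f m s) \<le> M0 m" by metis
    define M where "M m = (if of_int \<bar>m\<bar> * d \<ge> B + 1 then 4 * exp (2 * pi * B) * exp (- 2 * pi * d) ^ nat \<bar>m\<bar>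
        else M0 m)" for m
    have Mb: "norm (?f m s) \<le> M m" if "s \<in> cball s0 r" for m s
      unfolding M_def using norm_koebe_qe_le[OF d(1) d(2)[OF that] B[OF that]] M0[OF that] by auto
    have Ms: "M summable_on UNIV"
    proof (rule summable_on_int_cofinite_bound[where C = "(B + 1) / d"])
      show "(\<lambda>m. 4 * exp (2 * pi * B) * exp (- 2 * pi * d) ^ nat \<bar>m\<bar>) summable_on UNIV"
        using d by (intro summable_on_cmult_right summable_on_power_abs_int) auto
      fix m :: int assume "(B + 1) / d \<le> real_of_int \<bar>m\<bar>"
      then have "B + 1 \<le> real_of_int \<bar>m\<bar> * d"
        using d by (subst (asm) pos_divide_le_eq) auto
      then show "0 \<le> M m \<and> M m \<le> 4 * exp (2 * pi * B) * exp (- 2 * pi * d) ^ nat \<bar>m\<bar>"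
        by (simp add: M_def)
    qed
    have u: "uniform_limit (cball s0 r) (\<lambda>X s. \<Sum>m\<in>X. ?f m s) (\<lambda>s. wpq (z s) (t s)) (finite_subsets_at_top UNIV)"
      unfolding wpq_def using Mb Ms by (intro Weierstrass_m_test_general) auto
    have "(\<lambda>s. wpq (z s) (t s)) holomorphic_on ball s0 r"
    proof (rule holomorphic_uniform_limit[OF _ u])
      have h: "(\<lambda>s. \<Sum>m\<in>X. ?f m s) holomorphic_on cball s0 r" for X
        using fh r by (intro holomorphic_on_sum) (auto intro: holomorphic_on_subset)
      then show "\<forall>\<^sub>F X in finite_subsets_at_top UNIV. continuous_on (cball s0 r) (\<lambda>s. \<Sum>m\<in>X. ?f m s) \<and>
          (\<lambda>s. \<Sum>m\<in>X. ?f m s) holomorphic_on ball s0 r"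
        using holomorphic_on_imp_continuous_on holomorphic_on_subset ball_subset_cball by blast
    qed auto
    then show ?thesis using r unfolding analytic_at_ball by blast
  qed
  then have "(\<lambda>s. wpq (z s) (t s)) analytic_on S" by (subst analytic_on_analytic_at) auto
  then show ?thesis by (rule analytic_imp_holomorphic)
qed

text \<open>Every integer is uniquely \<open>k + N * l\<close> with \<open>k < N\<close>; grouping
  the partial fractions of \<open>koebe (qe z)\<close> by \<open>k\<close> gives \<open>N\<close>
  rescaled copies of the same series.\<close>

lemma koebe_qe_mult:
  assumes z: "z \<notin> \<int>" and N: "N > 0"
  shows "(\<Sum>k<N. koebe (qe ((z + of_nat k) / of_nat N))) = of_nat N ^ 2 * koebe (qe z)"
proof -
  let ?C = "(2 * of_real pi * \<i>)\<^sup>2 :: complex"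
  have bij: "bij_betw (\<lambda>(k, l). int k + int N * l) ({..<N} \<times> UNIV) UNIV"
  proof (rule bij_betw_byWitness[where f' = "\<lambda>n. (nat (n mod int N), n div int N)"]; clarsimp?)
    show "nat (n mod int N) < N" for n using N by (simp add: nat_less_iff)
  qed (use N in auto)
  have "((\<lambda>n. 1 / (z + of_int n)\<^sup>2) has_sum (?C * koebe (qe z))) UNIV"
    by (rule koebe_qe_pfd[OF z])
  then have 1: "((\<lambda>(k, l). 1 / (z + of_int (int k + int N * l))\<^sup>2) has_sum (?C * koebe (qe z))) ({..<N} \<times> UNIV)"
    by (subst (asm) has_sum_reindex_bij_betw[OF bij, symmetric]) (simp add: case_prod_unfold)
  have 2: "((\<lambda>l. 1 / (z + of_int (int k + int N * l))\<^sup>2) has_sum (1 / of_nat N ^ 2 * (?C * koebe (qe ((z + of_nat k) / of_nat N))))) UNIV"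
    for k
  proof -
    have "(z + of_nat k) / of_nat N \<notin> \<int>"
    proof
      assume "(z + of_nat k) / of_nat N \<in> \<int>"
      then have "(z + of_nat k) / of_nat N * of_nat N - of_nat k \<in> \<int>" by (intro Ints_diff Ints_mult) auto
      with z N show False by simp
    qed
    from has_sum_cmult_right[OF koebe_qe_pfd[OF this], of "1 / of_nat N ^ 2"]
    have "((\<lambda>l. 1 / of_nat N ^ 2 * (1 / ((z + of_nat k) / of_nat N + of_int l)\<^sup>2)) has_sum
       (1 / of_nat N ^ 2 * (?C * koebe (qe ((z + of_nat k) / of_nat N))))) UNIV" .
    moreover have "1 / of_nat N ^ 2 * (1 / ((z + of_nat k) / of_nat N + of_int l)\<^sup>2) = 1 / (z + of_int (int k + int N * l))\<^sup>2" for l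
    proof -
      have "z + of_int (int k + int N * l) = of_nat N * ((z + of_nat k) / of_nat N + of_int l)"
        using N by (simp add: field_simps)
      then show ?thesis by (simp only: power_mult_distrib) simp
    qed
    ultimately show ?thesis by simp
  qed
  have "((\<lambda>k. 1 / of_nat N ^ 2 * (?C * koebe (qe ((z + of_nat k) / of_nat N)))) has_sum (?C * koebe (qe z))) {..<N}"
    by (rule has_sum_SigmaD[OF 1]) (use 2 in auto)
  then have "(\<Sum>k<N. 1 / of_nat N ^ 2 * (?C * koebe (qe ((z + of_nat k) / of_nat N)))) = ?C * koebe (qe z)"
    by (simp add: has_sum_finite_iff)
  then have "?C * (1 / of_nat N ^ 2 * (\<Sum>k<N. koebe (qe ((z + of_nat k) / of_nat N)))) = ?C * koebe (qe z)"
    by (simp only: sum_distrib_left) (simp add: mult_ac)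
  then have "1 / of_nat N ^ 2 * (\<Sum>k<N. koebe (qe ((z + of_nat k) / of_nat N))) = koebe (qe z)"
    by (subst (asm) mult_cancel_left) auto
  then show ?thesis using N by (simp add: field_simps)
qed

lemma has_sum_finite_sum:
  fixes f :: "'a \<Rightarrow> 'b \<Rightarrow> 'c :: topological_comm_monoid_add"
  assumes "\<And>k. k \<in> K \<Longrightarrow> (f k has_sum s k) A"
  shows "((\<lambda>x. \<Sum>k\<in>K. f k x) has_sum (\<Sum>k\<in>K. s k)) A"
  using assms by (induction K rule: infinite_finite_induct) (auto intro: has_sum_add)

text \<open>The distribution relation, row by row. It exchanges the lattice generated by
  \<open>t\<close> and 1, on which the modular group acts, for the one generated by
  \<open>of_nat N * t\<close> and 1, where multiples of \<open>t\<close> give expansions in integral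
  powers of \<open>qe t\<close>.\<close>

lemma wpq_mult:
  assumes N: "N > 0" and t: "Im t > 0" and nl: "\<And>m. z + of_int m * (of_nat N * t) \<notin> \<int>"
  shows "(\<Sum>k<N. wpq ((z + of_nat k) / of_nat N) t) = of_nat N ^ 2 * wpq z (of_nat N * t)"
proof -
  have "((\<lambda>m. \<Sum>k<N. koebe (qe ((z + of_nat k) / of_nat N + of_int m * t))) has_sum (\<Sum>k<N. wpq ((z + of_nat k) / of_nat N) t)) UNIV"
    using t by (intro has_sum_finite_sum wpq_has_sum)
  also have "(\<lambda>m. \<Sum>k<N. koebe (qe ((z + of_nat k) / of_nat N + of_int m * t))) =
     (\<lambda>m. of_nat N ^ 2 * koebe (qe (z + of_int m * (of_nat N * t))))"
  proof
    fix m
    have "(z + of_nat k) / of_nat N + of_int m * t = (z + of_int m * (of_nat N * t) + of_nat k) / of_nat N" for k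
      using N by (simp add: field_simps)
    then show "(\<Sum>k<N. koebe (qe ((z + of_nat k) / of_nat N + of_int m * t))) = of_nat N ^ 2 * koebe (qe (z + of_int m * (of_nat N * t)))"
      using koebe_qe_mult[OF nl N, of m] by simp
  qed
  finally have "((\<lambda>m. of_nat N ^ 2 * koebe (qe (z + of_int m * (of_nat N * t)))) has_sum (\<Sum>k<N. wpq ((z + of_nat k) / of_nat N) t)) UNIV" .
  moreover have "((\<lambda>m. of_nat N ^ 2 * koebe (qe (z + of_int m * (of_nat N * t)))) has_sum (of_nat N ^ 2 * wpq z (of_nat N * t))) UNIV"
    using N t by (intro has_sum_cmult_right wpq_has_sum) auto
  ultimately show ?thesis by (rule has_sum_unique)
qed

text \<open>In this strip only the terms with \<open>m = 0\<close> and \<open>m = - 1\<close> can be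
  large; the others are dominated by a geometric series in \<open>norm (qe t)\<close>. All limits
  and leading terms of Weierstrass values come from this estimate.\<close>

lemma wpq_approx:
  assumes z: "0 \<le> Im z" "Im z \<le> Im t" and t: "Im t > 0"
  shows "norm (wpq z t - koebe (qe z) - koebe (qe (t - z))) \<le> 2 * norm (qe t) / (1 - norm (qe t)) ^ 3"
proof -
  let ?f = "\<lambda>m. koebe (qe (z + of_int m * t))" and ?q = "norm (qe t)"
  have q: "?q < 1" using t by (simp add: norm_qe)
  have pw: "norm (qe (w + of_nat (Suc n) * t)) \<le> ?q ^ Suc n" if "Im w \<ge> 0" for n w
  proof -
    have "norm (qe (w + of_nat (Suc n) * t)) = norm (qe w) * ?q ^ Suc n"
      by (simp only: qe_add qe_of_nat_mult norm_mult norm_power)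
    also have "\<dots> \<le> 1 * ?q ^ Suc n"
      using that by (intro mult_right_mono) (auto simp: norm_qe)
    finally show ?thesis by simp
  qed
  have kb: "norm (koebe (qe (w + of_nat (Suc n) * t))) \<le> ?q / (1 - ?q)\<^sup>2 * ?q ^ n" if "Im w \<ge> 0" for n w
  proof -
    have "?q ^ Suc n \<le> ?q ^ 1" by (rule power_decreasing) (use q in auto)
    then have "norm (qe (w + of_nat (Suc n) * t)) \<le> ?q"
      using pw[OF that, of n] unfolding power_one_right by linarith
    from norm_koebe_le'[OF this q] have "norm (koebe (qe (w + of_nat (Suc n) * t))) \<le> norm (qe (w + of_nat (Suc n) * t)) / (1 - ?q)\<^sup>2" .
    also have "\<dots> \<le> ?q ^ Suc n / (1 - ?q)\<^sup>2" using pw[OF that, of n] by (rule divide_right_mono) simp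
    finally show ?thesis by simp
  qed
  have gs: "(\<lambda>n. ?q / (1 - ?q)\<^sup>2 * ?q ^ n) sums (?q / (1 - ?q)\<^sup>2 * (1 / (1 - ?q)))"
    using q by (intro sums_mult geometric_sums) simp
  have sm: "summable (\<lambda>n. norm (koebe (qe (w + of_nat (Suc n) * t))))"
    "norm (\<Sum>n. koebe (qe (w + of_nat (Suc n) * t))) \<le> ?q / (1 - ?q) ^ 3" if "Im w \<ge> 0" for w
  proof -
    show s: "summable (\<lambda>n. norm (koebe (qe (w + of_nat (Suc n) * t))))"
      by (rule summable_comparison_test'[OF sums_summable[OF gs]]) (use kb[OF that] in auto)
    have "norm (\<Sum>n. koebe (qe (w + of_nat (Suc n) * t))) \<le> (\<Sum>n. norm (koebe (qe (w + of_nat (Suc n) * t))))"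
      by (rule summable_norm[OF s])
    also have "\<dots> \<le> (\<Sum>n. ?q / (1 - ?q)\<^sup>2 * ?q ^ n)"
      using kb[OF that] s gs by (intro suminf_le) (auto simp: sums_iff)
    also have "\<dots> = ?q / (1 - ?q)\<^sup>2 * (1 / (1 - ?q))" using gs by (simp add: sums_iff)
    also have "\<dots> = ?q / (1 - ?q) ^ 3" by (simp add: power2_eq_square power3_eq_cube)
    finally show "norm (\<Sum>n. koebe (qe (w + of_nat (Suc n) * t))) \<le> ?q / (1 - ?q) ^ 3" by simp
  qed
  have neg: "?f (- 1 - int n) = koebe (qe ((t - z) + of_nat n * t))" for n
  proof -
    have "?f (- 1 - int n) = koebe (qe (- ((t - z) + of_nat n * t)))" by (simp add: algebra_simps)
    then show ?thesis by (simp only: qe_minus koebe_inverse)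
  qed
  have s1: "summable (\<lambda>n. norm (?f (int n)))"
    using sm(1)[OF z(1)] by (subst summable_Suc_iff[symmetric]) simp
  have s2: "summable (\<lambda>n. norm (?f (- 1 - int n)))"
    using sm(1)[of "t - z"] z(2) unfolding neg by (subst summable_Suc_iff[symmetric]) simp
  have "wpq z t = (\<Sum>n. ?f (int n)) + (\<Sum>n. ?f (- 1 - int n))"
    using has_sum_int_split[OF s1 s2] wpq_has_sum[OF t, of z] has_sum_unique by blast
  also have "(\<Sum>n. ?f (int n)) = koebe (qe z) + (\<Sum>n. koebe (qe (z + of_nat (Suc n) * t)))"
    using suminf_split_head[OF summable_norm_cancel[OF s1]] by simp
  also have "(\<Sum>n. ?f (- 1 - int n)) = koebe (qe (t - z)) + (\<Sum>n. koebe (qe ((t - z) + of_nat (Suc n) * t)))"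
    using suminf_split_head[OF summable_norm_cancel[OF s2]] unfolding neg by simp
  finally have "wpq z t - koebe (qe z) - koebe (qe (t - z)) =
     (\<Sum>n. koebe (qe (z + of_nat (Suc n) * t))) + (\<Sum>n. koebe (qe ((t - z) + of_nat (Suc n) * t)))"
    by simp
  also have "norm \<dots> \<le> ?q / (1 - ?q) ^ 3 + ?q / (1 - ?q) ^ 3"
    using sm(2)[OF z(1)] sm(2)[of "t - z"] z(2) by (intro norm_triangle_mono) auto
  finally show ?thesis by simp
qed

subsection \<open>Lattices and the transformation of differences of Weierstrass values\<close>

definition lattice :: "complex \<Rightarrow> complex set" where
  "lattice t = {of_int m * t + of_int n | m n. True}"

lemma latticeI [intro]: "of_int m * t + of_int n \<in> lattice t"
  by (auto simp: lattice_def)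

lemma lattice_0 [simp]: "0 \<in> lattice t"
  using latticeI[of 0 t 0] by simp

lemma lattice_add: "z \<in> lattice t \<Longrightarrow> w \<in> lattice t \<Longrightarrow> z + w \<in> lattice t"
proof -
  assume "z \<in> lattice t" "w \<in> lattice t"
  then obtain m n m' n' where "z = of_int m * t + of_int n" "w = of_int m' * t + of_int n'"
    by (auto simp: lattice_def)
  then have "z + w = of_int (m + m') * t + of_int (n + n')" by (simp add: algebra_simps)
  then show ?thesis by (simp only: latticeI)
qed

lemma lattice_minus: "z \<in> lattice t \<Longrightarrow> - z \<in> lattice t"
proof -
  assume "z \<in> lattice t"
  then obtain m n where "z = of_int m * t + of_int n"
    by (auto simp: lattice_def)
  then have "- z = of_int (- m) * t + of_int (- n)" by simp
  then show ?thesis by (simp only: latticeI)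
qed

lemma lattice_diff: "z \<in> lattice t \<Longrightarrow> w \<in> lattice t \<Longrightarrow> z - w \<in> lattice t"
  using lattice_add[of z t "- w"] lattice_minus[of w t] by simp

lemma notin_lattice_Ints: "z \<notin> lattice t \<Longrightarrow> z + of_int m * t \<notin> \<int>"
proof
  assume z: "z \<notin> lattice t" "z + of_int m * t \<in> \<int>"
  then obtain n where "z + of_int m * t = of_int n" by (elim Ints_cases)
  then have "z = of_int (- m) * t + of_int n" by (simp add: algebra_simps)
  with z(1) latticeI show False by blast
qed

lemma notin_lattice_nonzero: "z \<notin> lattice t \<Longrightarrow> z + of_int m * t + of_int n \<noteq> 0"
proof
  assume z: "z \<notin> lattice t" "z + of_int m * t + of_int n = 0"
  then have "z = of_int (- m) * t + of_int (- n)" by (simp add: add_eq_0_iff)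
  with z(1) latticeI show False by blast
qed

lemma norm_lattice_ge:
  assumes t: "Im t > 0"
  shows "of_int (\<bar>m\<bar> + \<bar>n\<bar>) \<le> ((1 + norm t) / Im t + 1) * norm (of_int m * t + of_int n)"
proof -
  let ?w = "of_int m * t + of_int n"
  have "of_int \<bar>m\<bar> * Im t = \<bar>Im ?w\<bar>" using t by (simp add: abs_mult)
  also have "\<dots> \<le> norm ?w" by (rule abs_Im_le_cmod)
  finally have m: "of_int \<bar>m\<bar> \<le> norm ?w / Im t" using t by (simp add: field_simps)
  have "norm (of_int n :: complex) \<le> norm ?w + norm (of_int m * t)"
    using norm_triangle_ineq4[of ?w "of_int m * t"] by simp
  then have n: "of_int \<bar>n\<bar> \<le> norm ?w + of_int \<bar>m\<bar> * norm t" by (simp add: norm_mult)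
  have "of_int \<bar>m\<bar> * (1 + norm t) \<le> norm ?w / Im t * (1 + norm t)"
    using m by (intro mult_right_mono) auto
  with n show ?thesis by (simp add: algebra_simps add_divide_distrib)
qed

text \<open>Far out, the shift by \<open>z\<close> costs at most half of the lower bound for lattice
  points. The finitely many remaining points are nonzero because \<open>z\<close> is not in the
  lattice, so a larger constant covers them.\<close>

lemma lattice_shift_ge:
  assumes t: "Im t > 0" and z: "z \<notin> lattice t"
  shows "\<exists>C>0. \<forall>m n. 1 + of_int (\<bar>m\<bar> + \<bar>n\<bar>) \<le> C * norm (z + of_int m * t + of_int n)"
proof -
  define K where "K = (1 + norm t) / Im t + 1"
  have K: "K \<ge> 1" using t by (simp add: K_def)
  define G where "G = 2 * K * norm z + 1"
  have G: "G \<ge> 1" using K by (simp add: G_def)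
  define F where "F = {(m::int, n::int). of_int (\<bar>m\<bar> + \<bar>n\<bar>) < G}"
  have "F \<subseteq> {m. real_of_int \<bar>m\<bar> < G} \<times> {n. real_of_int \<bar>n\<bar> < G}" by (auto simp: F_def)
  then have "finite F" by (rule finite_subset) (intro finite_cartesian_product finite_int_bounded)
  define f where "f = (\<lambda>(m::int, n::int). (1 + of_int (\<bar>m\<bar> + \<bar>n\<bar>)) / norm (z + of_int m * t + of_int n))"
  have "bdd_above (f ` F)" using \<open>finite F\<close> by auto
  then obtain C1 where C1: "\<And>p. p \<in> F \<Longrightarrow> f p \<le> C1" by (auto simp: bdd_above_def)
  define C where "C = max (4 * K) C1"
  have "1 + of_int (\<bar>m\<bar> + \<bar>n\<bar>) \<le> C * norm (z + of_int m * t + of_int n)" for m n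
  proof -
    let ?g = "real_of_int (\<bar>m\<bar> + \<bar>n\<bar>)" and ?w = "of_int m * t + of_int n"
    have pos: "norm (z + of_int m * t + of_int n) > 0" using notin_lattice_nonzero[OF z] by simp
    show ?thesis
    proof (cases "(m, n) \<in> F")
      case True
      then have "f (m, n) \<le> C" using C1 by (force simp: C_def)
      then show ?thesis using pos by (simp add: f_def field_simps)
    next
      case False
      then have g: "?g \<ge> G" by (simp add: F_def)
      have "?g \<le> K * norm ?w" using norm_lattice_ge[OF t, of m n] by (simp add: K_def)
      also have "norm ?w \<le> norm (z + ?w) + norm z"
        using norm_triangle_ineq4[of "z + ?w" z] by simp
      finally have "?g \<le> K * norm (z + ?w) + K * norm z" using K by (simp add: algebra_simps)
      then have "1 + ?g \<le> 4 * K * norm (z + ?w)" using g G unfolding G_def by linarith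
      also have "\<dots> \<le> C * norm (z + ?w)" by (intro mult_right_mono) (auto simp: C_def)
      finally show ?thesis by (simp add: add_ac)
    qed
  qed
  moreover have "C > 0" using K by (simp add: C_def)
  ultimately show ?thesis by blast
qed

lemma norm_inverse_square_diff_le:
  fixes a b :: complex
  assumes g: "g > 0" and a: "g \<le> A * norm a" and b: "g \<le> B * norm b" and A: "A > 0" and B: "B > 0"
  shows "norm (1 / a\<^sup>2 - 1 / b\<^sup>2) \<le> norm (b - a) * (A * B\<^sup>2 + A\<^sup>2 * B) / g ^ 3"
proof -
  have "a \<noteq> 0" using a g by (intro notI) simp
  then have na: "norm a > 0" by simp
  have "b \<noteq> 0" using b g by (intro notI) simp
  then have nb: "norm b > 0" by simp
  have ia: "1 / norm a \<le> A / g" using a g na by (simp add: divide_simps)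
  have ib: "1 / norm b \<le> B / g" using b g nb by (simp add: divide_simps)
  have nz: "a \<noteq> 0" "b \<noteq> 0" using na nb by auto
  have "1 / a\<^sup>2 - 1 / b\<^sup>2 = (b - a) * ((1 / a) * (1 / b) * (1 / b) + (1 / a) * (1 / a) * (1 / b))"
    using nz by (simp add: field_simps power2_eq_square)
  then have "norm (1 / a\<^sup>2 - 1 / b\<^sup>2) = norm (b - a) * norm ((1 / a) * (1 / b) * (1 / b) + (1 / a) * (1 / a) * (1 / b))"
    by (simp only: norm_mult)
  also have "\<dots> \<le> norm (b - a) * (A / g * (B / g) * (B / g) + A / g * (A / g) * (B / g))"
  proof (rule mult_left_mono)
    have "norm ((1 / a) * (1 / b) * (1 / b) + (1 / a) * (1 / a) * (1 / b)) \<le>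
       (1 / norm a) * (1 / norm b) * (1 / norm b) + (1 / norm a) * (1 / norm a) * (1 / norm b)"
      by (rule order.trans[OF norm_triangle_ineq]) (simp add: norm_mult norm_divide)
    also have "\<dots> \<le> A / g * (B / g) * (B / g) + A / g * (A / g) * (B / g)"
      using ia ib g A B by (intro add_mono mult_mono) (auto intro!: mult_nonneg_nonneg)
    finally show "norm ((1 / a) * (1 / b) * (1 / b) + (1 / a) * (1 / a) * (1 / b)) \<le>
       A / g * (B / g) * (B / g) + A / g * (A / g) * (B / g)" .
  qed auto
  also have "\<dots> = norm (b - a) * (A * B\<^sup>2 + A\<^sup>2 * B) / g ^ 3"
    using g by (simp add: field_simps power2_eq_square power3_eq_cube)
  finally show ?thesis .
qed

lemma summable_on_int_powr: "(\<lambda>m::int. (1 + of_int \<bar>m\<bar>) powr (- 3 / 2) :: real) summable_on UNIV"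
proof -
  have s: "summable (\<lambda>n. (of_nat n :: real) powr (- 3 / 2))" by (simp add: summable_real_powr_iff)
  have "summable (\<lambda>n. norm ((1 + of_int \<bar>int n\<bar>) powr (- 3 / 2) :: real))"
    using s by (subst (asm) summable_Suc_iff[symmetric]) (simp add: add_ac)
  moreover have "summable (\<lambda>n. norm ((1 + of_int \<bar>- 1 - int n\<bar>) powr (- 3 / 2) :: real))"
  proof -
    have "summable (\<lambda>n. (of_nat (Suc (Suc n)) :: real) powr (- 3 / 2))"
      using s by (subst summable_Suc_iff, subst summable_Suc_iff)
    moreover have "1 + of_int \<bar>- 1 - int n\<bar> = (of_nat (Suc (Suc n)) :: real)" for n by simp
    ultimately show ?thesis by simp
  qed
  ultimately show ?thesis by (intro has_sum_imp_summable[OF has_sum_int_split])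
qed

text \<open>The inverse squares over the lattice are not absolutely summable, but the differences
  decay like a cube. Since \<open>((1 + \<bar>m\<bar>) * (1 + \<bar>n\<bar>)) powr (3 / 2)\<close>
  is at most the cube of \<open>1 + \<bar>m\<bar> + \<bar>n\<bar>\<close>, a product of two
  convergent series dominates.\<close>

lemma lattice_diff_summable:
  assumes t: "Im t > 0" and z: "z \<notin> lattice t" and w: "w \<notin> lattice t"
  shows "(\<lambda>(m, n). 1 / (z + of_int m * t + of_int n)\<^sup>2 - 1 / (w + of_int m * t + of_int n)\<^sup>2) summable_on (UNIV \<times> UNIV)"
proof -
  define h where "h = (\<lambda>m::int. (1 + of_int \<bar>m\<bar>) powr (- 3 / 2) :: real)"
  obtain A where A: "A > 0" "\<And>m n. 1 + of_int (\<bar>m\<bar> + \<bar>n\<bar>) \<le> A * norm (z + of_int m * t + of_int n)"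
    using lattice_shift_ge[OF t z] by blast
  obtain B where B: "B > 0" "\<And>m n. 1 + of_int (\<bar>m\<bar> + \<bar>n\<bar>) \<le> B * norm (w + of_int m * t + of_int n)"
    using lattice_shift_ge[OF t w] by blast
  define C where "C = norm (w - z) * (A * B\<^sup>2 + A\<^sup>2 * B)"
  have C: "C \<ge> 0" using A B by (simp add: C_def)
  have hs: "h summable_on UNIV" unfolding h_def by (rule summable_on_int_powr)
  have "(\<lambda>p. C * (h (fst p) * h (snd p))) summable_on (UNIV \<times> UNIV)"
  proof (rule summable_on_SigmaI)
    fix m :: int
    show "((\<lambda>n. C * (h (fst (m, n)) * h (snd (m, n)))) has_sum (C * (h m * infsum h UNIV))) UNIV"
      using hs by (auto intro!: has_sum_cmult_right has_sum_infsum)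
  next
    show "(\<lambda>m. C * (h m * infsum h UNIV)) summable_on UNIV"
      using hs by (intro summable_on_cmult_right summable_on_cmult_left)
  qed (use C in \<open>auto simp: h_def\<close>)
  moreover have "norm (1 / (z + of_int m * t + of_int n)\<^sup>2 - 1 / (w + of_int m * t + of_int n)\<^sup>2) \<le> C * (h m * h n)" for m n
  proof -
    let ?g = "1 + of_int (\<bar>m\<bar> + \<bar>n\<bar>) :: real"
    have "norm (1 / (z + of_int m * t + of_int n)\<^sup>2 - 1 / (w + of_int m * t + of_int n)\<^sup>2) \<le> C / ?g ^ 3"
      using norm_inverse_square_diff_le[OF _ A(2) B(2) A(1) B(1), of m n] by (simp add: C_def)
    also have "\<dots> \<le> C * (h m * h n)"
    proof -
      have "(1 + of_int \<bar>m\<bar>) * (1 + of_int \<bar>n\<bar>) \<le> ?g * ?g"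
        by (intro mult_mono) auto
      then have "?g powr 3 \<ge> ((1 + of_int \<bar>m\<bar>) * (1 + of_int \<bar>n\<bar>)) powr (3 / 2)"
      proof -
        assume a: "(1 + of_int \<bar>m\<bar>) * (1 + of_int \<bar>n\<bar>) \<le> ?g * ?g"
        have "((1 + of_int \<bar>m\<bar>) * (1 + of_int \<bar>n\<bar>)) powr (3 / 2) \<le> (?g * ?g) powr (3 / 2)"
          using a by (intro powr_mono2) auto
        also have "?g * ?g = ?g powr 2" by (simp add: powr_numeral power2_eq_square)
        also have "\<dots> powr (3 / 2) = ?g powr 3" by (subst powr_powr) simp
        finally show ?thesis .
      qed
      moreover have "((1 + of_int \<bar>m\<bar>) * (1 + of_int \<bar>n\<bar>)) powr (3 / 2) > (0::real)"
        by (auto simp: add_pos_nonneg zero_less_mult_iff)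
      ultimately have "1 / (?g powr 3) \<le> 1 / (((1 + of_int \<bar>m\<bar>) * (1 + of_int \<bar>n\<bar>)) powr (3 / 2))"
        by (intro divide_left_mono mult_pos_pos) auto
      also have "\<dots> = h m * h n"
        by (simp add: h_def powr_mult powr_minus_divide)
      finally have "C * (1 / ?g ^ 3) \<le> C * (h m * h n)" using C by (intro mult_left_mono) (simp_all add: powr_numeral)
      then show ?thesis by simp
    qed
    finally show ?thesis .
  qed
  ultimately have "(\<lambda>p. norm ((\<lambda>(m, n). 1 / (z + of_int m * t + of_int n)\<^sup>2 - 1 / (w + of_int m * t + of_int n)\<^sup>2) p)) summable_on (UNIV \<times> UNIV)"
    by (elim summable_on_comparison_test) auto
  then show ?thesis by (rule abs_summable_summable)
qed

text \<open>Summing row by row recovers the Koebe series, while summability over the whole lattice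
  makes the value independent of the basis in which the lattice is enumerated.\<close>

lemma wpq_diff_has_sum:
  assumes t: "Im t > 0" and z: "z \<notin> lattice t" and w: "w \<notin> lattice t"
  shows "((\<lambda>(m, n). 1 / (z + of_int m * t + of_int n)\<^sup>2 - 1 / (w + of_int m * t + of_int n)\<^sup>2) has_sum
     ((2 * of_real pi * \<i>)\<^sup>2 * (wpq z t - wpq w t))) (UNIV \<times> UNIV)"
proof -
  let ?C = "(2 * of_real pi * \<i>)\<^sup>2 :: complex"
  let ?f = "\<lambda>(m, n). 1 / (z + of_int m * t + of_int n)\<^sup>2 - 1 / (w + of_int m * t + of_int n)\<^sup>2"
  have hd: "((\<lambda>x. f x - g x) has_sum (a - b)) A" if "(f has_sum a) A" "(g has_sum b) A" for f g :: "'z \<Rightarrow> complex" and a b A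
    using has_sum_add[OF that(1) has_sum_uminusI[OF that(2)]] by simp
  obtain S where S: "(?f has_sum S) (UNIV \<times> UNIV)"
    using lattice_diff_summable[OF t z w] summable_on_def by blast
  have "((\<lambda>m. ?C * koebe (qe (z + of_int m * t)) - ?C * koebe (qe (w + of_int m * t))) has_sum S) UNIV"
  proof (rule has_sum_SigmaD[OF S])
    fix m :: int
    show "((\<lambda>n. ?f (m, n)) has_sum (?C * koebe (qe (z + of_int m * t)) - ?C * koebe (qe (w + of_int m * t)))) UNIV"
      unfolding prod.case
      by (intro hd koebe_qe_pfd notin_lattice_Ints z w)
  qed
  moreover have "((\<lambda>m. ?C * koebe (qe (z + of_int m * t)) - ?C * koebe (qe (w + of_int m * t))) has_sum (?C * wpq z t - ?C * wpq w t)) UNIV"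
    using t by (intro hd has_sum_cmult_right wpq_has_sum)
  ultimately have "S = ?C * wpq z t - ?C * wpq w t" by (rule has_sum_unique)
  then have "S = ?C * (wpq z t - wpq w t)" by (simp only: right_diff_distrib)
  with S show ?thesis by simp
qed

lemma Im_moebius:
  fixes a b c d :: int
  assumes det: "a * d - b * c = 1" and t: "Im t > 0"
  shows "of_int c * t + of_int d \<noteq> 0"
    and "Im ((of_int a * t + of_int b) / (of_int c * t + of_int d)) = Im t / (norm (of_int c * t + of_int d))\<^sup>2"
proof -
  show nz: "of_int c * t + of_int d \<noteq> 0"
  proof
    assume *: "of_int c * t + of_int d = 0"
    from arg_cong[OF *, of Im] have "of_int c * Im t = 0" by simp
    with t have "c = 0" by simp
    with * have "d = 0" by simp
    with \<open>c = 0\<close> det show False by simp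
  qed
  have "Im ((of_int a * t + of_int b) / (of_int c * t + of_int d)) =
     (of_int (a * d - b * c) * Im t) / (norm (of_int c * t + of_int d))\<^sup>2"
    unfolding Im_divide cmod_power2 by (simp add: algebra_simps)
  then show "Im ((of_int a * t + of_int b) / (of_int c * t + of_int d)) = Im t / (norm (of_int c * t + of_int d))\<^sup>2"
    unfolding det by simp
qed

text \<open>The lattice of \<open>t'\<close> is that of \<open>t\<close> divided by
  \<open>e\<close>, with another basis, and the unordered sum does not see the basis. Differences
  are taken because \<open>wpq\<close> alone differs from the Weierstrass function by a term that is
  not modular.\<close>

lemma wpq_diff_moebius:
  fixes a b c d :: int
  assumes det: "a * d - b * c = 1" and t: "Im t > 0" and z: "z \<notin> lattice t" and w: "w \<notin> lattice t"
  defines "e \<equiv> of_int c * t + of_int d"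
  defines "t' \<equiv> (of_int a * t + of_int b) / e"
  shows "wpq (z / e) t' - wpq (w / e) t' = e\<^sup>2 * (wpq z t - wpq w t)"
proof -
  let ?C = "(2 * of_real pi * \<i>)\<^sup>2 :: complex"
  have e: "e \<noteq> 0" and "Im t' = Im t / (norm e)\<^sup>2"
    using Im_moebius[OF det t] by (auto simp: e_def t'_def)
  then have t': "Im t' > 0" using t by simp
  have eq: "x / e + of_int m * t' + of_int n = (x + of_int (m * a + n * c) * t + of_int (m * b + n * d)) / e" for x m n
  proof -
    have "x / e + of_int m * t' + of_int n = (x + of_int m * (of_int a * t + of_int b) + of_int n * e) / e"
      using e by (simp add: t'_def add_divide_distrib distrib_left)
    also have "x + of_int m * (of_int a * t + of_int b) + of_int n * e = x + of_int (m * a + n * c) * t + of_int (m * b + n * d)"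
      by (simp add: e_def algebra_simps)
    finally show ?thesis .
  qed
  have nl: "x / e \<notin> lattice t'" if x: "x \<notin> lattice t" for x
  proof
    assume "x / e \<in> lattice t'"
    then obtain m n where "x / e = of_int m * t' + of_int n" by (auto simp: lattice_def)
    then have "x / e + of_int (- m) * t' + of_int (- n) = 0" by simp
    then show False unfolding eq
      using e notin_lattice_nonzero[OF x, of "- m * a + - n * c" "- m * b + - n * d"] unfolding divide_eq_0_iff by blast
  qed
  let ?f = "\<lambda>(m, n). 1 / (z + of_int m * t + of_int n)\<^sup>2 - 1 / (w + of_int m * t + of_int n)\<^sup>2"
  let ?g = "\<lambda>(m, n). 1 / (z / e + of_int m * t' + of_int n)\<^sup>2 - 1 / (w / e + of_int m * t' + of_int n)\<^sup>2"
  have 1: "(?g has_sum (?C * (wpq (z / e) t' - wpq (w / e) t'))) (UNIV \<times> UNIV)"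
    by (rule wpq_diff_has_sum[OF t' nl[OF z] nl[OF w]])
  have det': "a * (d * m - c * n) + c * (a * n - b * m) = m" "b * (d * m - c * n) + d * (a * n - b * m) = n"
    "d * (a * m + c * n) - c * (b * m + d * n) = m" "a * (b * m + d * n) - b * (a * m + c * n) = n" for m n
  proof -
    have "a * (d * m - c * n) + c * (a * n - b * m) = (a * d - b * c) * m" "b * (d * m - c * n) + d * (a * n - b * m) = (a * d - b * c) * n"
      "d * (a * m + c * n) - c * (b * m + d * n) = (a * d - b * c) * m" "a * (b * m + d * n) - b * (a * m + c * n) = (a * d - b * c) * n"
      by algebra+
    then show "a * (d * m - c * n) + c * (a * n - b * m) = m" "b * (d * m - c * n) + d * (a * n - b * m) = n"
    "d * (a * m + c * n) - c * (b * m + d * n) = m" "a * (b * m + d * n) - b * (a * m + c * n) = n"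
      unfolding det by simp_all
  qed
  have 2: "(?g has_sum (e\<^sup>2 * (?C * (wpq z t - wpq w t)))) (UNIV \<times> UNIV) \<longleftrightarrow>
     ((\<lambda>p. e\<^sup>2 * ?f p) has_sum (e\<^sup>2 * (?C * (wpq z t - wpq w t)))) (UNIV \<times> UNIV)"
  proof (rule has_sum_reindex_bij_witness[of _ "\<lambda>(m, n). (d * m - c * n, a * n - b * m)" "\<lambda>(m, n). (a * m + c * n, b * m + d * n)"])
    fix p :: "int \<times> int"
    obtain m n where p: "p = (m, n)" by (cases p)
    show "e\<^sup>2 * ?f (case p of (m, n) \<Rightarrow> (a * m + c * n, b * m + d * n)) = ?g p"
      unfolding p prod.case eq using e by (simp add: power_divide right_diff_distrib mult.commute)
  qed (use det' in auto)
  have "((\<lambda>p. e\<^sup>2 * ?f p) has_sum (e\<^sup>2 * (?C * (wpq z t - wpq w t)))) (UNIV \<times> UNIV)"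
    by (intro has_sum_cmult_right wpq_diff_has_sum t z w)
  with 1 2 have "?C * (wpq (z / e) t' - wpq (w / e) t') = e\<^sup>2 * (?C * (wpq z t - wpq w t))"
    using has_sum_unique by blast
  then have "?C * (wpq (z / e) t' - wpq (w / e) t') = ?C * (e\<^sup>2 * (wpq z t - wpq w t))"
    by (simp only: mult.left_commute)
  then show ?thesis by (subst (asm) mult_cancel_left) auto
qed

subsection \<open>Values at half periods\<close>

lemma wpq_lattice_add: "w \<in> lattice t \<Longrightarrow> wpq (z + w) t = wpq z t"
proof -
  assume "w \<in> lattice t"
  then obtain m n where w: "w = of_int m * t + of_int n" by (auto simp: lattice_def)
  have "wpq (z + w) t = wpq ((z + of_int m * t) + of_int n) t" by (simp add: w add_ac)
  then show ?thesis by simp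
qed

lemma lattice_discrete:
  assumes t: "Im t > 0"
  shows "\<exists>r>0. \<forall>w\<in>lattice t. norm w < r \<longrightarrow> w = 0"
proof -
  define K where "K = (1 + norm t) / Im t + 1"
  have K: "K > 0" using t by (auto simp: K_def intro!: add_nonneg_pos divide_nonneg_pos)
  have "w = 0" if w: "w \<in> lattice t" "norm w < 1 / K" for w
  proof -
    obtain m n where mn: "w = of_int m * t + of_int n" using w by (auto simp: lattice_def)
    have "K * norm w < 1" using w K by (simp add: field_simps)
    with norm_lattice_ge[OF t, of m n] have "real_of_int (\<bar>m\<bar> + \<bar>n\<bar>) < 1" by (simp add: K_def mn)
    then have "\<bar>m\<bar> + \<bar>n\<bar> < 1" by linarith
    then have "m = 0 \<and> n = 0" by arith
    then show ?thesis using mn by simp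
  qed
  then show ?thesis using K by (intro exI[of _ "1 / K"]) auto
qed

lemma closed_lattice:
  assumes "Im t > 0" shows "closed (lattice t)"
proof -
  obtain r where r: "r > 0" "\<And>w. w \<in> lattice t \<Longrightarrow> norm w < r \<Longrightarrow> w = 0"
    using lattice_discrete[OF assms] by blast
  show ?thesis
    by (rule discrete_imp_closed[OF r(1)]) (use r(2) lattice_diff in \<open>force simp: dist_norm\<close>)
qed

lemma lattice_half: "z \<in> lattice (t / 2) \<longleftrightarrow> z \<in> lattice t \<or> z - t / 2 \<in> lattice t"
proof
  assume "z \<in> lattice (t / 2)"
  then obtain m n where z: "z = of_int m * (t / 2) + of_int n" by (auto simp: lattice_def)
  show "z \<in> lattice t \<or> z - t / 2 \<in> lattice t"
  proof (cases "even m")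
    case True
    then obtain k where "m = 2 * k" by auto
    then have "z = of_int k * t + of_int n" using z by simp
    then show ?thesis by blast
  next
    case False
    then obtain k where "m = 2 * k + 1" by (elim oddE)
    then have "z - t / 2 = of_int k * t + of_int n" using z by (simp add: field_simps)
    then show ?thesis by (metis latticeI)
  qed
next
  assume "z \<in> lattice t \<or> z - t / 2 \<in> lattice t"
  then show "z \<in> lattice (t / 2)"
  proof
    assume "z \<in> lattice t"
    then obtain m n where "z = of_int m * t + of_int n" by (auto simp: lattice_def)
    then have "z = of_int (2 * m) * (t / 2) + of_int n" by simp
    then show ?thesis by (metis latticeI)
  next
    assume "z - t / 2 \<in> lattice t"
    then obtain m n where "z - t / 2 = of_int m * t + of_int n" by (auto simp: lattice_def)
    then have "z = of_int (2 * m + 1) * (t / 2) + of_int n" by (simp add: field_simps)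
    then show ?thesis by (metis latticeI)
  qed
qed

section \<open>Local behaviour at double poles and double zeros\<close>

lemma qe_deriv: "(qe has_field_derivative 2 * of_real pi * \<i> * qe z) (at z)"
  unfolding qe_def by (auto intro!: derivative_eq_intros)

lemma koebe_qe_double_pole: "((\<lambda>z. z\<^sup>2 * koebe (qe z)) \<longlongrightarrow> 1 / (2 * of_real pi * \<i>)\<^sup>2) (at 0)"
proof -
  have 1: "((\<lambda>z. (qe z - 1) / z) \<longlongrightarrow> 2 * of_real pi * \<i>) (at 0)"
    using qe_deriv[of 0] unfolding has_field_derivative_iff by simp
  have 2: "(qe \<longlongrightarrow> 1) (at 0)"
    using DERIV_isCont[OF qe_deriv[of 0]] by (simp add: isCont_def)
  have "((\<lambda>z. qe z / ((qe z - 1) / z)\<^sup>2) \<longlongrightarrow> 1 / (2 * of_real pi * \<i>)\<^sup>2) (at 0)"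
    by (intro tendsto_divide tendsto_power 1 2) auto
  then show ?thesis
  proof (rule Lim_transform_eventually)
    show "\<forall>\<^sub>F z in at 0. qe z / ((qe z - 1) / z)\<^sup>2 = z\<^sup>2 * koebe (qe z)"
      by (auto simp: eventually_at_filter koebe_def power_divide power2_commute[of "1::complex"])
  qed
qed

lemma norm_wpq_le:
  assumes t: "Im t > 0" and z: "\<bar>Im z\<bar> \<le> Im t"
  shows "norm (wpq z t) \<le> norm (koebe (qe z)) + norm (koebe (qe (t - z))) + norm (koebe (qe (t + z)))
     + 2 * norm (qe t) / (1 - norm (qe t)) ^ 3"
proof -
  have *: "norm (wpq z t) \<le> norm (koebe (qe z)) + norm (koebe (qe (t - z)))
     + 2 * norm (qe t) / (1 - norm (qe t)) ^ 3" if "Im z \<ge> 0" "Im z \<le> Im t" for z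
  proof -
    have "wpq z t = (wpq z t - koebe (qe z) - koebe (qe (t - z))) + koebe (qe z) + koebe (qe (t - z))" by simp
    also have "norm \<dots> \<le> norm (wpq z t - koebe (qe z) - koebe (qe (t - z))) + norm (koebe (qe z)) + norm (koebe (qe (t - z)))"
      by (intro norm_triangle_mono order_refl)
    finally show ?thesis using wpq_approx[OF that t] by linarith
  qed
  show ?thesis
  proof (cases "Im z \<ge> 0")
    case True
    then show ?thesis using *[of z] z norm_ge_zero[of "koebe (qe (t + z))"] by linarith
  next
    case False
    have "koebe (qe (- z)) = koebe (qe z)" by (simp add: qe_minus koebe_inverse)
    then have "norm (wpq z t) \<le> norm (koebe (qe z)) + norm (koebe (qe (t + z)))
       + 2 * norm (qe t) / (1 - norm (qe t)) ^ 3" using *[of "- z"] z False by simp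
    then show ?thesis using norm_ge_zero[of "koebe (qe (t - z))"] by linarith
  qed
qed

lemma tendsto_imp_eventually_bounded:
  fixes f :: "'a \<Rightarrow> complex"
  assumes "(f \<longlongrightarrow> l) F" shows "\<exists>B. eventually (\<lambda>z. norm (f z) \<le> B) F"
proof -
  have "eventually (\<lambda>z. norm (f z) < norm l + 1) F"
    by (rule order_tendstoD(2)[OF tendsto_norm[OF assms]]) simp
  then have "eventually (\<lambda>z. norm (f z) \<le> norm l + 1) F" by eventually_elim simp
  then show ?thesis by blast
qed

text \<open>Evenness forces the derivative at 0 to vanish as well, so the zero has order at least
  two; two difference quotients remove it.\<close>

lemma even_holomorphic_double_zero:
  assumes r: "r > 0" and s: "s holomorphic_on ball 0 r" and ev: "\<And>z. s (- z) = s z" and s0: "s 0 = 0"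
  shows "\<exists>B. eventually (\<lambda>z. norm (s z / z\<^sup>2) \<le> B) (at 0)"
proof -
  have "(s has_field_derivative deriv s 0) (at 0)"
    using s r by (intro holomorphic_derivI[of _ "ball 0 r"]) auto
  then have 1: "((\<lambda>z. s (- z)) has_field_derivative deriv s 0 * (- 1)) (at 0)"
    by (intro DERIV_chain2[of s _ "\<lambda>z. - z"]) (auto intro!: derivative_eq_intros)
  then have "deriv s 0 = deriv s 0 * (- 1)"
    using \<open>(s has_field_derivative deriv s 0) (at 0)\<close> unfolding ev by (rule DERIV_unique[rotated])
  then have d0: "deriv s 0 = 0" by simp
  define g where "g = (\<lambda>z. if z = 0 then deriv s 0 else (s z - s 0) / (z - 0))"
  have g: "g holomorphic_on ball 0 r" unfolding g_def using r by (intro pole_lemma s) auto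
  define k where "k = (\<lambda>z. if z = 0 then deriv g 0 else (g z - g 0) / (z - 0))"
  have k: "k holomorphic_on ball 0 r" unfolding k_def using r by (intro pole_lemma g) auto
  have "isCont k 0"
    using k r by (intro continuous_on_interior[of "ball 0 r"] holomorphic_on_imp_continuous_on) auto
  then obtain B where B: "eventually (\<lambda>z. norm (k z) \<le> B) (at 0)"
    using tendsto_imp_eventually_bounded unfolding isCont_def by blast
  have "eventually (\<lambda>z. k z = s z / z\<^sup>2) (at 0)"
    by (auto simp: eventually_at_filter k_def g_def s0 d0 power2_eq_square)
  with B have "eventually (\<lambda>z. norm (s z / z\<^sup>2) \<le> B) (at 0)" by eventually_elim simp
  then show ?thesis by blast
qed

text \<open>
  The product of \<open>wpq z t - e\<close> with its translate by \<open>t / 2\<close> extends to a bounded entire function: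
  the double pole of each factor meets the double zero of the other. A further zero of
  \<open>wpq z t - e\<close> would make that constant vanish.
\<close>
theorem wpq_half_period_unique:
  assumes t: "Im t > 0" and z0: "z0 \<notin> lattice t" "z0 - t / 2 \<notin> lattice t"
  shows "wpq z0 t \<noteq> wpq (t / 2) t"
proof
  assume eq: "wpq z0 t = wpq (t / 2) t"
  define e where "e = wpq (t / 2) t"
  define p where "p = (\<lambda>z. wpq z t)"
  define s where "s = (\<lambda>z. p (z + t / 2) - e)"
  define h where "h = (\<lambda>z. (p z - e) * s z)"
  \<comment> \<open>The poles of both factors of \<open>h\<close>. Translation by
    \<open>t / 2\<close> exchanges the factors, so all of \<open>H\<close> consists of periods of
    \<open>h\<close>, and its singularities need to be examined only near 0.\<close>
  define H where "H = lattice (t / 2)"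
  have t2: "Im (t / 2) > 0" using t by simp
  have cH: "closed H" unfolding H_def by (rule closed_lattice[OF t2])
  have cL: "closed (lattice t)" by (rule closed_lattice[OF t])
  have LH: "lattice t \<subseteq> H" unfolding H_def using lattice_half by blast
  have half: "t / 2 \<notin> lattice t"
  proof
    assume "t / 2 \<in> lattice t"
    then obtain m n where "t / 2 = of_int m * t + of_int n" by (auto simp: lattice_def)
    from arg_cong[OF this, of Im] have "(2 * real_of_int m - 1) * Im t = 0" by (simp add: algebra_simps)
    then have "real_of_int (2 * m) = real_of_int 1" using t by simp
    then have "2 * m = 1" unfolding of_int_eq_iff .
    then show False by presburger
  qed
  have phol: "p holomorphic_on - lattice t"
    unfolding p_def using cL t by (intro wpq_holomorphic) (auto simp: notin_lattice_Ints)
  have p_per: "p (z + w) = p z" if "w \<in> lattice t" for z w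
    unfolding p_def using that by (rule wpq_lattice_add)
  have p_ev: "p (- z) = p z" for z by (simp add: p_def)
  have tL: "t \<in> lattice t" using latticeI[of 1 t 0] by simp
  have shol: "s holomorphic_on - H"
  proof -
    have "p \<circ> (\<lambda>z. z + t / 2) holomorphic_on - H"
    proof (rule holomorphic_on_compose_gen[OF _ phol])
      show "(\<lambda>z. z + t / 2) ` (- H) \<subseteq> - lattice t"
        using lattice_diff[OF _ tL] unfolding H_def
        by (force simp: lattice_half)
    qed (auto intro!: holomorphic_intros)
    then show ?thesis unfolding s_def by (intro holomorphic_intros) (simp add: o_def)
  qed
  have hhol: "h holomorphic_on - H"
    unfolding h_def using phol LH shol by (intro holomorphic_intros) (auto intro: holomorphic_on_subset)
  have h_per: "h (z + w) = h z" if w: "w \<in> H" for z w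
  proof -
    from w consider "w \<in> lattice t" | "w - t / 2 \<in> lattice t" unfolding H_def lattice_half by blast
    then show ?thesis
    proof cases
      case 1
      then show ?thesis using p_per[OF 1, of z] p_per[OF 1, of "z + t / 2"] by (simp add: h_def s_def add_ac)
    next
      case 2
      have "p (z + w) = p (z + t / 2)" using p_per[OF 2, of "z + t / 2"] by simp
      moreover have "p (z + w + t / 2) = p z"
        using p_per[OF lattice_add[OF 2 tL], of z] by (simp add: algebra_simps)
      ultimately show ?thesis by (simp add: h_def s_def)
    qed
  qed
  obtain r where r: "r > 0" and rH: "\<And>w. w \<in> H \<Longrightarrow> norm w < r \<Longrightarrow> w = 0"
    using lattice_discrete[OF t2] unfolding H_def by blast
  \<comment> \<open>The point \<open>t / 2\<close> is its own negative modulo the lattice; hence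
    \<open>s\<close> is even about 0, and its zero there is double.\<close>
  have s_ev: "s (- z) = s z" for z
  proof -
    have "z - t / 2 + t = z + t / 2" by (simp add: field_simps)
    then have "p (z + t / 2) = p (z - t / 2)" using p_per[OF tL, of "z - t / 2"] by (simp only:)
    also have "\<dots> = p (- z + t / 2)" using p_ev[of "z - t / 2"] by simp
    finally show ?thesis by (simp add: s_def)
  qed
  have p_bd: "\<exists>B. eventually (\<lambda>z. norm (z\<^sup>2 * (p z - e)) \<le> B) (at 0)"
  proof -
    have nt: "t \<notin> \<int>" using t by (auto simp: Ints_def)
    have c1: "((\<lambda>z. koebe (qe (t - z))) \<longlongrightarrow> koebe (qe (t - 0))) (at 0)"
      unfolding koebe_def qe_def
      by (intro tendsto_intros) (use nt in \<open>auto simp: qe_eq_1_iff simp flip: qe_def\<close>)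
    have c2: "((\<lambda>z. koebe (qe (t + z))) \<longlongrightarrow> koebe (qe (t + 0))) (at 0)"
      unfolding koebe_def qe_def
      by (intro tendsto_intros) (use nt in \<open>auto simp: qe_eq_1_iff simp flip: qe_def\<close>)
    obtain B1 where B1: "eventually (\<lambda>z. norm (z\<^sup>2 * koebe (qe z)) \<le> B1) (at 0)"
      using tendsto_imp_eventually_bounded[OF koebe_qe_double_pole] by blast
    obtain B2 where B2: "eventually (\<lambda>z. norm (koebe (qe (t - z))) \<le> B2) (at 0)"
      using tendsto_imp_eventually_bounded[OF c1] by blast
    obtain B3 where B3: "eventually (\<lambda>z. norm (koebe (qe (t + z))) \<le> B3) (at 0)"
      using tendsto_imp_eventually_bounded[OF c2] by blast
    define C where "C = 2 * norm (qe t) / (1 - norm (qe t)) ^ 3 + norm e"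
    have "eventually (\<lambda>z::complex. dist z 0 < min 1 (Im t)) (at 0)"
      using t by (intro eventually_at_in_open'[of "ball 0 (min 1 (Im t))" 0, simplified, THEN eventually_mono]) (auto simp: dist_norm)
    with B1 B2 B3 have "eventually (\<lambda>z. norm (z\<^sup>2 * (p z - e)) \<le> B1 + \<bar>B2 + B3 + C\<bar>) (at 0)"
    proof eventually_elim
      case (elim z)
      then have z: "norm z < 1" "\<bar>Im z\<bar> \<le> Im t" using abs_Im_le_cmod[of z] by (auto simp: dist_norm)
      have "norm (p z - e) \<le> norm (p z) + norm e" by (rule norm_triangle_ineq4)
      also have "\<dots> \<le> norm (koebe (qe z)) + (B2 + B3 + C)"
        using norm_wpq_le[OF t z(2)] elim unfolding p_def C_def by linarith
      finally have "norm (p z - e) \<le> norm (koebe (qe z)) + \<bar>B2 + B3 + C\<bar>" by linarith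
      then have "norm (z\<^sup>2) * norm (p z - e) \<le> norm (z\<^sup>2) * (norm (koebe (qe z)) + \<bar>B2 + B3 + C\<bar>)"
        by (intro mult_left_mono) auto
      also have "\<dots> = norm (z\<^sup>2 * koebe (qe z)) + norm (z\<^sup>2) * \<bar>B2 + B3 + C\<bar>"
        by (simp add: norm_mult algebra_simps)
      also have "\<dots> \<le> B1 + 1 * \<bar>B2 + B3 + C\<bar>"
        using elim z(1) by (intro add_mono mult_right_mono) (auto simp: norm_power intro!: power_le_one)
      finally show ?case by (simp add: norm_mult)
    qed
    then show ?thesis by blast
  qed
  have s0: "s 0 = 0" by (simp add: s_def e_def p_def)
  have shol0: "s holomorphic_on ball 0 r"
  proof -
    have "p \<circ> (\<lambda>z. z + t / 2) holomorphic_on ball 0 r"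
    proof (rule holomorphic_on_compose_gen[OF _ phol])
      have "z + t / 2 \<notin> lattice t" if "norm z < r" for z
      proof
        assume *: "z + t / 2 \<in> lattice t"
        then have "z - t / 2 \<in> lattice t" using lattice_diff[OF _ tL, of "z + t / 2"] by simp
        then have "z \<in> H" unfolding H_def lattice_half by blast
        then have "z = 0" using rH that by blast
        with * half show False by simp
      qed
      then show "(\<lambda>z. z + t / 2) ` ball 0 r \<subseteq> - lattice t" by auto
    qed (auto intro!: holomorphic_intros)
    then show ?thesis unfolding s_def by (intro holomorphic_intros) (simp add: o_def)
  qed
  have hbd: "\<exists>B. eventually (\<lambda>z. norm (h z) \<le> B) (at 0)"
  proof -
    obtain B1 where B1: "eventually (\<lambda>z. norm (z\<^sup>2 * (p z - e)) \<le> B1) (at 0)" using p_bd by blast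
    obtain B2 where B2: "eventually (\<lambda>z. norm (s z / z\<^sup>2) \<le> B2) (at 0)"
      using even_holomorphic_double_zero[OF r shol0 s_ev s0] by blast
    have "eventually (\<lambda>z::complex. z \<noteq> 0) (at 0)" by (simp add: eventually_at_filter)
    with B1 B2 have "eventually (\<lambda>z. norm (h z) \<le> \<bar>B1\<bar> * \<bar>B2\<bar>) (at 0)"
    proof eventually_elim
      case (elim z)
      have "h z = (z\<^sup>2 * (p z - e)) * (s z / z\<^sup>2)" using elim by (simp add: h_def)
      then have "norm (h z) = norm (z\<^sup>2 * (p z - e)) * norm (s z / z\<^sup>2)" by (simp only: norm_mult)
      also have "\<dots> \<le> \<bar>B1\<bar> * \<bar>B2\<bar>" using elim by (intro mult_mono) auto
      finally show ?case .
    qed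
    then show ?thesis by blast
  qed
  have "h holomorphic_on ball 0 r - {0}"
    by (rule holomorphic_on_subset[OF hhol]) (use rH in auto)
  then have "\<exists>g. g holomorphic_on ball 0 r \<and> (\<forall>z\<in>ball 0 r - {0}. g z = h z)"
    using r hbd by (subst holomorphic_on_extend_bounded) auto
  then obtain g0 where g0: "g0 holomorphic_on ball 0 r" "\<And>z. z \<in> ball 0 r - {0} \<Longrightarrow> g0 z = h z" by blast
  define g where "g = (\<lambda>z. if z \<in> H then g0 0 else h z)"
  have H0: "0 \<in> H" and Hdiff: "\<And>a b. a \<in> H \<Longrightarrow> b \<in> H \<Longrightarrow> a - b \<in> H" and Hadd: "\<And>a b. a \<in> H \<Longrightarrow> b \<in> H \<Longrightarrow> a + b \<in> H"
    by (auto simp: H_def intro: lattice_diff lattice_add)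
  have g_per: "g (z + w) = g z" if w: "w \<in> H" for z w
  proof -
    have "z + w \<in> H \<longleftrightarrow> z \<in> H" using Hadd[OF _ w, of z] Hdiff[OF _ w, of "z + w"] by auto
    then show ?thesis by (simp add: g_def h_per[OF w])
  qed
  have ghol: "g holomorphic_on UNIV"
  proof -
    have "g analytic_on {w}" for w
    proof (cases "w \<in> H")
      case False
      have "h analytic_on {w}" using hhol False cH by (subst analytic_at) (auto intro!: exI[of _ "- H"])
      moreover have "eventually (\<lambda>z. z \<in> - H) (nhds w)" using cH False by (intro eventually_nhds_in_open) auto
      then have "eventually (\<lambda>z. h z = g z) (nhds w)" by eventually_elim (simp add: g_def)
      ultimately show ?thesis by (subst (asm) analytic_at_cong[OF _ refl])
    next
      case True
      have "(\<lambda>z. g0 (z - w)) holomorphic_on ball w r"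
      proof -
        have "g0 \<circ> (\<lambda>z. z - w) holomorphic_on ball w r"
          by (rule holomorphic_on_compose_gen[OF _ g0(1)]) (auto intro!: holomorphic_intros simp: dist_norm norm_minus_commute)
        then show ?thesis by (simp add: o_def)
      qed
      moreover have "g z = g0 (z - w)" if z: "z \<in> ball w r" for z
      proof (cases "z = w")
        case True
        then show ?thesis using \<open>w \<in> H\<close> by (simp add: g_def)
      next
        case False
        have n: "norm (z - w) < r" using z by (simp add: dist_norm norm_minus_commute)
        have "z - w \<notin> H" using rH[of "z - w"] n False by auto
        then have "z \<notin> H" using Hdiff \<open>w \<in> H\<close> by blast
        then have "g z = h (z - w)" using h_per[OF \<open>w \<in> H\<close>, of "z - w"] by (simp add: g_def)
        also have "\<dots> = g0 (z - w)" using g0(2)[of "z - w"] n False by simp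
        finally show ?thesis .
      qed
      ultimately have "g holomorphic_on ball w r" by (metis (no_types, lifting) holomorphic_transform)
      then show ?thesis unfolding analytic_at_ball using r by blast
    qed
    then have "g analytic_on UNIV" by (subst analytic_on_analytic_at) auto
    then show ?thesis by (rule analytic_imp_holomorphic)
  qed
  have gbd: "bounded (range g)"
  proof -
    \<comment> \<open>Subtracting a multiple of \<open>t / 2\<close> settles the imaginary part, and
      then an integer settles the real part; hence this rectangle meets every class modulo
      \<open>H\<close> even if \<open>t\<close> is not purely imaginary.\<close>
    define P where "P = cbox 0 (Complex 1 (Im t / 2))"
    have "compact (g ` P)"
      unfolding P_def by (intro compact_continuous_image compact_cbox holomorphic_on_imp_continuous_on holomorphic_on_subset[OF ghol]) auto
    moreover have "range g \<subseteq> g ` P"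
    proof clarify
      fix z
      define m where "m = \<lfloor>Im z / (Im t / 2)\<rfloor>"
      define x where "x = z - of_int m * (t / 2)"
      define n where "n = \<lfloor>Re x\<rfloor>"
      define y where "y = x - of_int n"
      have zy: "z = y + (of_int m * (t / 2) + of_int n)" by (simp add: x_def y_def)
      have "of_int m * (Im t / 2) \<le> Im z" "Im z \<le> (of_int m + 1) * (Im t / 2)"
        using t floor_divide_lower[of "Im t / 2" "Im z"] floor_divide_upper[of "Im t / 2" "Im z"] by (auto simp: m_def)
      then have "0 \<le> Im y" "Im y \<le> Im t / 2" by (auto simp: y_def x_def algebra_simps)
      moreover have "0 \<le> Re y" "Re y \<le> 1" unfolding y_def n_def by (auto; linarith)+
      ultimately have "y \<in> P" by (auto simp: P_def in_cbox_complex_iff)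
      moreover have "g z = g y" unfolding zy by (rule g_per) (unfold H_def, rule latticeI)
      ultimately show "g z \<in> g ` P" by auto
    qed
    ultimately show ?thesis using compact_imp_bounded bounded_subset by blast
  qed
  have "g constant_on UNIV" by (rule Liouville_theorem[OF ghol gbd])
  then have gc: "g z = g w" for z w by (auto simp: constant_on_def)
  have z0H: "z0 \<notin> H" using z0 unfolding H_def lattice_half by blast
  have "g z0 = 0" using z0H eq by (simp add: g_def h_def p_def e_def)
  then have h0: "h z = 0" if "z \<notin> H" for z using gc[of z z0] that by (simp add: g_def)
  \<comment> \<open>The open strip between two neighbouring rows of \<open>H\<close> avoids
    \<open>H\<close>, is connected and has 0 on its boundary. There one of the two factors of
    \<open>h\<close> vanishes identically, and the reflection \<open>t / 2 - z\<close> carries the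
    vanishing of \<open>s\<close> to that of \<open>p z - e\<close>.\<close>
  define U where "U = {z. 0 < Im z} \<inter> {z. Im z < Im t / 2}"
  have U: "open U" "convex U" unfolding U_def
    by (rule open_Int convex_Int open_halfspace_Im_gt open_halfspace_Im_lt convex_halfspace_Im_gt convex_halfspace_Im_lt)+
  have UH: "z \<notin> H" if "z \<in> U" for z
  proof
    assume "z \<in> H"
    then obtain m n where "z = of_int m * (t / 2) + of_int n" by (auto simp: H_def lattice_def)
    then have "Im z = of_int m * (Im t / 2)" by simp
    with that t have "0 < real_of_int m" "real_of_int m < 1"
      by (auto simp: U_def zero_less_mult_iff mult_less_cancel_right1 dest: less_imp_not_less)
    then show False by simp
  qed
  have pU: "p z = e" if z: "z \<in> U" for z
  proof (rule ccontr)
    assume ne: "p z \<noteq> e"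
    have pc: "continuous_on U p"
      using phol UH LH by (intro holomorphic_on_imp_continuous_on holomorphic_on_subset[OF phol]) auto
    define V where "V = {w \<in> U. p w \<noteq> e}"
    have "open V"
    proof -
      have "V = p -` (- {e}) \<inter> U" by (auto simp: V_def)
      then show ?thesis using pc U(1) by (simp add: continuous_on_open_vimage open_Compl)
    qed
    have sV: "s w = 0" if "w \<in> V" for w using h0[of w] that UH by (auto simp: V_def h_def)
    have "s w = 0" if "w \<in> U" for w
    proof (rule analytic_continuation_open[of V U s "\<lambda>_. 0"])
      show "s holomorphic_on U" using UH by (intro holomorphic_on_subset[OF shol]) auto
    qed (use \<open>open V\<close> U z ne sV that convex_connected in \<open>auto simp: V_def\<close>)
    moreover have "t / 2 - z \<in> U" using z by (auto simp: U_def)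
    ultimately have "p (t / 2 - z + t / 2) = e" by (fastforce simp: s_def)
    also have "t / 2 - z + t / 2 = - z + t" by (simp add: field_simps)
    finally show False using p_per[OF tL, of "- z"] p_ev[of z] ne by metis
  qed
  \<comment> \<open>If \<open>p\<close> is constant on the strip, then \<open>koebe (qe z)\<close>
    stays bounded as 0 is approached from inside, which contradicts its double pole.\<close>
  have "((\<lambda>z. z\<^sup>2 * koebe (qe z)) \<longlongrightarrow> 0) (at 0 within U)"
  proof -
    have nt: "t \<notin> \<int>" using t by (auto simp: Ints_def)
    define C where "C = 2 * norm (qe t) / (1 - norm (qe t)) ^ 3"
    have c: "((\<lambda>z. norm (z\<^sup>2) * (norm e + norm (koebe (qe (t - z))) + C)) \<longlongrightarrow> norm (0\<^sup>2 :: complex) * (norm e + norm (koebe (qe (t - 0))) + C)) (at 0 within U)"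
      unfolding koebe_def qe_def
      by (intro tendsto_intros) (use nt in \<open>auto simp: qe_eq_1_iff simp flip: qe_def\<close>)
    show ?thesis
    proof (rule Lim_null_comparison)
      show "((\<lambda>z. norm (z\<^sup>2) * (norm e + norm (koebe (qe (t - z))) + C)) \<longlongrightarrow> 0) (at 0 within U)" using c by simp
      have "norm (z\<^sup>2 * koebe (qe z)) \<le> norm (z\<^sup>2) * (norm e + norm (koebe (qe (t - z))) + C)" if "z \<in> U" for z
      proof -
        have i: "0 \<le> Im z" "Im z \<le> Im t" using that t by (auto simp: U_def)
        have "koebe (qe z) = p z - koebe (qe (t - z)) - (p z - koebe (qe z) - koebe (qe (t - z)))" by simp
        also have "norm \<dots> \<le> norm (p z) + norm (koebe (qe (t - z))) + norm (p z - koebe (qe z) - koebe (qe (t - z)))"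
          by (metis (no_types, lifting) add_right_mono norm_triangle_ineq4 order_trans)
        also have "\<dots> \<le> norm e + norm (koebe (qe (t - z))) + C"
          using wpq_approx[OF i t] pU[OF that] by (simp add: C_def p_def)
        finally show ?thesis unfolding norm_mult by (rule mult_left_mono) simp
      qed
      then show "\<forall>\<^sub>F z in at 0 within U. norm (z\<^sup>2 * koebe (qe z)) \<le> norm (z\<^sup>2) * (norm e + norm (koebe (qe (t - z))) + C)"
        by (auto simp: eventually_at_filter)
    qed
  qed
  moreover have "((\<lambda>z. z\<^sup>2 * koebe (qe z)) \<longlongrightarrow> 1 / (2 * of_real pi * \<i>)\<^sup>2) (at 0 within U)"
    by (rule tendsto_within_subset[OF koebe_qe_double_pole]) auto
  moreover have "at 0 within U \<noteq> bot"
  proof -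
    have "0 islimpt U" unfolding islimpt_approachable
    proof (intro allI impI)
      fix \<epsilon> :: real assume "\<epsilon> > 0"
      then show "\<exists>x'\<in>U. x' \<noteq> 0 \<and> dist x' 0 < \<epsilon>"
        using t by (intro bexI[of _ "Complex 0 (min \<epsilon> (Im t / 2) / 2)"]) (auto simp: U_def complex_eq_iff dist_norm cmod_def min_def)
    qed
    then show ?thesis by (simp add: trivial_limit_within)
  qed
  ultimately have "0 = 1 / (2 * of_real pi * \<i>)\<^sup>2" using tendsto_unique by blast
  then show False by simp
qed

subsection \<open>Expansions at infinity\<close>

abbreviation at_ioo :: "complex filter" where
  "at_ioo \<equiv> filtercomap Im at_top"

lemma eventually_at_ioo: "eventually P at_ioo \<longleftrightarrow> (\<exists>Y. \<forall>z. Im z \<ge> Y \<longrightarrow> P z)"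
  unfolding eventually_filtercomap_at_top_linorder by blast

lemma at_ioo_neq_bot [simp]: "at_ioo \<noteq> bot"
proof -
  have "\<exists>z. Im z \<ge> Y" for Y by (intro exI[of _ "Complex 0 Y"]) simp
  then show ?thesis unfolding trivial_limit_def eventually_at_ioo by auto
qed

lemma eventually_upper_half_plane: "eventually (\<lambda>z. z \<in> upper_half_plane) at_ioo"
  unfolding eventually_at_ioo upper_half_plane_def by (intro exI[of _ 1]) auto

lemma open_upper_half_plane [simp]: "open upper_half_plane"
  unfolding upper_half_plane_def by (rule open_halfspace_Im_gt)

lemma convex_upper_half_plane [simp]: "convex upper_half_plane"
  unfolding upper_half_plane_def by (rule convex_halfspace_Im_gt)

lemma qe_surj:
  assumes w: "w \<noteq> 0" and h: "h > 0"
  shows "qe (of_nat h * Ln w / (2 * of_real pi * \<i>) / of_nat h) = w"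
    and "Im (of_nat h * Ln w / (2 * of_real pi * \<i>)) = - (real h * ln (norm w) / (2 * pi))"
proof -
  have "2 * of_real pi * \<i> * (of_nat h * Ln w / (2 * of_real pi * \<i>) / of_nat h) = Ln w"
    using h by simp
  then show "qe (of_nat h * Ln w / (2 * of_real pi * \<i>) / of_nat h) = w"
    using w by (simp add: qe_def)
  have "of_nat h * Ln w / (2 * of_real pi * \<i>) = - (of_real (real h / (2 * pi)) * (\<i> * Ln w))"
    by (simp add: field_simps)
  then show "Im (of_nat h * Ln w / (2 * of_real pi * \<i>)) = - (real h * ln (norm w) / (2 * pi))"
    using w by (simp add: Re_Ln)
qed

text \<open>An equality of filters is wanted, since both limits and eventual bounds have to pass
  from the cusp to the disc and back.\<close>

lemma filtermap_qe:
  assumes h: "h > 0"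
  shows "filtermap (\<lambda>z. qe (z / of_nat h)) at_ioo = at 0"
proof (rule antisym)
  show "filtermap (\<lambda>z. qe (z / of_nat h)) at_ioo \<le> at 0"
    unfolding filterlim_def[symmetric]
  proof (rule filterlim_atI)
    show "((\<lambda>z. qe (z / of_nat h)) \<longlongrightarrow> 0) at_ioo"
    proof (rule tendsto_norm_zero_cancel)
      have "((\<lambda>y. exp (- 2 * pi * (y / real h))) \<longlongrightarrow> 0) at_top"
        using h by real_asymp
      then have "((\<lambda>z. exp (- 2 * pi * (Im z / real h))) \<longlongrightarrow> 0) at_ioo"
        by (rule filterlim_compose) (rule filterlim_filtercomap)
      then show "((\<lambda>z. norm (qe (z / of_nat h))) \<longlongrightarrow> 0) at_ioo"
        by (simp add: norm_qe)
    qed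
  qed auto
  show "at 0 \<le> filtermap (\<lambda>z. qe (z / of_nat h)) at_ioo"
  proof (rule filter_leI)
    fix P assume "eventually P (filtermap (\<lambda>z. qe (z / of_nat h)) at_ioo)"
    then obtain Y where Y: "\<And>z. Im z \<ge> Y \<Longrightarrow> P (qe (z / of_nat h))"
      by (auto simp: eventually_filtermap eventually_at_ioo)
    define r where "r = exp (- (2 * pi * Y / real h))"
    have "P w" if w: "w \<noteq> 0" "norm w < r" for w
    proof -
      have "ln (norm w) \<le> ln r" using w by (subst ln_le_cancel_iff) (auto simp: r_def)
      then have "- (real h * ln (norm w) / (2 * pi)) \<ge> Y" using h by (simp add: r_def field_simps)
      then show ?thesis using Y qe_surj[OF w(1) h] by metis
    qed
    then show "eventually P (at 0)"
      unfolding eventually_at by (intro exI[of _ r]) (auto simp: r_def dist_norm)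
  qed
qed

lemma has_q_expansion_alt:
  "has_q_expansion h f F \<longleftrightarrow> fls_conv_radius F \<ge> 1 \<and> (\<forall>z\<in>upper_half_plane. f z = eval_fls F (qe (z / of_nat h)))"
  by (simp add: has_q_expansion_def qe_def)

lemma norm_qe_less_1: "z \<in> upper_half_plane \<Longrightarrow> h > 0 \<Longrightarrow> norm (qe (z / of_nat h)) < 1"
  by (simp add: norm_qe upper_half_plane_def)

text \<open>After multiplication by \<open>w powi (- n)\<close> the series either has no negative
  exponents and tends to its constant term, or it has a pole and is unbounded. So a limit, or merely
  a bound, already controls the coefficients.\<close>

lemma eval_fls_tendsto_iff:
  assumes F: "fls_conv_radius F \<ge> 1"
  shows "((\<lambda>w. eval_fls F w * w powi (- n)) \<longlongrightarrow> L) (at 0) \<longleftrightarrow> (\<forall>j<n. fls_nth F j = 0) \<and> fls_nth F n = L"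
    and "eventually (\<lambda>w. norm (eval_fls F w * w powi (- n)) \<le> B) (at 0) \<Longrightarrow> (\<forall>j<n. fls_nth F j = 0)"
proof -
  define G where "G = fls_shift n F"
  have "fls_conv_radius F > 0" using F by (rule less_le_trans[rotated]) simp
  then have Fx: "eval_fls F has_laurent_expansion F" by (rule eval_fls_has_laurent_expansion)
  have ev: "eventually (\<lambda>w. eval_fls F w * w powi (- n) = eval_fls G w) (at 0)"
  proof -
    have "eventually (\<lambda>w::complex. w \<noteq> 0) (at 0)" by (simp add: eventually_at_filter)
    then show ?thesis
      by eventually_elim (simp add: G_def eval_fls_shift power_int_minus divide_inverse)
  qed
  have "fls_conv_radius G > 0" using F unfolding G_def fls_conv_radius_shift by (rule less_le_trans[rotated]) simp
  then have G: "eval_fls G has_laurent_expansion G" by (rule eval_fls_has_laurent_expansion)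
  have sub: "(\<forall>j<n. fls_nth F j = 0) \<longleftrightarrow> fls_subdegree G \<ge> 0"
  proof
    assume *: "\<forall>j<n. fls_nth F j = 0"
    then show "fls_subdegree G \<ge> 0"
      by (cases "G = 0") (auto intro!: fls_subdegree_geI simp: G_def)
  next
    assume "fls_subdegree G \<ge> 0"
    then have "fls_nth G j = 0" if "j < 0" for j using that by (intro fls_eq0_below_subdegree) auto
    from this[of "_ - n"] show "\<forall>j<n. fls_nth F j = 0" by (simp add: G_def)
  qed
  have 1: "(eval_fls G \<longlongrightarrow> fls_nth F n) (at 0)" if "\<forall>j<n. fls_nth F j = 0"
    using has_laurent_expansion_imp_tendsto_0[OF G] that sub by (simp add: G_def)
  have 2: "\<forall>j<n. fls_nth F j = 0" if "eventually (\<lambda>w. norm (eval_fls G w) \<le> B) (at 0)" for B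
  proof (rule ccontr)
    assume "\<not> ?thesis"
    then have "fls_subdegree G < 0" using sub by auto
    then have "filterlim (eval_fls G) at_infinity (at 0)"
      by (intro has_laurent_expansion_imp_filterlim_infinity_0[OF G]) auto
    then have "eventually (\<lambda>w. norm (eval_fls G w) \<ge> \<bar>B\<bar> + 1) (at 0)"
      unfolding filterlim_at_infinity[OF order_refl] by (auto simp: add_nonneg_pos)
    with that have "eventually (\<lambda>w::complex. False) (at 0)" by eventually_elim auto
    then show False by simp
  qed
  show "eventually (\<lambda>w. norm (eval_fls F w * w powi (- n)) \<le> B) (at 0) \<Longrightarrow> (\<forall>j<n. fls_nth F j = 0)"
    using 2[of B] eventually_elim2[OF _ ev, of "\<lambda>w. norm (eval_fls F w * w powi (- n)) \<le> B" "\<lambda>w. norm (eval_fls G w) \<le> B"]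
    by fastforce
  have "((\<lambda>w. eval_fls F w * w powi (- n)) \<longlongrightarrow> L) (at 0) \<longleftrightarrow> (eval_fls G \<longlongrightarrow> L) (at 0)"
    by (rule tendsto_cong[OF ev])
  also have "\<dots> \<longleftrightarrow> (\<forall>j<n. fls_nth F j = 0) \<and> fls_nth F n = L"
  proof
    assume L: "(eval_fls G \<longlongrightarrow> L) (at 0)"
    then have "\<forall>j<n. fls_nth F j = 0" using tendsto_imp_eventually_bounded 2 by blast
    moreover from this have "fls_nth F n = L" using 1 L tendsto_unique[of "at 0"] by (metis trivial_limit_at)
    ultimately show "(\<forall>j<n. fls_nth F j = 0) \<and> fls_nth F n = L" by blast
  qed (use 1 in auto)
  finally show "((\<lambda>w. eval_fls F w * w powi (- n)) \<longlongrightarrow> L) (at 0) \<longleftrightarrow> (\<forall>j<n. fls_nth F j = 0) \<and> fls_nth F n = L" .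
qed

text \<open>This is the bridge by which the conditions on coefficients in the definitions of the
  spaces are handled as limits along \<open>at_ioo\<close>.\<close>

lemma has_q_expansion_tendsto_iff:
  assumes f: "has_q_expansion h f F" and h: "h > 0"
  shows "((\<lambda>z. f z * qe (z / of_nat h) powi (- n)) \<longlongrightarrow> L) at_ioo \<longleftrightarrow> (\<forall>j<n. fls_nth F j = 0) \<and> fls_nth F n = L"
proof -
  have F: "fls_conv_radius F \<ge> 1" and eq: "\<And>z. z \<in> upper_half_plane \<Longrightarrow> f z = eval_fls F (qe (z / of_nat h))"
    using f by (auto simp: has_q_expansion_alt)
  have "((\<lambda>z. f z * qe (z / of_nat h) powi (- n)) \<longlongrightarrow> L) at_ioo \<longleftrightarrow>
      ((\<lambda>z. (\<lambda>w. eval_fls F w * w powi (- n)) (qe (z / of_nat h))) \<longlongrightarrow> L) at_ioo"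
    by (rule tendsto_cong) (use eventually_upper_half_plane in eventually_elim, simp add: eq)
  also have "\<dots> \<longleftrightarrow> ((\<lambda>w. eval_fls F w * w powi (- n)) \<longlongrightarrow> L) (at 0)"
    unfolding filtermap_qe[OF h, symmetric] filterlim_filtermap ..
  also note eval_fls_tendsto_iff(1)[OF F]
  finally show ?thesis .
qed

lemma has_q_expansion_unique:
  assumes f: "has_q_expansion h f F" "has_q_expansion h f G" and h: "h > 0"
  shows "F = G"
proof (rule has_laurent_expansion_unique)
  have F: "fls_conv_radius F > 0" and G: "fls_conv_radius G > 0"
    using f by (auto simp: has_q_expansion_alt intro: less_le_trans[rotated])
  show "eval_fls F has_laurent_expansion F" using F by (rule eval_fls_has_laurent_expansion)
  have "eventually (\<lambda>w. eval_fls G w = eval_fls F w) (at 0)"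
    unfolding filtermap_qe[OF h, symmetric] eventually_filtermap
    using eventually_upper_half_plane by eventually_elim (use f in \<open>auto simp: has_q_expansion_alt\<close>)
  then show "eval_fls F has_laurent_expansion G"
    unfolding has_laurent_expansion_def using G by (auto simp: eq_commute)
qed

lemma periodic_of_int:
  fixes f :: "complex \<Rightarrow> 'a"
  assumes per: "\<And>z. z \<in> upper_half_plane \<Longrightarrow> f (z + of_nat h) = f z" and z: "z \<in> upper_half_plane"
  shows "f (z + of_int k * of_nat h) = f z"
proof -
  have *: "f (z + of_nat n * of_nat h) = f z" if "z \<in> upper_half_plane" for n z
    using that
  proof (induction n)
    case (Suc n)
    have "z + of_nat n * of_nat h \<in> upper_half_plane" using Suc.prems by (simp add: upper_half_plane_def)
    from per[OF this] Suc show ?case by (simp add: algebra_simps)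
  qed simp
  show ?thesis
  proof (cases "k \<ge> 0")
    case True
    then show ?thesis using *[OF z, of "nat k"] by simp
  next
    case False
    have "z + of_int k * of_nat h \<in> upper_half_plane" using z by (simp add: upper_half_plane_def)
    from *[OF this, of "nat (- k)"] False show ?thesis by simp
  qed
qed

text \<open>Off the negative axis the principal logarithm inverts the exponential; across its cut a
  second branch is used, and periodicity makes the two agree.\<close>

lemma periodic_descends_to_disc:
  assumes f: "f holomorphic_on upper_half_plane" and h: "h > 0"
    and per: "\<And>z. z \<in> upper_half_plane \<Longrightarrow> f (z + of_nat h) = f z"
  obtains g where "g holomorphic_on ball 0 1 - {0}" "\<And>z. z \<in> upper_half_plane \<Longrightarrow> f z = g (qe (z / of_nat h))"
proof -
  define c where "c = of_nat h / (2 * of_real pi * \<i>)"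
  define g where "g = (\<lambda>w. f (c * Ln w))"
  have c0: "c \<noteq> 0" using h by (simp add: c_def)
  have inH: "c * Ln w \<in> upper_half_plane" if w: "w \<noteq> 0" "norm w < 1" for w
  proof -
    have "ln (norm w) < 0" using w by simp
    then have "Im (c * Ln w) > 0"
      using qe_surj(2)[OF w(1) h] h by (simp add: c_def mult_less_0_iff divide_less_0_iff)
    then show ?thesis by (simp add: upper_half_plane_def)
  qed
  have g_eq: "f z = g w" if z: "z \<in> upper_half_plane" "qe (z / of_nat h) = w" for z w
  proof -
    have w: "w \<noteq> 0" "norm w < 1" using z norm_qe_less_1[OF _ h] by auto
    have "exp (Ln w) = exp (z / c)"
      using z w h by (simp add: qe_def c_def mult_ac)
    then obtain k :: int where k: "Ln w = z / c + (of_int (2 * k) * pi) * \<i>"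
      unfolding exp_eq by auto
    have "c * Ln w = z + of_int k * of_nat h" using c0 h unfolding k by (simp add: distrib_left) (simp add: c_def)
    then show ?thesis using periodic_of_int[of f h, OF per z(1), of k] by (simp add: g_def)
  qed
  have "g analytic_on {w}" if w: "w \<in> ball 0 1 - {0}" for w
  proof -
    have f_an: "f analytic_on {z}" if "z \<in> upper_half_plane" for z
      using f that by (subst analytic_at) (auto intro!: exI[of _ upper_half_plane])
    show ?thesis
    proof (cases "w \<in> \<real>\<^sub>\<le>\<^sub>0")
      case False
      have "(f \<circ> (\<lambda>w. c * Ln w)) analytic_on {w}"
        by (rule analytic_on_compose) (use False inH[of w] w f_an in \<open>auto intro!: analytic_intros\<close>)
      then show ?thesis by (simp add: g_def o_def)
    next
      case True
      \<comment> \<open>Built on the branch of the logarithm whose cut is the positive axis.\<close>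
      define L where "L = (\<lambda>w. c * (Ln (- w) + of_real pi * \<i>))"
      have w': "- w \<notin> \<real>\<^sub>\<le>\<^sub>0" using True w by (auto simp: complex_nonpos_Reals_iff complex_eq_iff)
      have LH: "L v \<in> upper_half_plane \<and> qe (L v / of_nat h) = v" if "v \<in> ball 0 1 - {0}" for v
      proof
        have "Im (c * of_real pi * \<i>) = 0" by (simp add: c_def)
        moreover have "Im (c * Ln (- v)) > 0" using inH[of "- v"] that by (simp add: upper_half_plane_def)
        ultimately show "L v \<in> upper_half_plane" by (simp add: L_def upper_half_plane_def distrib_left mult.assoc)
        have "2 * of_real pi * \<i> * (L v / of_nat h) = Ln (- v) + of_real pi * \<i>"
          using h by (simp add: L_def c_def)
        then show "qe (L v / of_nat h) = v" using that by (simp add: qe_def exp_add)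
      qed
      have "(f \<circ> L) analytic_on {w}"
        by (rule analytic_on_compose) (use w' LH[OF w] w f_an in \<open>auto intro!: analytic_intros simp: L_def\<close>)
      moreover have "eventually (\<lambda>v. v \<in> ball 0 1 - {0}) (nhds w)"
        using w by (intro eventually_nhds_in_open) auto
      then have "eventually (\<lambda>v. (f \<circ> L) v = g v) (nhds w)"
        by eventually_elim (use g_eq LH in auto)
      ultimately show ?thesis by (subst (asm) analytic_at_cong[OF _ refl])
    qed
  qed
  then have "g analytic_on ball 0 1 - {0}" by (subst analytic_on_analytic_at) auto
  then have "g holomorphic_on ball 0 1 - {0}" by (rule analytic_imp_holomorphic)
  then show ?thesis using g_eq that by blast
qed

text \<open>The bound makes the singularity of \<open>g w * w powi n\<close> at 0 removable, so
  \<open>g\<close> has at most a pole there.\<close>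

lemma has_q_expansion_exists:
  assumes f: "f holomorphic_on upper_half_plane" and h: "h > 0"
    and per: "\<And>z. z \<in> upper_half_plane \<Longrightarrow> f (z + of_nat h) = f z"
    and bd: "eventually (\<lambda>z. norm (f z * qe (z / of_nat h) powi n) \<le> B) at_ioo"
  shows "\<exists>F. has_q_expansion h f F"
proof -
  obtain g where g: "g holomorphic_on ball 0 1 - {0}" "\<And>z. z \<in> upper_half_plane \<Longrightarrow> f z = g (qe (z / of_nat h))"
    using periodic_descends_to_disc[OF f h per] by blast
  define k where "k = (\<lambda>w. g w * w powi n)"
  have "eventually (\<lambda>z. norm (k (qe (z / of_nat h))) \<le> B) at_ioo"
    using bd eventually_upper_half_plane by eventually_elim (simp add: k_def g)
  then have kb: "eventually (\<lambda>w. norm (k w) \<le> B) (at 0)"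
    unfolding filtermap_qe[OF h, symmetric] eventually_filtermap .
  have "k holomorphic_on ball 0 1 - {0}" unfolding k_def by (intro holomorphic_intros g) auto
  then have "\<exists>k'. k' holomorphic_on ball 0 1 \<and> (\<forall>z\<in>ball 0 1 - {0}. k' z = k z)"
    using kb by (subst holomorphic_on_extend_bounded) auto
  then obtain k' where k': "k' holomorphic_on ball 0 1" "\<And>w. w \<in> ball 0 1 - {0} \<Longrightarrow> k' w = k w" by blast
  have "k' analytic_on {0}" using k'(1) by (subst analytic_at) (auto intro!: exI[of _ "ball 0 1"])
  then have "k' has_fps_expansion fps_expansion k' 0" by (rule analytic_at_imp_has_fps_expansion_0)
  then have "k' has_laurent_expansion fps_to_fls (fps_expansion k' 0)" by (rule has_laurent_expansion_fps)
  then have "(\<lambda>w. k' w * w powi (- n)) has_laurent_expansion fps_to_fls (fps_expansion k' 0) * fls_X_intpow (- n)"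
    by (intro laurent_expansion_intros)
  moreover define F where "F = fps_to_fls (fps_expansion k' 0) * fls_X_intpow (- n)"
  moreover have ev: "eventually (\<lambda>w. k' w * w powi (- n) = g w) (at 0)"
  proof -
    have "eventually (\<lambda>w::complex. w \<in> ball 0 1 - {0}) (at 0)"
      by (rule eventually_at_in_open) auto
    then show ?thesis by eventually_elim (use k' in \<open>auto simp: k_def power_int_minus\<close>)
  qed
  ultimately have gF: "g has_laurent_expansion F" using has_laurent_expansion_cong[OF ev refl] by simp
  have g': "g holomorphic_on eball 0 1 - {0}" using g(1) by (simp only: one_ereal_def eball_ereal)
  have "has_q_expansion h f F" unfolding has_q_expansion_alt
  proof (intro conjI ballI)
    show "1 \<le> fls_conv_radius F" by (rule fls_conv_radius_ge[OF gF g'])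
    fix z assume z: "z \<in> upper_half_plane"
    have "eval_fls F (qe (z / of_nat h)) = g (qe (z / of_nat h))"
      by (rule eval_fls_eqI[OF gF g']) (use norm_qe_less_1[OF z h] in \<open>auto simp: in_eball_iff\<close>)
    then show "f z = eval_fls F (qe (z / of_nat h))" using g(2)[OF z] by simp
  qed
  then show ?thesis by blast
qed

section \<open>Arithmetic and derivatives of expansions\<close>

lemma norm_qe_less_conv_radius:
  assumes "fls_conv_radius F \<ge> 1" "z \<in> upper_half_plane" "h > 0"
  shows "ereal (norm (qe (z / of_nat h))) < fls_conv_radius F"
proof -
  have "ereal (norm (qe (z / of_nat h))) < 1" using norm_qe_less_1[OF assms(2,3)] by (simp add: one_ereal_def)
  then show ?thesis using assms(1) by (rule less_le_trans)
qed

lemma has_q_expansion_add_cmult: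
  assumes "has_q_expansion h f F" "has_q_expansion h g G" "h > 0"
  shows "has_q_expansion h (\<lambda>z. f z + c * g z) (F + fls_const c * G)"
  unfolding has_q_expansion_alt
proof (intro conjI ballI)
  have F: "fls_conv_radius F \<ge> 1" and G: "fls_conv_radius G \<ge> 1"
    using assms by (auto simp: has_q_expansion_alt)
  have cG: "fls_conv_radius (fls_const c * G) \<ge> 1" using G by (intro fls_conv_radius_mult_ge) auto
  then show "1 \<le> fls_conv_radius (F + fls_const c * G)" using F by (intro fls_conv_radius_add_ge)
  fix z assume z: "z \<in> upper_half_plane"
  note n = norm_qe_less_conv_radius[OF _ z assms(3)]
  have "eval_fls (F + fls_const c * G) (qe (z / of_nat h)) = eval_fls F (qe (z / of_nat h)) + c * eval_fls G (qe (z / of_nat h))"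
    using n[OF F] n[OF G] n[OF cG] by (simp add: eval_fls_add eval_fls_mult)
  then show "f z + c * g z = eval_fls (F + fls_const c * G) (qe (z / of_nat h))"
    using assms z by (simp add: has_q_expansion_alt)
qed

lemma has_q_expansion_mult:
  assumes "has_q_expansion h f F" "has_q_expansion h g G" "h > 0"
  shows "has_q_expansion h (\<lambda>z. f z * g z) (F * G)"
  unfolding has_q_expansion_alt
proof (intro conjI ballI)
  have F: "fls_conv_radius F \<ge> 1" and G: "fls_conv_radius G \<ge> 1"
    using assms by (auto simp: has_q_expansion_alt)
  show "1 \<le> fls_conv_radius (F * G)" using F G by (intro fls_conv_radius_mult_ge)
  fix z assume z: "z \<in> upper_half_plane"
  note n = norm_qe_less_conv_radius[OF _ z assms(3)]
  have "eval_fls (F * G) (qe (z / of_nat h)) = eval_fls F (qe (z / of_nat h)) * eval_fls G (qe (z / of_nat h))"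
    using n[OF F] n[OF G] by (simp add: eval_fls_mult)
  then show "f z * g z = eval_fls (F * G) (qe (z / of_nat h))"
    using assms z by (simp add: has_q_expansion_alt)
qed

lemma has_q_expansion_deriv:
  assumes f: "has_q_expansion h f F" and h: "h > 0" and z: "z \<in> upper_half_plane"
  shows "deriv f z = 2 * of_real pi * \<i> / of_nat h * (qe (z / of_nat h) * eval_fls (fls_deriv F) (qe (z / of_nat h)))"
proof (rule DERIV_imp_deriv)
  have F: "fls_conv_radius F \<ge> 1" using f by (auto simp: has_q_expansion_alt)
  note n = norm_qe_less_conv_radius[OF _ z h]
  have "(eval_fls F has_field_derivative eval_fls (fls_deriv F) (qe (z / of_nat h))) (at (qe (z / of_nat h)))"
    using n[OF F] by (intro has_field_derivative_eval_fls) (auto simp: in_eball_iff)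
  moreover have "((\<lambda>z. qe (z / of_nat h)) has_field_derivative (2 * of_real pi * \<i> * qe (z / of_nat h) * (1 / of_nat h))) (at z)"
    by (rule DERIV_chain2[OF qe_deriv]) (use h in \<open>auto intro!: derivative_eq_intros\<close>)
  ultimately have "((\<lambda>z. eval_fls F (qe (z / of_nat h))) has_field_derivative
     eval_fls (fls_deriv F) (qe (z / of_nat h)) * (2 * of_real pi * \<i> * qe (z / of_nat h) * (1 / of_nat h))) (at z)"
    by (rule DERIV_chain2)
  then have "(f has_field_derivative
     eval_fls (fls_deriv F) (qe (z / of_nat h)) * (2 * of_real pi * \<i> * qe (z / of_nat h) * (1 / of_nat h))) (at z)"
    by (rule has_field_derivative_transform_within_open[where S = upper_half_plane])
       (use f z in \<open>auto simp: has_q_expansion_alt\<close>)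
  then show "(f has_field_derivative 2 * of_real pi * \<i> / of_nat h * (qe (z / of_nat h) * eval_fls (fls_deriv F) (qe (z / of_nat h)))) (at z)"
    by (simp add: mult_ac)
qed

lemma has_q_expansion_deriv':
  assumes f: "has_q_expansion h f F" and h: "h > 0"
  shows "has_q_expansion h (deriv f) (fls_const (2 * of_real pi * \<i> / of_nat h) * (fls_X * fls_deriv F))"
  unfolding has_q_expansion_alt
proof (intro conjI ballI)
  have F: "fls_conv_radius F \<ge> 1" using f by (auto simp: has_q_expansion_alt)
  then have D: "fls_conv_radius (fls_deriv F) \<ge> 1" using fls_conv_radius_deriv[of F] by (rule order_trans)
  then have XD: "fls_conv_radius (fls_X * fls_deriv F) \<ge> 1" by (intro fls_conv_radius_mult_ge) auto
  show "1 \<le> fls_conv_radius (fls_const (2 * of_real pi * \<i> / of_nat h) * (fls_X * fls_deriv F))"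
    by (rule fls_conv_radius_mult_ge[OF _ XD]) simp
  fix z assume z: "z \<in> upper_half_plane"
  note n = norm_qe_less_conv_radius[OF _ z h]
  have "eval_fls (fls_const (2 * of_real pi * \<i> / of_nat h) * (fls_X * fls_deriv F)) (qe (z / of_nat h)) =
     2 * of_real pi * \<i> / of_nat h * (qe (z / of_nat h) * eval_fls (fls_deriv F) (qe (z / of_nat h)))"
    using n[OF D] n[OF XD] by (subst eval_fls_mult, simp, simp, simp, subst eval_fls_mult) (auto simp: eval_fls_X)
  then show "deriv f z = eval_fls (fls_const (2 * of_real pi * \<i> / of_nat h) * (fls_X * fls_deriv F)) (qe (z / of_nat h))"
    using has_q_expansion_deriv[OF f h z] by simp
qed

subsection \<open>The slash action and invariant forms\<close>

no_notation fps_nth (infixl "$" 75)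

section \<open>Integer matrices of determinant 1\<close>

definition mat2 :: "int \<Rightarrow> int \<Rightarrow> int \<Rightarrow> int \<Rightarrow> int^2^2" where
  "mat2 a b c d = vector [vector [a, b], vector [c, d]]"

lemma mat2_nth [simp]:
  "mat2 a b c d $ 1 $ 1 = a" "mat2 a b c d $ 1 $ 2 = b" "mat2 a b c d $ 2 $ 1 = c" "mat2 a b c d $ 2 $ 2 = d"
  unfolding mat2_def vector_2 by (rule refl)+

lemma mat2_eq_iff:
  "(A :: int^2^2) = B \<longleftrightarrow> A $ 1 $ 1 = B $ 1 $ 1 \<and> A $ 1 $ 2 = B $ 1 $ 2 \<and> A $ 2 $ 1 = B $ 2 $ 1 \<and> A $ 2 $ 2 = B $ 2 $ 2"
  unfolding vec_eq_iff forall_2 by blast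

lemma mat2_mult_nth:
  fixes A B :: "int^2^2"
  shows "(A ** B) $ i $ j = A $ i $ 1 * B $ 1 $ j + A $ i $ 2 * B $ 2 $ j"
  by (simp add: matrix_matrix_mult_def sum_2)

lemma mat2_one_nth: "(mat 1 :: int^2^2) $ i $ j = (if i = j then 1 else 0)"
  by (simp add: mat_def)

definition mat2_inv :: "int^2^2 \<Rightarrow> int^2^2" where
  "mat2_inv A = mat2 (A $ 2 $ 2) (- (A $ 1 $ 2)) (- (A $ 2 $ 1)) (A $ 1 $ 1)"

lemma SL2Z_iff: "A \<in> SL2Z \<longleftrightarrow> A $ 1 $ 1 * A $ 2 $ 2 - A $ 1 $ 2 * A $ 2 $ 1 = 1"
  by (simp add: SL2Z_def det_2)

lemma Gamma0_iff: "A \<in> Gamma0 N \<longleftrightarrow> A \<in> SL2Z \<and> int N dvd A $ 2 $ 1"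
  by (simp add: Gamma0_def)

lemma Gamma0_SL2Z: "A \<in> Gamma0 N \<Longrightarrow> A \<in> SL2Z"
  by (simp add: Gamma0_iff)

lemma SL2Z_mult: "A \<in> SL2Z \<Longrightarrow> B \<in> SL2Z \<Longrightarrow> A ** B \<in> SL2Z"
  by (simp add: SL2Z_def det_mul)

lemma SL2Z_inv: "A \<in> SL2Z \<Longrightarrow> mat2_inv A \<in> SL2Z"
  by (simp add: SL2Z_iff mat2_inv_def mult.commute)

lemma mat2_inv_right: "A \<in> SL2Z \<Longrightarrow> A ** mat2_inv A = mat 1"
  by (simp add: mat2_eq_iff mat2_mult_nth mat2_one_nth mat2_inv_def SL2Z_iff mult.commute)

lemma mat2_inv_left: "A \<in> SL2Z \<Longrightarrow> mat2_inv A ** A = mat 1"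
  by (simp add: mat2_eq_iff mat2_mult_nth mat2_one_nth mat2_inv_def SL2Z_iff mult.commute)

lemma SL2Z_one: "mat 1 \<in> SL2Z"
  by (simp add: SL2Z_iff mat2_one_nth)

lemma Gamma0_one: "mat 1 \<in> Gamma0 N"
  by (simp add: Gamma0_iff SL2Z_one mat2_one_nth)

lemma Gamma0_mult: "A \<in> Gamma0 N \<Longrightarrow> B \<in> Gamma0 N \<Longrightarrow> A ** B \<in> Gamma0 N"
  by (simp add: Gamma0_iff SL2Z_mult mat2_mult_nth)

lemma Gamma0_inv: "A \<in> Gamma0 N \<Longrightarrow> mat2_inv A \<in> Gamma0 N"
  by (simp add: Gamma0_iff SL2Z_inv) (simp add: mat2_inv_def)

lemma automorphy_factor_nonzero:
  assumes A: "A \<in> SL2Z" and z: "z \<in> upper_half_plane"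
  shows "automorphy_factor A z \<noteq> 0"
  unfolding automorphy_factor_def
  by (rule Im_moebius(1)[of "A $ 1 $ 1" _ "A $ 1 $ 2"]) (use A z in \<open>auto simp: SL2Z_iff upper_half_plane_def\<close>)

lemma Im_moebius_action:
  assumes A: "A \<in> SL2Z" and z: "z \<in> upper_half_plane"
  shows "Im (moebius_action A z) = Im z / (norm (automorphy_factor A z))\<^sup>2"
  unfolding automorphy_factor_def moebius_action_def
  by (rule Im_moebius(2)) (use A z in \<open>auto simp: SL2Z_iff upper_half_plane_def\<close>)

lemma moebius_action_in_H:
  assumes A: "A \<in> SL2Z" and z: "z \<in> upper_half_plane"
  shows "moebius_action A z \<in> upper_half_plane"
  using Im_moebius_action[OF A z] automorphy_factor_nonzero[OF A z] z
  by (simp add: upper_half_plane_def)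

lemma automorphy_factor_mult:
  assumes B: "B \<in> SL2Z" and z: "z \<in> upper_half_plane"
  shows "automorphy_factor (A ** B) z = automorphy_factor A (moebius_action B z) * automorphy_factor B z"
  using automorphy_factor_nonzero[OF B z]
  by (simp add: automorphy_factor_def moebius_action_def mat2_mult_nth divide_simps) (simp add: algebra_simps)

lemma moebius_action_mult:
  assumes A: "A \<in> SL2Z" and B: "B \<in> SL2Z" and z: "z \<in> upper_half_plane"
  shows "moebius_action (A ** B) z = moebius_action A (moebius_action B z)"
proof -
  let ?j = "automorphy_factor B z"
  have j: "?j \<noteq> 0" by (rule automorphy_factor_nonzero[OF B z])
  have "(of_int (A $ 1 $ 1) * moebius_action B z + of_int (A $ 1 $ 2)) * ?j =
     of_int ((A ** B) $ 1 $ 1) * z + of_int ((A ** B) $ 1 $ 2)"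
    using j by (simp add: moebius_action_def mat2_mult_nth divide_simps) (simp add: automorphy_factor_def algebra_simps)
  then have "moebius_action (A ** B) z = ((of_int (A $ 1 $ 1) * moebius_action B z + of_int (A $ 1 $ 2)) * ?j) /
      (automorphy_factor A (moebius_action B z) * ?j)"
    by (simp add: moebius_action_def[of "A ** B"] automorphy_factor_mult[OF B z])
  then show ?thesis using j by (simp add: moebius_action_def[of A])
qed

lemma slash_mult:
  assumes A: "A \<in> SL2Z" and B: "B \<in> SL2Z" and z: "z \<in> upper_half_plane"
  shows "slash k f (A ** B) z = slash k (slash k f A) B z"
  by (simp add: slash_def automorphy_factor_mult[OF B z] moebius_action_mult[OF A B z] power_int_mult_distrib mult_ac)

lemma slash_cong:
  assumes "A \<in> SL2Z" "z \<in> upper_half_plane" "\<And>z. z \<in> upper_half_plane \<Longrightarrow> f z = g z"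
  shows "slash k f A z = slash k g A z"
  using assms(3)[OF moebius_action_in_H[OF assms(1,2)]] by (simp add: slash_def)

lemma slash_one: "slash k f (mat 1) z = f z"
  by (simp add: slash_def moebius_action_def automorphy_factor_def mat2_one_nth)

lemma slash_translation: "slash k f (mat2 1 n 0 1) z = f (z + of_int n)"
  by (simp add: slash_def moebius_action_def automorphy_factor_def)

lemma slash_prod:
  assumes A: "A \<in> SL2Z" and z: "z \<in> upper_half_plane"
  shows "slash (k + l) (\<lambda>z. f z * g z) A z = slash k f A z * slash l g A z"
  using automorphy_factor_nonzero[OF A z] power_int_add[of "automorphy_factor A z" "- k" "- l"]
  by (simp add: slash_def mult_ac)

lemma slash_add_cmult: "slash k (\<lambda>z. f z + c * g z) A z = slash k f A z + c * slash k g A z"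
  by (simp add: slash_def algebra_simps)

lemma holomorphic_automorphy_factor [holomorphic_intros]: "automorphy_factor A holomorphic_on S"
  unfolding automorphy_factor_def [abs_def] by (intro holomorphic_intros)

lemma holomorphic_moebius_action: "A \<in> SL2Z \<Longrightarrow> moebius_action A holomorphic_on upper_half_plane"
  unfolding moebius_action_def [abs_def] by (intro holomorphic_intros automorphy_factor_nonzero)

lemma holomorphic_slash:
  assumes A: "A \<in> SL2Z" and f: "f holomorphic_on upper_half_plane"
  shows "slash k f A holomorphic_on upper_half_plane"
proof -
  have "f \<circ> moebius_action A holomorphic_on upper_half_plane"
    by (rule holomorphic_on_compose_gen[OF holomorphic_moebius_action[OF A] f])
       (auto intro: moebius_action_in_H[OF A])
  then have "(\<lambda>z. f (moebius_action A z)) holomorphic_on upper_half_plane" by (simp add: o_def)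
  then show ?thesis unfolding slash_def [abs_def]
    by (intro holomorphic_intros) (auto dest: automorphy_factor_nonzero[OF A])
qed

section \<open>Invariance, growth at infinity and limits at the other cusps\<close>

definition invariant_form :: "int \<Rightarrow> nat \<Rightarrow> (complex \<Rightarrow> complex) \<Rightarrow> bool" where
  "invariant_form k N f \<longleftrightarrow> f holomorphic_on upper_half_plane \<and> (\<forall>z. z \<notin> upper_half_plane \<longrightarrow> f z = 0) \<and>
     (\<forall>A\<in>Gamma0 N. \<forall>z\<in>upper_half_plane. slash k f A z = f z)"

lemma invariant_form_slash_coset:
  assumes f: "invariant_form k N f" and A: "A \<in> SL2Z" and C: "C \<in> Gamma0 N" and z: "z \<in> upper_half_plane"
  shows "slash k f (C ** A) z = slash k f A z"
proof -
  have "slash k f (C ** A) z = slash k (slash k f C) A z"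
    by (rule slash_mult[OF Gamma0_SL2Z[OF C] A z])
  also have "\<dots> = slash k f A z"
    by (rule slash_cong[OF A z]) (use f C in \<open>auto simp: invariant_form_def\<close>)
  finally show ?thesis .
qed

lemma invariant_form_periodic:
  assumes f: "invariant_form k N f" and z: "z \<in> upper_half_plane"
  shows "f (z + 1) = f z"
proof -
  have "mat2 1 1 0 1 \<in> Gamma0 N" by (simp add: Gamma0_iff SL2Z_iff)
  then have "slash k f (mat2 1 1 0 1) z = f z" using f z by (auto simp: invariant_form_def)
  then show ?thesis by (simp add: slash_translation)
qed

lemma slash_periodic:
  assumes f: "invariant_form k N f" and A: "A \<in> SL2Z" and z: "z \<in> upper_half_plane"
  shows "slash k f A (z + of_nat N) = slash k f A z"
proof -
  let ?T = "mat2 1 (int N) 0 1"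
  have T: "?T \<in> SL2Z" by (simp add: SL2Z_iff)
  \<comment> \<open>This is \<open>A ** ?T ** mat2_inv A\<close>, written out so that the
    divisibility of the lower left entry by \<open>N\<close> is visible.\<close>
  define C where "C = mat2 (1 - A $ 1 $ 1 * A $ 2 $ 1 * int N) ((A $ 1 $ 1)\<^sup>2 * int N) (- ((A $ 2 $ 1)\<^sup>2 * int N)) (1 + A $ 1 $ 1 * A $ 2 $ 1 * int N)"
  have C: "C \<in> Gamma0 N" by (simp add: Gamma0_iff SL2Z_iff C_def) algebra
  have eq: "C ** A = A ** ?T"
  proof -
    have d: "A $ 1 $ 1 * A $ 2 $ 2 - A $ 1 $ 2 * A $ 2 $ 1 = 1" using A by (simp add: SL2Z_iff)
    show ?thesis unfolding mat2_eq_iff mat2_mult_nth C_def mat2_nth using d by algebra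
  qed
  have "slash k f A (z + of_nat N) = slash k (slash k f A) ?T z" by (simp add: slash_translation)
  also have "\<dots> = slash k f (A ** ?T) z" by (rule slash_mult[OF A T z, symmetric])
  also have "\<dots> = slash k f A z" unfolding eq[symmetric] by (rule invariant_form_slash_coset[OF f A C z])
  finally show ?thesis .
qed

text \<open>Meromorphy at infinity, phrased as a bound so that it passes to sums and products
  without manipulating series.\<close>

definition moderate_growth :: "(complex \<Rightarrow> complex) \<Rightarrow> bool" where
  "moderate_growth f \<longleftrightarrow> (\<exists>n B. eventually (\<lambda>z. norm (f z * qe z ^ n) \<le> B) at_ioo)"

lemma qe_scale: "N > 0 \<Longrightarrow> qe z = qe (z / of_nat N) ^ N"
  using qe_of_nat_mult[of N "z / of_nat N"] by simp

lemma weakly_holomorphic_forms_invariant: "f \<in> weakly_holomorphic_forms k N \<Longrightarrow> invariant_form k N f"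
  by (simp add: weakly_holomorphic_forms_def invariant_form_def)

lemma weakly_holomorphic_forms_moderate:
  assumes f: "f \<in> weakly_holomorphic_forms k N" and N: "N > 0"
  shows "moderate_growth f"
proof -
  have "\<exists>F. has_q_expansion N (slash k f (mat 1)) F"
    using f SL2Z_one by (auto simp: weakly_holomorphic_forms_def)
  then obtain F where F: "has_q_expansion N f F" by (auto simp: slash_one [abs_def])
  define m where "m = fls_subdegree F"
  have "((\<lambda>z. f z * qe (z / of_nat N) powi (- m)) \<longlongrightarrow> fls_nth F m) at_ioo"
    unfolding has_q_expansion_tendsto_iff[OF F N] by (auto simp: m_def fls_eq0_below_subdegree)
  then obtain B where B: "eventually (\<lambda>z. norm (f z * qe (z / of_nat N) powi (- m)) \<le> B) at_ioo"
    using tendsto_imp_eventually_bounded by blast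
  have "eventually (\<lambda>z. norm (f z * qe z ^ nat \<bar>m\<bar>) \<le> B) at_ioo"
    using B eventually_upper_half_plane
  proof eventually_elim
    case (elim z)
    let ?w = "qe (z / of_nat N)"
    have w: "norm ?w \<le> 1" using norm_qe_less_1[OF elim(2) N] by simp
    have "int (N * nat \<bar>m\<bar>) \<ge> - m"
    proof -
      have "- m \<le> 1 * \<bar>m\<bar>" by simp
      also have "\<dots> \<le> int N * \<bar>m\<bar>" using N by (intro mult_right_mono) auto
      finally show ?thesis by simp
    qed
    then have e: "int (N * nat \<bar>m\<bar>) = int (nat (int (N * nat \<bar>m\<bar>) + m)) + (- m)" by simp
    have "qe z ^ nat \<bar>m\<bar> = ?w ^ (N * nat \<bar>m\<bar>)" by (simp only: power_mult qe_scale[OF N, of z, symmetric])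
    also have "\<dots> = ?w powi int (N * nat \<bar>m\<bar>)" by (rule power_int_of_nat[symmetric])
    also have "\<dots> = ?w ^ nat (int (N * nat \<bar>m\<bar>) + m) * ?w powi (- m)"
      by (subst e) (simp only: power_int_add[OF disjI1[OF qe_nonzero]] power_int_of_nat)
    finally have "norm (f z * qe z ^ nat \<bar>m\<bar>) = norm (f z * ?w powi (- m)) * norm ?w ^ nat (int (N * nat \<bar>m\<bar>) + m)"
      by (simp add: norm_mult norm_power)
    also have "\<dots> \<le> norm (f z * ?w powi (- m)) * 1"
      using w by (intro mult_left_mono power_le_one) auto
    finally show ?case using elim by simp
  qed
  then show ?thesis unfolding moderate_growth_def by blast
qed

lemma q_expansion_exists:
  assumes f: "invariant_form k N f" and m: "moderate_growth f" and N: "N > 0"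
  shows "\<exists>F. has_q_expansion N f F" "\<exists>F. has_q_expansion 1 f F"
proof -
  have hol: "f holomorphic_on upper_half_plane" using f by (simp add: invariant_form_def)
  have per: "f (z + of_nat h) = f z" if "z \<in> upper_half_plane" for z h
    using periodic_of_int[of f 1 z "int h"] invariant_form_periodic[OF f] that by simp
  obtain n B where B: "eventually (\<lambda>z. norm (f z * qe z ^ n) \<le> B) at_ioo"
    using m by (auto simp: moderate_growth_def)
  have "\<exists>F. has_q_expansion h f F" if h: "h > 0" for h
    by (rule has_q_expansion_exists[OF hol h per, of "int (h * n)" B])
       (use B in \<open>simp_all only: power_int_of_nat power_mult qe_scale[OF h, symmetric]\<close>)
  then show "\<exists>F. has_q_expansion N f F" "\<exists>F. has_q_expansion 1 f F" using N by auto
qed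

lemma weakly_holomorphic_formsI:
  assumes f: "invariant_form k N f" and m: "moderate_growth f" and N: "N > 0"
    and b: "\<And>A. A \<in> SL2Z - Gamma0 N \<Longrightarrow> \<exists>L. (slash k f A \<longlongrightarrow> L) at_ioo"
  shows "f \<in> weakly_holomorphic_forms k N"
proof -
  have "\<exists>F. has_q_expansion N (slash k f A) F" if A: "A \<in> SL2Z" for A
  proof (cases "A \<in> Gamma0 N")
    case True
    obtain F where "has_q_expansion N f F" using q_expansion_exists[OF f m N] by blast
    then have "has_q_expansion N (slash k f A) F"
      using f True by (auto simp: has_q_expansion_def invariant_form_def)
    then show ?thesis by blast
  next
    case False
    then obtain L where L: "(slash k f A \<longlongrightarrow> L) at_ioo" using b A by blast
    then obtain B where "eventually (\<lambda>z. norm (slash k f A z) \<le> B) at_ioo"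
      using tendsto_imp_eventually_bounded by blast
    then show ?thesis
      using f by (intro has_q_expansion_exists[where n = 0 and B = B] holomorphic_slash[OF A] slash_periodic[OF f A] N)
         (auto simp: invariant_form_def)
  qed
  then show ?thesis using f by (simp add: weakly_holomorphic_forms_def invariant_form_def)
qed

text \<open>Absence of negative exponents at a cusp is the existence of a limit there. For
  \<open>A \<in> Gamma0 N\<close> the slashed function is \<open>f\<close> itself on the upper half
  plane, so a single growth condition at infinity replaces all those expansions.\<close>

theorem M_sharp_iff:
  assumes N: "N > 0"
  shows "f \<in> M_sharp k N \<longleftrightarrow> invariant_form k N f \<and> moderate_growth f \<and>
    (\<forall>A\<in>SL2Z - Gamma0 N. \<exists>L. (slash k f A \<longlongrightarrow> L) at_ioo)"
proof
  assume f: "f \<in> M_sharp k N"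
  then have w: "f \<in> weakly_holomorphic_forms k N" by (simp add: M_sharp_def)
  have "\<exists>L. (slash k f A \<longlongrightarrow> L) at_ioo" if A: "A \<in> SL2Z - Gamma0 N" for A
  proof -
    obtain F where F: "has_q_expansion N (slash k f A) F" using w A by (auto simp: weakly_holomorphic_forms_def)
    then have "\<forall>j<0. fls_nth F j = 0" using f A by (auto simp: M_sharp_def)
    then show ?thesis using has_q_expansion_tendsto_iff[OF F N, of 0] by auto
  qed
  then show "invariant_form k N f \<and> moderate_growth f \<and> (\<forall>A\<in>SL2Z - Gamma0 N. \<exists>L. (slash k f A \<longlongrightarrow> L) at_ioo)"
    using weakly_holomorphic_forms_invariant[OF w] weakly_holomorphic_forms_moderate[OF w N] by blast
next
  assume f: "invariant_form k N f \<and> moderate_growth f \<and> (\<forall>A\<in>SL2Z - Gamma0 N. \<exists>L. (slash k f A \<longlongrightarrow> L) at_ioo)"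
  have "\<forall>j<0. fls_nth F j = 0" if A: "A \<in> SL2Z - Gamma0 N" and F: "has_q_expansion N (slash k f A) F" for A F
  proof -
    obtain L where "(slash k f A \<longlongrightarrow> L) at_ioo" using f A by blast
    then show ?thesis using has_q_expansion_tendsto_iff[OF F N, of 0 L] by auto
  qed
  then show "f \<in> M_sharp k N" unfolding M_sharp_def using f N by (auto intro!: weakly_holomorphic_formsI)
qed

theorem S_sharp_iff:
  assumes N: "N > 0"
  shows "f \<in> S_sharp k N \<longleftrightarrow> invariant_form k N f \<and> moderate_growth f \<and>
    (\<forall>A\<in>SL2Z - Gamma0 N. (slash k f A \<longlongrightarrow> 0) at_ioo)"
proof
  assume f: "f \<in> S_sharp k N"
  then have M: "f \<in> M_sharp k N" by (simp add: S_sharp_def)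
  then have w: "f \<in> weakly_holomorphic_forms k N" by (simp add: M_sharp_def)
  have "(slash k f A \<longlongrightarrow> 0) at_ioo" if A: "A \<in> SL2Z - Gamma0 N" for A
  proof -
    obtain F where F: "has_q_expansion N (slash k f A) F" using w A by (auto simp: weakly_holomorphic_forms_def)
    then have "\<forall>j<0. fls_nth F j = 0" "fls_nth F 0 = 0" using f M A by (auto simp: M_sharp_def S_sharp_def)
    then show ?thesis using has_q_expansion_tendsto_iff[OF F N, of 0 0] by auto
  qed
  then show "invariant_form k N f \<and> moderate_growth f \<and> (\<forall>A\<in>SL2Z - Gamma0 N. (slash k f A \<longlongrightarrow> 0) at_ioo)"
    using M by (auto simp: M_sharp_iff[OF N])
next
  assume f: "invariant_form k N f \<and> moderate_growth f \<and> (\<forall>A\<in>SL2Z - Gamma0 N. (slash k f A \<longlongrightarrow> 0) at_ioo)"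
  then have "f \<in> M_sharp k N" unfolding M_sharp_iff[OF N] by blast
  moreover have "fls_nth F 0 = 0" if A: "A \<in> SL2Z - Gamma0 N" and F: "has_q_expansion N (slash k f A) F" for A F
    using has_q_expansion_tendsto_iff[OF F N, of 0 0] f A by auto
  ultimately show "f \<in> S_sharp k N" unfolding S_sharp_def by blast
qed

section \<open>Closure of the spaces under sums and products\<close>

lemma eventually_norm_qe_le_1: "eventually (\<lambda>z. norm (qe z) \<le> 1) at_ioo"
  using eventually_upper_half_plane by eventually_elim (use norm_qe_less_1[of _ 1] in \<open>force\<close>)

lemma moderate_growth_mult:
  assumes "moderate_growth f" "moderate_growth g"
  shows "moderate_growth (\<lambda>z. f z * g z)"
proof -
  obtain n B where B: "eventually (\<lambda>z. norm (f z * qe z ^ n) \<le> B) at_ioo" using assms by (auto simp: moderate_growth_def)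
  obtain m C where C: "eventually (\<lambda>z. norm (g z * qe z ^ m) \<le> C) at_ioo" using assms by (auto simp: moderate_growth_def)
  from B C have "eventually (\<lambda>z. norm (f z * g z * qe z ^ (n + m)) \<le> \<bar>B\<bar> * \<bar>C\<bar>) at_ioo"
  proof eventually_elim
    case (elim z)
    have "norm (f z * g z * qe z ^ (n + m)) = norm (f z * qe z ^ n) * norm (g z * qe z ^ m)"
      by (simp add: norm_mult power_add)
    also have "\<dots> \<le> \<bar>B\<bar> * \<bar>C\<bar>" using elim by (intro mult_mono) auto
    finally show ?case .
  qed
  then show ?thesis unfolding moderate_growth_def by blast
qed

lemma moderate_growth_add_cmult:
  assumes "moderate_growth f" "moderate_growth g"
  shows "moderate_growth (\<lambda>z. f z + c * g z)"
proof -
  obtain n B where B: "eventually (\<lambda>z. norm (f z * qe z ^ n) \<le> B) at_ioo" using assms by (auto simp: moderate_growth_def)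
  obtain m C where C: "eventually (\<lambda>z. norm (g z * qe z ^ m) \<le> C) at_ioo" using assms by (auto simp: moderate_growth_def)
  from B C eventually_norm_qe_le_1 have "eventually (\<lambda>z. norm ((f z + c * g z) * qe z ^ (n + m)) \<le> \<bar>B\<bar> + norm c * \<bar>C\<bar>) at_ioo"
  proof eventually_elim
    case (elim z)
    have "norm ((f z + c * g z) * qe z ^ (n + m)) \<le> norm (f z * qe z ^ n * qe z ^ m) + norm (c * (g z * qe z ^ m * qe z ^ n))"
      by (rule order.trans[OF _ norm_triangle_ineq]) (simp add: power_add algebra_simps)
    also have "\<dots> = norm (f z * qe z ^ n) * norm (qe z) ^ m + norm c * (norm (g z * qe z ^ m) * norm (qe z) ^ n)"
      by (simp add: norm_mult norm_power)
    also have "\<dots> \<le> \<bar>B\<bar> * 1 + norm c * (\<bar>C\<bar> * 1)"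
      using elim by (intro add_mono mult_mono power_le_one) auto
    finally show ?case by simp
  qed
  then show ?thesis unfolding moderate_growth_def by blast
qed

lemma invariant_form_mult:
  assumes "invariant_form k N f" "invariant_form l N g"
  shows "invariant_form (k + l) N (\<lambda>z. f z * g z)"
  using assms by (auto simp: invariant_form_def slash_prod Gamma0_SL2Z intro!: holomorphic_intros)

lemma invariant_form_add_cmult:
  assumes "invariant_form k N f" "invariant_form k N g"
  shows "invariant_form k N (\<lambda>z. f z + c * g z)"
  using assms by (auto simp: invariant_form_def slash_add_cmult intro!: holomorphic_intros)

lemma tendsto_slash_prod:
  assumes "A \<in> SL2Z" "(slash k f A \<longlongrightarrow> a) at_ioo" "(slash l g A \<longlongrightarrow> b) at_ioo"
  shows "(slash (k + l) (\<lambda>z. f z * g z) A \<longlongrightarrow> a * b) at_ioo"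
  by (rule Lim_transform_eventually[OF tendsto_mult[OF assms(2,3)]])
     (use eventually_upper_half_plane in eventually_elim, simp add: slash_prod assms(1))

lemma tendsto_slash_add_cmult:
  assumes "(slash k f A \<longlongrightarrow> a) at_ioo" "(slash k g A \<longlongrightarrow> b) at_ioo"
  shows "(slash k (\<lambda>z. f z + c * g z) A \<longlongrightarrow> a + c * b) at_ioo"
  using assms by (simp add: slash_add_cmult [abs_def] tendsto_intros)

lemma M_sharp_mult:
  assumes N: "N > 0" and "f \<in> M_sharp k N" "g \<in> M_sharp l N"
  shows "(\<lambda>z. f z * g z) \<in> M_sharp (k + l) N"
  using assms(2,3) unfolding M_sharp_iff[OF N]
  by (blast intro: invariant_form_mult moderate_growth_mult tendsto_slash_prod)

lemma M_sharp_mult_S_sharp: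
  assumes N: "N > 0" and f: "f \<in> M_sharp k N" and g: "g \<in> S_sharp l N"
  shows "(\<lambda>z. f z * g z) \<in> S_sharp (k + l) N"
  unfolding S_sharp_iff[OF N]
proof (intro conjI ballI)
  fix A assume A: "A \<in> SL2Z - Gamma0 N"
  obtain L where "(slash k f A \<longlongrightarrow> L) at_ioo" using f A by (auto simp: M_sharp_iff[OF N])
  moreover have "(slash l g A \<longlongrightarrow> 0) at_ioo" using g A by (auto simp: S_sharp_iff[OF N])
  ultimately show "(slash (k + l) (\<lambda>z. f z * g z) A \<longlongrightarrow> 0) at_ioo"
    using tendsto_slash_prod[of A k f L l g 0] A by simp
qed (use f g in \<open>auto simp: M_sharp_iff[OF N] S_sharp_iff[OF N] intro: invariant_form_mult moderate_growth_mult\<close>)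

lemma M_sharp_add_cmult:
  assumes N: "N > 0" and "f \<in> M_sharp k N" "g \<in> M_sharp k N"
  shows "(\<lambda>z. f z + c * g z) \<in> M_sharp k N"
  unfolding M_sharp_iff[OF N]
proof (intro conjI ballI)
  fix A assume "A \<in> SL2Z - Gamma0 N"
  then obtain a b where "(slash k f A \<longlongrightarrow> a) at_ioo" "(slash k g A \<longlongrightarrow> b) at_ioo"
    using assms(2,3) unfolding M_sharp_iff[OF N] by blast
  from tendsto_slash_add_cmult[OF this]
  show "\<exists>L. (slash k (\<lambda>z. f z + c * g z) A \<longlongrightarrow> L) at_ioo" by (rule exI)
qed (use assms(2,3) in \<open>auto simp: M_sharp_iff[OF N] intro: invariant_form_add_cmult moderate_growth_add_cmult\<close>)

lemma S_sharp_add_cmult: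
  assumes N: "N > 0" and "f \<in> S_sharp k N" "g \<in> S_sharp k N"
  shows "(\<lambda>z. f z + c * g z) \<in> S_sharp k N"
  unfolding S_sharp_iff[OF N]
proof (intro conjI ballI)
  fix A assume "A \<in> SL2Z - Gamma0 N"
  then show "(slash k (\<lambda>z. f z + c * g z) A \<longlongrightarrow> 0) at_ioo"
    using tendsto_slash_add_cmult[of k f A 0 g 0 c] assms(2,3) by (auto simp: S_sharp_iff[OF N])
qed (use assms(2,3) in \<open>auto simp: S_sharp_iff[OF N] intro: invariant_form_add_cmult moderate_growth_add_cmult\<close>)

lemma S_sharp_subset: "S_sharp k N \<subseteq> M_sharp k N"
  by (auto simp: S_sharp_def)

lemma has_q_expansion_q_expansion:
  assumes "has_q_expansion 1 f F" shows "q_expansion f = F"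
  unfolding q_expansion_def by (rule the_equality) (rule assms, rule has_q_expansion_unique[OF _ assms zero_less_one])

lemma M_sharp_q_expansion:
  assumes N: "N > 0" and f: "f \<in> M_sharp k N"
  shows "has_q_expansion 1 f (q_expansion f)"
proof -
  have "invariant_form k N f" "moderate_growth f" using f unfolding M_sharp_iff[OF N] by blast+
  from q_expansion_exists(2)[OF this N] obtain F where F: "has_q_expansion 1 f F" by blast
  show ?thesis unfolding has_q_expansion_q_expansion[OF F] by (rule F)
qed

lemma q_coeff_tendsto_iff:
  assumes "has_q_expansion 1 f (q_expansion f)"
  shows "((\<lambda>z. f z * qe z powi (- n)) \<longlongrightarrow> L) at_ioo \<longleftrightarrow> (\<forall>j<n. q_coeff f j = 0) \<and> q_coeff f n = L"
  using has_q_expansion_tendsto_iff[OF assms, of n L] by (simp add: q_coeff_def)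

lemma q_coeff_add_cmult:
  assumes "has_q_expansion 1 f (q_expansion f)" "has_q_expansion 1 g (q_expansion g)"
  shows "q_coeff (\<lambda>z. f z + c * g z) n = q_coeff f n + c * q_coeff g n"
  using has_q_expansion_q_expansion[OF has_q_expansion_add_cmult[OF assms, of c]] by (simp add: q_coeff_def)

lemma has_q_expansion_imp_moderate:
  assumes F: "has_q_expansion 1 f F" shows "moderate_growth f"
proof -
  define m where "m = - int (nat \<bar>fls_subdegree F\<bar>)"
  have "((\<lambda>z. f z * qe (z / of_nat 1) powi (- m)) \<longlongrightarrow> fls_nth F m) at_ioo"
    unfolding has_q_expansion_tendsto_iff[OF F zero_less_one] by (auto simp: m_def fls_eq0_below_subdegree)
  then obtain B where B: "eventually (\<lambda>z. norm (f z * qe z powi (- m)) \<le> B) at_ioo"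
    using tendsto_imp_eventually_bounded[of "\<lambda>z. f z * qe z powi (- m)"] by auto
  then show ?thesis unfolding moderate_growth_def m_def minus_minus power_int_of_nat by blast
qed

subsection \<open>Derivatives of functions of weight 0\<close>

lemma has_derivative_moebius_action:
  assumes A: "A \<in> SL2Z" and z: "z \<in> upper_half_plane"
  shows "(moebius_action A has_field_derivative automorphy_factor A z powi (- 2)) (at z)"
proof -
  let ?j = "automorphy_factor A z"
  have j: "?j \<noteq> 0" by (rule automorphy_factor_nonzero[OF A z])
  have "of_int (A $ 1 $ 1 * A $ 2 $ 2 - A $ 1 $ 2 * A $ 2 $ 1) = (1 :: complex)"
    using A by (simp only: SL2Z_iff of_int_1)
  then have d: "of_int (A $ 1 $ 1) * ?j - (of_int (A $ 1 $ 1) * z + of_int (A $ 1 $ 2)) * of_int (A $ 2 $ 1) = 1"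
    by (simp add: automorphy_factor_def algebra_simps)
  have "(moebius_action A has_field_derivative
     (of_int (A $ 1 $ 1) * ?j - (of_int (A $ 1 $ 1) * z + of_int (A $ 1 $ 2)) * of_int (A $ 2 $ 1)) / (?j * ?j)) (at z)"
    unfolding moebius_action_def [abs_def] using j
    by (auto intro!: derivative_eq_intros simp: automorphy_factor_def)
  then show ?thesis unfolding d by (simp add: power_int_minus power2_eq_square divide_inverse)
qed

definition deriv_form :: "(complex \<Rightarrow> complex) \<Rightarrow> complex \<Rightarrow> complex" where
  "deriv_form f z = (if z \<in> upper_half_plane then deriv f z else 0)"

lemma slash_deriv_form:
  assumes f: "f holomorphic_on upper_half_plane" and A: "A \<in> SL2Z" and z: "z \<in> upper_half_plane"
  shows "slash 2 (deriv_form f) A z = deriv (slash 0 f A) z"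
proof -
  have "(f has_field_derivative deriv f (moebius_action A z)) (at (moebius_action A z))"
    using f moebius_action_in_H[OF A z] by (intro holomorphic_derivI[of _ upper_half_plane]) auto
  from DERIV_chain2[OF this has_derivative_moebius_action[OF A z]]
  have "((\<lambda>z. f (moebius_action A z)) has_field_derivative deriv f (moebius_action A z) * automorphy_factor A z powi (- 2)) (at z)" .
  then show ?thesis using moebius_action_in_H[OF A z]
    by (simp add: slash_def [abs_def] deriv_form_def DERIV_imp_deriv mult.commute)
qed

lemma deriv_eq_on_upper_half_plane:
  assumes "z \<in> upper_half_plane" "\<And>z. z \<in> upper_half_plane \<Longrightarrow> f z = g z"
  shows "deriv f z = deriv g z"
  by (rule deriv_cong_ev) (use assms eventually_nhds_in_open[OF open_upper_half_plane assms(1)] in \<open>auto elim: eventually_mono\<close>)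

text \<open>In the local parameter of each cusp, differentiation multiplies a coefficient by its
  exponent, up to a constant. The constant terms disappear, so a finite limit at a cusp turns into
  the limit 0, and a pole at infinity keeps its order.\<close>

lemma deriv_form_S_sharp:
  assumes N: "N > 0" and f: "f \<in> M_sharp 0 N"
  shows "deriv_form f \<in> S_sharp 2 N"
    and "q_coeff (deriv_form f) n = 2 * of_real pi * \<i> * of_int n * q_coeff f n"
    and "has_q_expansion 1 (deriv_form f) (q_expansion (deriv_form f))"
proof -
  have inv: "invariant_form 0 N f" using f by (simp add: M_sharp_iff[OF N])
  then have hol: "f holomorphic_on upper_half_plane" by (simp add: invariant_form_def)
  have F: "has_q_expansion 1 f (q_expansion f)" by (rule M_sharp_q_expansion[OF N f])
  have D: "has_q_expansion 1 (deriv_form f) (fls_const (2 * of_real pi * \<i>) * (fls_X * fls_deriv (q_expansion f)))"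
    using has_q_expansion_deriv'[OF F] by (simp add: has_q_expansion_def deriv_form_def)
  show "has_q_expansion 1 (deriv_form f) (q_expansion (deriv_form f))"
    using D has_q_expansion_q_expansion[OF D] by simp
  show "q_coeff (deriv_form f) n = 2 * of_real pi * \<i> * of_int n * q_coeff f n"
    unfolding q_coeff_def has_q_expansion_q_expansion[OF D] by (simp add: fls_X_times_conv_shift algebra_simps)
  show "deriv_form f \<in> S_sharp 2 N" unfolding S_sharp_iff[OF N]
  proof (intro conjI ballI)
    have "deriv f holomorphic_on upper_half_plane" using hol by (rule holomorphic_deriv) simp
    then have "deriv_form f holomorphic_on upper_half_plane"
      by (rule holomorphic_transform) (simp add: deriv_form_def)
    moreover have "slash 2 (deriv_form f) A z = deriv_form f z" if "A \<in> Gamma0 N" "z \<in> upper_half_plane" for A z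
    proof -
      have "slash 2 (deriv_form f) A z = deriv (slash 0 f A) z"
        using slash_deriv_form[OF hol Gamma0_SL2Z] that by blast
      also have "\<dots> = deriv f z"
        by (rule deriv_eq_on_upper_half_plane) (use inv that in \<open>auto simp: invariant_form_def\<close>)
      finally show ?thesis using that by (simp add: deriv_form_def)
    qed
    ultimately show "invariant_form 2 N (deriv_form f)" by (auto simp: invariant_form_def deriv_form_def)
    show "moderate_growth (deriv_form f)" by (rule has_q_expansion_imp_moderate[OF D])
    fix A assume A: "A \<in> SL2Z - Gamma0 N"
    obtain F where F: "has_q_expansion N (slash 0 f A) F"
      using f A by (auto simp: M_sharp_def weakly_holomorphic_forms_def)
    then have F0: "\<forall>j<0. fls_nth F j = 0" using f A by (auto simp: M_sharp_def)
    have "has_q_expansion N (slash 2 (deriv_form f) A) (fls_const (2 * of_real pi * \<i> / of_nat N) * (fls_X * fls_deriv F))"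
      using has_q_expansion_deriv'[OF F N] slash_deriv_form[OF hol] A by (auto simp: has_q_expansion_def)
    from has_q_expansion_tendsto_iff[OF this N, of 0 0] F0
    show "(slash 2 (deriv_form f) A \<longlongrightarrow> 0) at_ioo" by (simp add: fls_X_times_conv_shift)
  qed
qed

subsection \<open>The constant term in weight 2\<close>

definition right_coset :: "nat \<Rightarrow> int^2^2 \<Rightarrow> (int^2^2) set" where
  "right_coset N A = {C ** A | C. C \<in> Gamma0 N}"

lemma mem_right_coset: "A \<in> right_coset N A"
  unfolding right_coset_def using Gamma0_one[of N] by (force intro: exI[of _ "mat 1"])

lemma right_coset_eq_iff:
  assumes A: "A \<in> SL2Z" and B: "B \<in> SL2Z"
  shows "right_coset N A = right_coset N B \<longleftrightarrow> A ** mat2_inv B \<in> Gamma0 N"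
proof
  assume "right_coset N A = right_coset N B"
  then have "A \<in> right_coset N B" using mem_right_coset by blast
  then obtain C where C: "C \<in> Gamma0 N" "A = C ** B" by (auto simp: right_coset_def)
  then have "A ** mat2_inv B = C ** (B ** mat2_inv B)" by (simp add: matrix_mul_assoc)
  then show "A ** mat2_inv B \<in> Gamma0 N" using C mat2_inv_right[OF B] by simp
next
  assume D: "A ** mat2_inv B \<in> Gamma0 N"
  define E where "E = A ** mat2_inv B"
  have E: "E \<in> Gamma0 N" using D by (simp add: E_def)
  have AB: "A = E ** B" using mat2_inv_left[OF B] by (simp add: E_def flip: matrix_mul_assoc)
  have BA: "B = mat2_inv E ** A" using mat2_inv_left[OF Gamma0_SL2Z[OF E]] by (simp add: AB matrix_mul_assoc)
  show "right_coset N A = right_coset N B"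
  proof (intro equalityI subsetI)
    fix X assume "X \<in> right_coset N A"
    then obtain C where "C \<in> Gamma0 N" "X = C ** A" by (auto simp: right_coset_def)
    then have "X = (C ** E) ** B" "C ** E \<in> Gamma0 N" using E by (auto simp: AB matrix_mul_assoc intro: Gamma0_mult)
    then show "X \<in> right_coset N B" by (auto simp: right_coset_def)
  next
    fix X assume "X \<in> right_coset N B"
    then obtain C where C: "C \<in> Gamma0 N" "X = C ** B" by (auto simp: right_coset_def)
    have "X = (C ** mat2_inv E) ** A" unfolding C(2) by (subst BA) (simp add: matrix_mul_assoc)
    moreover have "C ** mat2_inv E \<in> Gamma0 N" using C E by (intro Gamma0_mult Gamma0_inv)
    ultimately show "X \<in> right_coset N A" by (auto simp: right_coset_def)
  qed
qed

text \<open>If \<open>A\<close> and \<open>B\<close> agree modulo \<open>N\<close>, the lower left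
  entry of \<open>A ** mat2_inv B\<close> is congruent to that of \<open>B ** mat2_inv B\<close>,
  which is 0. So the residues of the entries determine the coset.\<close>

lemma finite_right_cosets:
  assumes N: "N > 0" shows "finite (right_coset N ` SL2Z)"
proof -
  define I where "I = {0..<int N}"
  define r where "r A = (A $ 1 $ 1 mod int N, A $ 1 $ 2 mod int N, A $ 2 $ 1 mod int N, A $ 2 $ 2 mod int N)" for A :: "int^2^2"
  have fin: "finite (r ` SL2Z)"
    by (rule finite_subset[of _ "I \<times> I \<times> I \<times> I"]) (use N in \<open>auto simp: r_def I_def\<close>)
  have "right_coset N A = right_coset N B" if "A \<in> SL2Z" "B \<in> SL2Z" "r A = r B" for A B
  proof -
    have "(A $ 2 $ 1 * B $ 2 $ 2 - A $ 2 $ 2 * B $ 2 $ 1) mod int N = (B $ 2 $ 1 * B $ 2 $ 2 - B $ 2 $ 2 * B $ 2 $ 1) mod int N"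
      using that(3) by (intro mod_diff_cong mod_mult_cong) (auto simp: r_def)
    then have "int N dvd (A ** mat2_inv B) $ 2 $ 1"
      by (simp add: mat2_mult_nth mat2_inv_def mod_eq_0_iff_dvd mult.commute)
    then show ?thesis unfolding right_coset_eq_iff[OF that(1,2)] Gamma0_iff
      using that by (auto intro: SL2Z_mult SL2Z_inv)
  qed
  then have "right_coset N ` SL2Z = (\<lambda>x. right_coset N (SOME A. A \<in> SL2Z \<and> r A = x)) ` (r ` SL2Z)"
    unfolding image_image by (intro image_cong refl) (metis (mono_tags, lifting) someI_ex)
  then show ?thesis using fin by simp
qed

lemma weight_2_level_1_primitive_periodic:
  assumes hol: "H holomorphic_on upper_half_plane"
    and inv: "\<And>A z. A \<in> SL2Z \<Longrightarrow> z \<in> upper_half_plane \<Longrightarrow> slash 2 H A z = H z"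
  obtains P where "\<And>z. z \<in> upper_half_plane \<Longrightarrow> (P has_field_derivative H z) (at z)"
    "\<And>z. z \<in> upper_half_plane \<Longrightarrow> P (z + 1) = P z"
proof -
  obtain P where "\<And>z. z \<in> upper_half_plane \<Longrightarrow> (P has_field_derivative H z) (at z within upper_half_plane)"
    using holomorphic_convex_primitive'[OF convex_upper_half_plane open_upper_half_plane hol] by blast
  then have P: "(P has_field_derivative H z) (at z)" if "z \<in> upper_half_plane" for z
    using that by (metis at_within_open open_upper_half_plane)
  have const: "\<exists>c. \<forall>z\<in>upper_half_plane. P (moebius_action A z) = P z + c" if A: "A \<in> SL2Z" for A
  proof -
    have "((\<lambda>z. P (moebius_action A z) - P z) has_field_derivative 0) (at z within upper_half_plane)" if z: "z \<in> upper_half_plane" for z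
    proof -
      have "((\<lambda>z. P (moebius_action A z)) has_field_derivative (H (moebius_action A z) * automorphy_factor A z powi (- 2))) (at z)"
        by (rule DERIV_chain2[OF P[OF moebius_action_in_H[OF A z]] has_derivative_moebius_action[OF A z]])
      then have "((\<lambda>z. P (moebius_action A z)) has_field_derivative H z) (at z)"
        using inv[OF A z] by (simp add: slash_def mult.commute)
      from DERIV_diff[OF this P[OF z]] have "((\<lambda>z. P (moebius_action A z) - P z) has_field_derivative 0) (at z)" by simp
      then show ?thesis by (rule has_field_derivative_at_within)
    qed
    then obtain c where "\<And>z. z \<in> upper_half_plane \<Longrightarrow> P (moebius_action A z) - P z = c"
      using has_field_derivative_zero_constant[OF convex_upper_half_plane, of "\<lambda>z. P (moebius_action A z) - P z"] by blast
    then show ?thesis by (intro exI[of _ c]) (auto simp: algebra_simps)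
  qed
  have T: "mat2 1 1 0 1 \<in> SL2Z" and S: "mat2 0 (-1) 1 0 \<in> SL2Z" by (auto simp: SL2Z_iff)
  obtain c where c: "\<And>z. z \<in> upper_half_plane \<Longrightarrow> P (z + 1) = P z + c"
    using const[OF T] by (auto simp: moebius_action_def automorphy_factor_def)
  obtain d where d: "\<And>z. z \<in> upper_half_plane \<Longrightarrow> P (- 1 / z) = P z + d"
    using const[OF S] by (auto simp: moebius_action_def automorphy_factor_def)
  have "- 1 / \<i> = \<i>" by simp
  with d[of \<i>] have d0: "d = 0" by (simp add: upper_half_plane_def)
  \<comment> \<open>The cube root of unity with \<open>- 1 / (w + 1) = w\<close>. Comparing
    \<open>P\<close> at \<open>w + 1\<close> and at \<open>w\<close> gives \<open>c = - d\<close>,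
    and \<open>d\<close> is already known to be 0.\<close>
  define w where "w = Complex (- 1 / 2) (sqrt 3 / 2)"
  have "(w + 1) * w = - 1" by (simp add: w_def complex_eq_iff algebra_simps)
  moreover have w: "w \<in> upper_half_plane" "w + 1 \<in> upper_half_plane" by (simp_all add: w_def upper_half_plane_def)
  moreover have "w + 1 \<noteq> 0" by (auto simp: w_def complex_eq_iff)
  ultimately have "- 1 / (w + 1) = w" by (simp add: field_simps)
  with d[OF w(2)] c[OF w(1)] d0 have "c = 0" by simp
  with c have "\<And>z. z \<in> upper_half_plane \<Longrightarrow> P (z + 1) = P z" by simp
  with P show ?thesis using that by blast
qed

text \<open>By periodicity \<open>P\<close> descends to a function \<open>p\<close> on the punctured
  disc, and in the coordinate \<open>w\<close> of the disc \<open>H\<close> is a multiple of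
  \<open>w * deriv p w\<close>. So the expansion divided by \<open>w\<close> has a primitive; its
  integral over a circle vanishes, and that integral is a multiple of the constant term.\<close>

lemma q_expansion_of_periodic_primitive:
  assumes P: "\<And>z. z \<in> upper_half_plane \<Longrightarrow> (P has_field_derivative H z) (at z)"
    and per: "\<And>z. z \<in> upper_half_plane \<Longrightarrow> P (z + 1) = P z"
    and F: "has_q_expansion 1 H F"
  shows "fls_nth F 0 = 0"
proof -
  have "P holomorphic_on upper_half_plane" using P by (auto simp: holomorphic_on_open)
  then obtain p where p: "p holomorphic_on ball 0 1 - {0}" "\<And>z. z \<in> upper_half_plane \<Longrightarrow> P z = p (qe z)"
    using periodic_descends_to_disc[of P 1] per by auto
  have dp: "(p has_field_derivative deriv p w) (at w)" if "w \<in> ball 0 1 - {0}" for w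
    using p(1) that by (intro holomorphic_derivI[of _ "ball 0 1 - {0}"]) (auto intro: open_delete)
  have Fr: "fls_conv_radius F \<ge> 1" and Fe: "\<And>z. z \<in> upper_half_plane \<Longrightarrow> H z = eval_fls F (qe z)"
    using F by (auto simp: has_q_expansion_alt)
  have eq: "eval_fls F w = 2 * of_real pi * \<i> * (w * deriv p w)" if w: "w \<in> ball 0 1 - {0}" for w
  proof -
    define z where "z = of_nat 1 * Ln w / (2 * of_real pi * \<i>)"
    have qz: "qe z = w" using qe_surj(1)[of w 1] w by (simp add: z_def)
    have "norm (qe z) < 1" using w qz by simp
    then have "Im z > 0" by (simp add: norm_qe zero_less_mult_iff)
    then have z: "z \<in> upper_half_plane" by (simp add: upper_half_plane_def)
    have "((\<lambda>z. p (qe z)) has_field_derivative deriv p w * (2 * of_real pi * \<i> * qe z)) (at z)"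
      by (rule DERIV_chain2[OF _ qe_deriv]) (use dp[OF w] qz in simp)
    then have "(P has_field_derivative deriv p w * (2 * of_real pi * \<i> * qe z)) (at z)"
      by (rule has_field_derivative_transform_within_open[where S = upper_half_plane]) (use z p in auto)
    then have "H z = deriv p w * (2 * of_real pi * \<i> * qe z)" using P[OF z] DERIV_unique by blast
    then show ?thesis using Fe[OF z] qz by (simp add: mult_ac)
  qed
  have Fl: "eval_fls F has_laurent_expansion F"
    using Fr by (intro eval_fls_has_laurent_expansion) (auto intro: less_le_trans[rotated])
  have Fh: "eval_fls F holomorphic_on ball 0 1 - {0}"
  proof (rule holomorphic_on_subset[OF holomorphic_on_eval_fls[OF order_refl]])
    have "ball 0 1 \<subseteq> eball 0 (fls_conv_radius F)" using Fr by (intro ball_eball_mono) (simp add: one_ereal_def)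
    then show "ball 0 1 - {0} \<subseteq> eball 0 (fls_conv_radius F) - (if 0 \<le> fls_subdegree F then {} else {0})" by auto
  qed
  have "((\<lambda>w. eval_fls F w * w powi (- (0 + 1))) has_contour_integral 2 * of_real pi * \<i> * fls_nth F 0) (circlepath 0 (1/2))"
    using fls_nth_as_contour_integral[OF Fl Fh, of "1/2" 0] by simp
  moreover have "((\<lambda>w. eval_fls F w * w powi (- (0 + 1))) has_contour_integral 0) (circlepath 0 (1/2))"
  proof -
    have "((\<lambda>w. 2 * of_real pi * \<i> * deriv p w) has_contour_integral
       (2 * of_real pi * \<i> * p (pathfinish (circlepath 0 (1/2))) - 2 * of_real pi * \<i> * p (pathstart (circlepath 0 (1/2))))) (circlepath 0 (1/2))"
    proof (rule contour_integral_primitive[where S = "ball 0 1 - {0}" and f = "\<lambda>w. 2 * of_real pi * \<i> * p w"])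
      fix w assume "w \<in> ball 0 1 - {0 :: complex}"
      from DERIV_cmult[OF dp[OF this]]
      show "((\<lambda>w. 2 * of_real pi * \<i> * p w) has_field_derivative 2 * of_real pi * \<i> * deriv p w) (at w within ball 0 1 - {0})"
        by (rule has_field_derivative_at_within)
    qed (auto simp: path_image_circlepath)
    then have "((\<lambda>w. 2 * of_real pi * \<i> * deriv p w) has_contour_integral 0) (circlepath 0 (1/2))" by simp
    then show ?thesis
    proof (rule has_contour_integral_eq)
      fix w :: complex assume "w \<in> path_image (circlepath 0 (1/2))"
      then have w: "w \<in> ball 0 1 - {0}" by (auto simp: path_image_circlepath)
      then show "2 * of_real pi * \<i> * deriv p w = eval_fls F w * w powi (- (0 + 1))"
        unfolding eq[OF w] by (simp add: power_int_minus field_simps)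
    qed
  qed
  ultimately have "2 * of_real pi * \<i> * fls_nth F 0 = 0" by (rule has_contour_integral_unique)
  then show ?thesis by simp
qed

text \<open>In the trace, the coset of the identity contributes \<open>f\<close> and every other
  coset a function tending to 0 at infinity. This is where vanishing at the other cusps, and not
  only boundedness, enters.\<close>

theorem S_sharp_2_constant_coeff:
  assumes N: "N > 0" and f: "f \<in> S_sharp 2 N"
  shows "q_coeff f 0 = 0"
proof -
  have inv: "invariant_form 2 N f" and lim0: "\<And>A. A \<in> SL2Z - Gamma0 N \<Longrightarrow> (slash 2 f A \<longlongrightarrow> 0) at_ioo"
    using f by (auto simp: S_sharp_iff[OF N])
  then have hol: "f holomorphic_on upper_half_plane" by (simp add: invariant_form_def)
  define R where "R = right_coset N ` SL2Z"
  have finR: "finite R" unfolding R_def by (rule finite_right_cosets[OF N])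
  define rep where "rep X = (SOME A. A \<in> SL2Z \<and> right_coset N A = X)" for X
  have rep: "rep X \<in> SL2Z" "right_coset N (rep X) = X" if X: "X \<in> R" for X
  proof -
    obtain A where "A \<in> SL2Z \<and> right_coset N A = X" using X by (auto simp: R_def)
    then have "rep X \<in> SL2Z \<and> right_coset N (rep X) = X" unfolding rep_def by (rule someI)
    then show "rep X \<in> SL2Z" "right_coset N (rep X) = X" by auto
  qed
  have sl: "slash 2 f A z = slash 2 f B z" if "A \<in> SL2Z" "B \<in> SL2Z" "right_coset N A = right_coset N B" "z \<in> upper_half_plane" for A B z
  proof -
    have "A \<in> right_coset N B" using that(3) mem_right_coset by blast
    then obtain C where "C \<in> Gamma0 N" "A = C ** B" by (auto simp: right_coset_def)
    then show ?thesis using invariant_form_slash_coset[OF inv that(2) _ that(4)] by simp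
  qed
  define H where "H z = (\<Sum>X\<in>R. slash 2 f (rep X) z)" for z
  have Hhol: "H holomorphic_on upper_half_plane"
    unfolding H_def [abs_def] by (intro holomorphic_on_sum holomorphic_slash rep hol)
  have Hinv: "slash 2 H B z = H z" if B: "B \<in> SL2Z" and z: "z \<in> upper_half_plane" for B z
  proof -
    \<comment> \<open>Right multiplication permutes the cosets, the inverse permutation coming from
      the inverse matrix; this reindexes the sum.\<close>
    define b where "b C X = right_coset N (rep X ** C)" for C X
    have bR: "b C X \<in> R" if "X \<in> R" "C \<in> SL2Z" for C X
      using rep(1)[OF that(1)] that(2) by (auto simp: b_def R_def intro: SL2Z_mult)
    have binv: "b (mat2_inv C) (b C X) = X" if X: "X \<in> R" and C: "C \<in> SL2Z" for C X
    proof -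
      have r: "rep (b C X) \<in> SL2Z" "right_coset N (rep (b C X)) = right_coset N (rep X ** C)"
        using rep[OF bR[OF X C]] by (auto simp: b_def)
      then have "rep (b C X) ** mat2_inv (rep X ** C) \<in> Gamma0 N"
        using right_coset_eq_iff[OF r(1) SL2Z_mult[OF rep(1)[OF X] C]] by simp
      moreover have "mat2_inv (rep X ** C) = mat2_inv C ** mat2_inv (rep X)"
        by (simp add: mat2_eq_iff mat2_inv_def mat2_mult_nth mult.commute)
      ultimately have "(rep (b C X) ** mat2_inv C) ** mat2_inv (rep X) \<in> Gamma0 N" by (simp add: matrix_mul_assoc)
      then have "right_coset N (rep (b C X) ** mat2_inv C) = right_coset N (rep X)"
        using right_coset_eq_iff[OF SL2Z_mult[OF r(1) SL2Z_inv[OF C]] rep(1)[OF X]] by blast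
      then show ?thesis using rep(2)[OF X] by (simp add: b_def)
    qed
    have "mat2_inv (mat2_inv B) = B" by (simp add: mat2_eq_iff mat2_inv_def)
    then have bij: "bij_betw (b B) R R"
      using binv[OF _ B] binv[OF _ SL2Z_inv[OF B]] bR B SL2Z_inv[OF B]
      by (intro bij_betw_byWitness[where f' = "b (mat2_inv B)"]) auto
    have "slash 2 H B z = (\<Sum>X\<in>R. slash 2 (slash 2 f (rep X)) B z)"
      by (simp add: slash_def[of 2 H] H_def slash_def[of 2 "slash 2 f _"] sum_distrib_left)
    also have "\<dots> = (\<Sum>X\<in>R. slash 2 f (rep (b B X)) z)"
    proof (rule sum.cong)
      fix X assume X: "X \<in> R"
      have "slash 2 (slash 2 f (rep X)) B z = slash 2 f (rep X ** B) z"
        by (rule slash_mult[OF rep(1)[OF X] B z, symmetric])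
      also have "\<dots> = slash 2 f (rep (b B X)) z"
        using rep[OF bR[OF X B]] rep(1)[OF X] B z by (intro sl SL2Z_mult) (auto simp: b_def)
      finally show "slash 2 (slash 2 f (rep X)) B z = slash 2 f (rep (b B X)) z" .
    qed simp
    also have "\<dots> = H z" unfolding H_def by (rule sum.reindex_bij_betw[OF bij])
    finally show ?thesis .
  qed
  define X0 where "X0 = right_coset N (mat 1)"
  have X0: "X0 \<in> R" unfolding X0_def R_def using SL2Z_one by blast
  have mat1_inv: "mat2_inv (mat 1) = mat 1" by (simp add: mat2_eq_iff mat2_inv_def mat2_one_nth)
  have "((\<lambda>z. \<Sum>X\<in>R - {X0}. slash 2 f (rep X) z) \<longlongrightarrow> (\<Sum>X\<in>R - {X0}. 0)) at_ioo"
  proof (rule tendsto_sum)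
    fix X assume X: "X \<in> R - {X0}"
    have "rep X \<notin> Gamma0 N"
    proof
      assume "rep X \<in> Gamma0 N"
      then have "right_coset N (rep X) = right_coset N (mat 1)"
        using right_coset_eq_iff[OF rep(1)[of X] SL2Z_one, of N] X by (simp add: mat1_inv)
      then show False using X rep(2)[of X] by (auto simp: X0_def)
    qed
    then show "(slash 2 f (rep X) \<longlongrightarrow> 0) at_ioo" using rep(1)[of X] X by (intro lim0) auto
  qed
  then have sum0: "((\<lambda>z. \<Sum>X\<in>R - {X0}. slash 2 f (rep X) z) \<longlongrightarrow> 0) at_ioo" by simp
  have Hf: "H z = f z + (\<Sum>X\<in>R - {X0}. slash 2 f (rep X) z)" if z: "z \<in> upper_half_plane" for z
  proof -
    have "slash 2 f (rep X0) z = slash 2 f (mat 1) z"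
      by (rule sl) (use rep[OF X0] SL2Z_one z in \<open>auto simp: X0_def\<close>)
    then show ?thesis unfolding H_def using sum.remove[OF finR X0, of "\<lambda>X. slash 2 f (rep X) z"] by (simp add: slash_one)
  qed
  \<comment> \<open>The difference tends to 0, so it has an expansion without constant term; the
    expansion of \<open>H\<close> is then the sum of those of \<open>g\<close> and
    \<open>f\<close>.\<close>
  define g where "g z = H z + (- 1) * f z" for z
  have g0: "(g \<longlongrightarrow> 0) at_ioo"
    by (rule Lim_transform_eventually[OF sum0]) (use eventually_upper_half_plane in eventually_elim, simp add: g_def Hf)
  obtain B where B: "eventually (\<lambda>z. norm (g z) \<le> B) at_ioo" using tendsto_imp_eventually_bounded[OF g0] by blast
  obtain P where P: "\<And>z. z \<in> upper_half_plane \<Longrightarrow> (P has_field_derivative H z) (at z)"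
    "\<And>z. z \<in> upper_half_plane \<Longrightarrow> P (z + 1) = P z"
    using weight_2_level_1_primitive_periodic[OF Hhol Hinv] by blast
  have Hper: "H (z + 1) = H z" if "z \<in> upper_half_plane" for z
    using Hinv[of "mat2 1 1 0 1" z] that by (simp add: slash_translation SL2Z_iff)
  have "\<exists>G. has_q_expansion 1 g G"
  proof (rule has_q_expansion_exists[where n = 0 and B = B])
    show "g holomorphic_on upper_half_plane" unfolding g_def [abs_def] by (intro holomorphic_intros Hhol hol)
  qed (use B Hper invariant_form_periodic[OF inv] in \<open>auto simp: g_def\<close>)
  then obtain G where G: "has_q_expansion 1 g G" by blast
  have G0: "fls_nth G 0 = 0" using has_q_expansion_tendsto_iff[OF G zero_less_one, of 0 0] g0 by simp
  have F: "has_q_expansion 1 f (q_expansion f)" using M_sharp_q_expansion[OF N] f S_sharp_subset by blast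
  have "has_q_expansion 1 (\<lambda>z. g z + 1 * f z) (G + fls_const 1 * q_expansion f)"
    by (rule has_q_expansion_add_cmult[OF G F zero_less_one])
  then have "has_q_expansion 1 H (G + q_expansion f)" by (simp add: g_def)
  from q_expansion_of_periodic_primitive[OF P this] G0 show ?thesis by (simp add: q_coeff_def)
qed

subsection \<open>Reduced bases and duality from generators\<close>

text \<open>
  The coefficient \<open>a\<close> may be 0, so \<open>leading f n a\<close> only bounds the order of \<open>f\<close> from below.
\<close>
definition leading :: "(complex \<Rightarrow> complex) \<Rightarrow> int \<Rightarrow> complex \<Rightarrow> bool" where
  "leading f n a \<longleftrightarrow> ((\<lambda>z. f z * qe z powi (- n)) \<longlongrightarrow> a) at_ioo"

lemma leading_mult:
  assumes "leading f n a" "leading g m b" shows "leading (\<lambda>z. f z * g z) (n + m) (a * b)"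
proof -
  have "((\<lambda>z. (f z * qe z powi (- n)) * (g z * qe z powi (- m))) \<longlongrightarrow> a * b) at_ioo"
    using assms unfolding leading_def by (intro tendsto_mult)
  moreover have "qe z powi (- (n + m)) = qe z powi (- n) * qe z powi (- m)" for z
    using power_int_add[of "qe z" "- n" "- m"] by simp
  ultimately show ?thesis by (simp add: leading_def mult_ac)
qed

lemma leading_cmult: "leading f n a \<Longrightarrow> leading (\<lambda>z. c * f z) n (c * a)"
  unfolding leading_def using tendsto_mult_left[of "\<lambda>z. f z * qe z powi (- n)" a at_ioo c] by (simp add: mult.assoc)

lemma leading_add: "leading f n a \<Longrightarrow> leading g n b \<Longrightarrow> leading (\<lambda>z. f z + g z) n (a + b)"
  unfolding leading_def using tendsto_add[of "\<lambda>z. f z * qe z powi (- n)" a at_ioo "\<lambda>z. g z * qe z powi (- n)" b] by (simp add: algebra_simps)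

lemma leading_power: "leading f n a \<Longrightarrow> leading (\<lambda>z. f z ^ i) (int i * n) (a ^ i)"
proof (induction i)
  case 0
  then show ?case by (simp add: leading_def)
next
  case (Suc i)
  from leading_mult[OF Suc.prems Suc.IH[OF Suc.prems]] show ?case by (simp add: algebra_simps)
qed

text \<open>Shared by the two sides of the duality. Each multiplication by \<open>\<phi>\<close>
  lowers the order by exactly one, so \<open>F0\<close> yields forms of all orders up to
  \<open>r\<close>. That no larger order occurs is not an assumption here, because it follows only
  from pairing the two spaces.\<close>

locale form_space =
  fixes V :: "(complex \<Rightarrow> complex) set" and \<phi> F0 :: "complex \<Rightarrow> complex" and r :: int and a b :: complex
  assumes expansion: "f \<in> V \<Longrightarrow> has_q_expansion 1 f (q_expansion f)"
    and zero_outside: "f \<in> V \<Longrightarrow> z \<notin> upper_half_plane \<Longrightarrow> f z = 0"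
    and add_cmult: "f \<in> V \<Longrightarrow> g \<in> V \<Longrightarrow> (\<lambda>z. f z + c * g z) \<in> V"
    and mult: "f \<in> V \<Longrightarrow> (\<lambda>z. \<phi> z * f z) \<in> V"
    and \<phi>: "leading \<phi> (- 1) a" "a \<noteq> 0"
    and F0: "F0 \<in> V" "leading F0 r b" "b \<noteq> 0"
begin

lemma leading_iff: "f \<in> V \<Longrightarrow> leading f n L \<longleftrightarrow> (\<forall>j<n. q_coeff f j = 0) \<and> q_coeff f n = L"
  unfolding leading_def by (rule q_coeff_tendsto_iff[OF expansion])

lemma coeff_add_cmult: "f \<in> V \<Longrightarrow> g \<in> V \<Longrightarrow> q_coeff (\<lambda>z. f z + c * g z) n = q_coeff f n + c * q_coeff g n"
  by (intro q_coeff_add_cmult expansion)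

lemma exists_order: "\<exists>f\<in>V. leading f (r - int i) 1"
proof -
  have "\<exists>f\<in>V. \<exists>b. b \<noteq> 0 \<and> leading f (r - int i) b"
  proof (induction i)
    case 0
    then show ?case using F0 by auto
  next
    case (Suc i)
    then obtain f b where f: "f \<in> V" "b \<noteq> 0" "leading f (r - int i) b" by blast
    have "leading (\<lambda>z. \<phi> z * f z) (- 1 + (r - int i)) (a * b)" by (rule leading_mult[OF \<phi>(1) f(3)])
    then have "leading (\<lambda>z. \<phi> z * f z) (r - int (Suc i)) (a * b)" by (simp add: algebra_simps)
    then show ?case using mult[OF f(1)] f(2) \<phi>(2) by (intro bexI[of _ "\<lambda>z. \<phi> z * f z"] exI[of _ "a * b"]) auto
  qed
  then obtain f b where f: "f \<in> V" "b \<noteq> 0" "leading f (r - int i) b" by blast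
  define c where "c = 1 / b - 1"
  have "leading (\<lambda>z. f z + c * f z) (r - int i) (b + c * b)" by (intro leading_add leading_cmult f)
  moreover have "b + c * b = 1" using f by (simp add: c_def field_simps)
  ultimately show ?thesis using add_cmult[OF f(1) f(1), of c] by auto
qed

lemma exists_reduced: "\<exists>f\<in>V. \<forall>n\<le>r. q_coeff f n = (if n = r - int i then 1 else 0)"
proof (induction i rule: less_induct)
  case (less i)
  \<comment> \<open>Each further coefficient is cleared with the reduced form whose leading exponent
    is that very position. It comes from the outer induction, and being reduced it disturbs no other
    exponent up to \<open>r\<close>.\<close>
  have "\<exists>h\<in>V. \<forall>n\<le>r - int i + int l. q_coeff h n = (if n = r - int i then 1 else 0)" if "l \<le> i" for l
    using that
  proof (induction l)
    case 0
    obtain f where f: "f \<in> V" "leading f (r - int i) 1" using exists_order by blast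
    then show ?case using leading_iff[OF f(1)] by (intro bexI[of _ f]) auto
  next
    case (Suc l)
    then obtain h where h: "h \<in> V" "\<And>n. n \<le> r - int i + int l \<Longrightarrow> q_coeff h n = (if n = r - int i then 1 else 0)" by auto
    obtain f where f: "f \<in> V" "\<And>n. n \<le> r \<Longrightarrow> q_coeff f n = (if n = r - int (i - Suc l) then 1 else 0)"
      using less[of "i - Suc l"] Suc.prems by auto
    define c where "c = - q_coeff h (r - int i + int (Suc l))"
    have "q_coeff (\<lambda>z. h z + c * f z) n = (if n = r - int i then 1 else 0)" if n: "n \<le> r - int i + int (Suc l)" for n
    proof -
      have e: "q_coeff f n = (if n = r - int i + int (Suc l) then 1 else 0)"
        using f(2)[of n] n Suc.prems by (auto simp: of_nat_diff)
      show ?thesis unfolding coeff_add_cmult[OF h(1) f(1)] e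
        using h(2)[of n] n by (auto simp: c_def)
    qed
    then show ?case using add_cmult[OF h(1) f(1)] by blast
  qed
  from this[of i] show ?case by simp
qed

text \<open>By the hypothesis a form is 0 once its coefficients up to \<open>r\<close> are. This
  bounds the order and gives the uniqueness required by the description operator in
  \<open>reduced_form\<close>.\<close>

lemma reduced_form_properties:
  assumes max: "\<And>f. f \<in> V \<Longrightarrow> (\<And>j. j \<le> r \<Longrightarrow> q_coeff f j = 0) \<Longrightarrow> q_expansion f = 0"
  shows "max_order_infinity V = r"
    and "m \<ge> - r \<Longrightarrow> reduced_form V m \<in> V"
    and "m \<ge> - r \<Longrightarrow> n \<le> r \<Longrightarrow> q_coeff (reduced_form V m) n = (if n = - m then 1 else 0)"
proof -
  have zero: "f = (\<lambda>z. 0)" if f: "f \<in> V" "q_expansion f = 0" for f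
  proof
    fix z show "f z = 0"
      using expansion[OF f(1)] f zero_outside[OF f(1)] by (cases "z \<in> upper_half_plane") (auto simp: has_q_expansion_def)
  qed
  show mo: "max_order_infinity V = r" unfolding max_order_infinity_def
  proof (rule Greatest_equality)
    obtain f where f: "f \<in> V" "leading f (r - int 0) 1" using exists_order by blast
    then have c: "\<And>j. j < r \<Longrightarrow> fls_nth (q_expansion f) j = 0" "fls_nth (q_expansion f) r = 1"
      using leading_iff[OF f(1)] by (auto simp: q_coeff_def)
    then have "fls_subdegree (q_expansion f) = r" by (intro fls_subdegree_eqI) auto
    moreover have "q_expansion (\<lambda>z. 0) = 0"
      by (rule has_q_expansion_q_expansion) (simp add: has_q_expansion_def)
    then have "f \<noteq> (\<lambda>z. 0)" using c(2) by auto
    ultimately show "\<exists>f\<in>V. f \<noteq> (\<lambda>z. 0) \<and> fls_subdegree (q_expansion f) = r" using f by blast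
  next
    fix s assume "\<exists>f\<in>V. f \<noteq> (\<lambda>z. 0) \<and> fls_subdegree (q_expansion f) = s"
    then obtain f where f: "f \<in> V" "f \<noteq> (\<lambda>z. 0)" "fls_subdegree (q_expansion f) = s" by blast
    show "s \<le> r"
    proof (rule ccontr)
      assume "\<not> s \<le> r"
      then have "q_expansion f = 0"
        using f by (intro max) (auto simp: q_coeff_def fls_eq0_below_subdegree)
      then show False using zero f by blast
    qed
  qed
  assume m: "m \<ge> - r"
  have ex: "\<exists>f\<in>V. \<forall>n\<le>r. q_coeff f n = (if n = - m then 1 else 0)"
    using exists_reduced[of "nat (r + m)"] m by simp
  then obtain f where f: "f \<in> V" "\<forall>n\<le>r. q_coeff f n = (if n = - m then 1 else 0)" by blast
  have un: "g = f" if g: "g \<in> V" "\<forall>n\<le>r. q_coeff g n = (if n = - m then 1 else 0)" for g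
  proof -
    have d: "(\<lambda>z. g z + (- 1) * f z) \<in> V" by (rule add_cmult[OF g(1) f(1)])
    have "q_expansion (\<lambda>z. g z + (- 1) * f z) = 0"
      by (rule max[OF d]) (simp only: coeff_add_cmult[OF g(1) f(1)], use f g in simp)
    note eq0 = zero[OF d this]
    show ?thesis
    proof
      fix z show "g z = f z" using fun_cong[OF eq0, of z] by simp
    qed
  qed
  have "reduced_form V m = f" unfolding reduced_form_def mo
  proof (rule the_equality)
    show "f \<in> V \<and> (\<forall>n\<le>r. q_coeff f n = (if n = - m then 1 else 0))" using f by blast
  qed (use un in blast)
  then show "reduced_form V m \<in> V" "n \<le> r \<Longrightarrow> q_coeff (reduced_form V m) n = (if n = - m then 1 else 0)"
    using f by auto
qed

end

section \<open>Pairing the two reduced bases\<close>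

lemma fls_nth_mult_eq_0:
  fixes F G :: "complex fls"
  assumes "\<And>j. j < a \<Longrightarrow> fls_nth F j = 0" "\<And>j. j < b \<Longrightarrow> fls_nth G j = 0" "n < a + b"
  shows "fls_nth (F * G) n = 0"
proof (cases "F = 0 \<or> G = 0")
  case False
  then have "fls_subdegree F \<ge> a" "fls_subdegree G \<ge> b" using assms by (auto intro!: fls_subdegree_geI)
  then show ?thesis using False assms(3) by (intro fls_eq0_below_subdegree) simp
qed auto

text \<open>Splitting off the leading monomials leaves tails that start at exponents
  \<open>r + 1\<close> and \<open>- r\<close> or later, so their product starts at 1 or later. The
  product of the monomials has exponent \<open>- m - n < 0\<close>. Only the two mixed products
  contribute.\<close>

lemma fls_constant_coeff_of_reduced_product:
  fixes F G :: "complex fls"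
  assumes F: "\<And>j. j \<le> r \<Longrightarrow> fls_nth F j = (if j = - m then 1 else 0)"
    and G: "\<And>j. j \<le> - 1 - r \<Longrightarrow> fls_nth G j = (if j = - n then 1 else 0)"
    and m: "m \<ge> - r" and n: "n \<ge> 1 + r"
  shows "fls_nth (F * G) 0 = fls_nth F n + fls_nth G m"
proof -
  define F' where "F' = F - fls_X_intpow (- m)"
  define G' where "G' = G - fls_X_intpow (- n)"
  have "fls_nth F' j = 0" if "j < r + 1" for j using F[of j] that by (simp add: F'_def)
  moreover have "fls_nth G' j = 0" if "j < - r" for j using G[of j] that by (simp add: G'_def)
  ultimately have FG: "fls_nth (F' * G') 0 = 0" using fls_nth_mult_eq_0[of "r + 1" F' "- r" G' 0] by simp
  have "F * G = F' * G' + fls_X_intpow (- m) * G + fls_X_intpow (- n) * F - fls_X_intpow (- m) * fls_X_intpow (- n)"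
    by (simp add: F'_def G'_def algebra_simps)
  then show ?thesis using FG m n
    by (simp add: fls_shifted_times_simps)
qed

lemma M_sharp_zero_outside:
  "N > 0 \<Longrightarrow> f \<in> M_sharp k N \<Longrightarrow> z \<notin> upper_half_plane \<Longrightarrow> f z = 0"
  by (simp add: M_sharp_iff invariant_form_def)

text \<open>The orders \<open>r\<close> and \<open>- 1 - r\<close> of \<open>F\<close> and
  \<open>G\<close> turn out to be \<open>n0\<close> and \<open>n1\<close>. That they add up to -1 is
  used twice: a form of larger order would meet a form of the opposite order in the other space, and
  the tails of two reduced forms have a product without constant term.\<close>

theorem duality_of_generators:
  fixes N :: nat and k n0 n1 m n r :: int
  assumes N: "N > 0"
    and \<phi>: "\<phi> \<in> M_sharp 0 N" "leading \<phi> (- 1) a" "a \<noteq> 0"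
    and F: "F \<in> M_sharp k N" "leading F r b" "b \<noteq> 0"
    and G: "G \<in> S_sharp (2 - k) N" "leading G (- 1 - r) c" "c \<noteq> 0"
    and n0: "n0 = max_order_infinity (M_sharp k N)" and n1: "n1 = max_order_infinity (S_sharp (2 - k) N)"
    and m: "m \<ge> - n0" and n: "n \<ge> - n1"
  shows "a_coeff N k m n = - b_coeff N (2 - k) n m"
proof -
  have MS: "\<And>f. f \<in> S_sharp (2 - k) N \<Longrightarrow> f \<in> M_sharp (2 - k) N" using S_sharp_subset by blast
  interpret M: form_space "M_sharp k N" \<phi> F r a b
  proof
    fix f g c assume f: "f \<in> M_sharp k N" "g \<in> M_sharp k N"
    show "(\<lambda>z. f z + c * g z) \<in> M_sharp k N" by (rule M_sharp_add_cmult[OF N f])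
  next
    fix f assume f: "f \<in> M_sharp k N"
    show "(\<lambda>z. \<phi> z * f z) \<in> M_sharp k N" using M_sharp_mult[OF N \<phi>(1) f] by simp
    show "has_q_expansion 1 f (q_expansion f)" by (rule M_sharp_q_expansion[OF N f])
    fix z assume "z \<notin> upper_half_plane"
    then show "f z = 0" by (rule M_sharp_zero_outside[OF N f])
  qed (rule \<phi> F)+
  interpret S: form_space "S_sharp (2 - k) N" \<phi> G "- 1 - r" a c
  proof
    fix f g c assume f: "f \<in> S_sharp (2 - k) N" "g \<in> S_sharp (2 - k) N"
    show "(\<lambda>z. f z + c * g z) \<in> S_sharp (2 - k) N" by (rule S_sharp_add_cmult[OF N f])
  next
    fix f assume f: "f \<in> S_sharp (2 - k) N"
    show "(\<lambda>z. \<phi> z * f z) \<in> S_sharp (2 - k) N" using M_sharp_mult_S_sharp[OF N \<phi>(1) f] by simp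
    show "has_q_expansion 1 f (q_expansion f)" by (rule M_sharp_q_expansion[OF N MS[OF f]])
    fix z assume "z \<notin> upper_half_plane"
    then show "f z = 0" by (rule M_sharp_zero_outside[OF N MS[OF f]])
  qed (rule \<phi> G)+
  have pair: "(\<lambda>z. f z * g z) \<in> S_sharp 2 N" "q_coeff (\<lambda>z. f z * g z) 0 = 0"
    "q_expansion (\<lambda>z. f z * g z) = q_expansion f * q_expansion g"
    if f: "f \<in> M_sharp k N" and g: "g \<in> S_sharp (2 - k) N" for f g
  proof -
    show *: "(\<lambda>z. f z * g z) \<in> S_sharp 2 N" using M_sharp_mult_S_sharp[OF N f g] by simp
    show "q_coeff (\<lambda>z. f z * g z) 0 = 0" by (rule S_sharp_2_constant_coeff[OF N *])
    show "q_expansion (\<lambda>z. f z * g z) = q_expansion f * q_expansion g"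
      by (intro has_q_expansion_q_expansion has_q_expansion_mult M.expansion S.expansion f g zero_less_one)
  qed
  \<comment> \<open>Opposite orders put \<open>x * y\<close> into the constant term of a form of
    weight 2.\<close>
  have lead0: "x * y = 0" if "f \<in> M_sharp k N" "g \<in> S_sharp (2 - k) N" "leading f s x" "leading g (- s) y" for f g s x y
  proof -
    have "leading (\<lambda>z. f z * g z) 0 (x * y)" using leading_mult[OF that(3,4)] by simp
    moreover have "has_q_expansion 1 (\<lambda>z. f z * g z) (q_expansion (\<lambda>z. f z * g z))"
      using pair(1)[OF that(1,2)] S_sharp_subset by (blast intro: M_sharp_q_expansion[OF N])
    ultimately have "q_coeff (\<lambda>z. f z * g z) 0 = x * y"
      unfolding leading_def by (subst (asm) q_coeff_tendsto_iff) auto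
    then show ?thesis using pair(2)[OF that(1,2)] by simp
  qed
  have maxM: "q_expansion f = 0" if f: "f \<in> M_sharp k N" "\<And>j. j \<le> r \<Longrightarrow> q_coeff f j = 0" for f
  proof (rule ccontr)
    assume nz: "q_expansion f \<noteq> 0"
    define s where "s = fls_subdegree (q_expansion f)"
    have s: "q_coeff f s \<noteq> 0" "\<forall>j<s. q_coeff f j = 0" using nz by (auto simp: q_coeff_def s_def fls_eq0_below_subdegree)
    then have "s > r" using f(2) by (meson not_less)
    \<comment> \<open>Since \<open>s > r\<close>, the order \<open>- s\<close> is at most
      \<open>- 1 - r\<close> and is therefore attained in the other space.\<close>
    then obtain g where g: "g \<in> S_sharp (2 - k) N" "leading g (- s) 1"
      using S.exists_order[of "nat (s - 1 - r)"] by auto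
    have "leading f s (q_coeff f s)" using M.leading_iff[OF f(1)] s by blast
    from lead0[OF f(1) g(1) this g(2)] s show False by simp
  qed
  have maxS: "q_expansion f = 0" if f: "f \<in> S_sharp (2 - k) N" "\<And>j. j \<le> - 1 - r \<Longrightarrow> q_coeff f j = 0" for f
  proof (rule ccontr)
    assume nz: "q_expansion f \<noteq> 0"
    define s where "s = fls_subdegree (q_expansion f)"
    have s: "q_coeff f s \<noteq> 0" "\<forall>j<s. q_coeff f j = 0" using nz by (auto simp: q_coeff_def s_def fls_eq0_below_subdegree)
    then have "s > - 1 - r" using f(2) by (meson not_less)
    then obtain g where g: "g \<in> M_sharp k N" "leading g (- s) 1"
      using M.exists_order[of "nat (s + r)"] by auto
    have "leading f (- (- s)) (q_coeff f s)" using S.leading_iff[OF f(1)] s by simp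
    from lead0[OF g(1) f(1) g(2) this] s show False by simp
  qed
  have n0r: "n0 = r" unfolding n0 by (rule M.reduced_form_properties(1)[OF maxM])
  have n1r: "n1 = - 1 - r" unfolding n1 by (rule S.reduced_form_properties(1)[OF maxS])
  have m': "m \<ge> - r" and n': "n \<ge> - (- 1 - r)" using m n n0r n1r by auto
  let ?f = "f_form N k m" and ?g = "g_form N (2 - k) n"
  have fM: "?f \<in> M_sharp k N" unfolding f_form_def by (rule M.reduced_form_properties(2)[OF maxM m'])
  have gS: "?g \<in> S_sharp (2 - k) N" unfolding g_form_def by (rule S.reduced_form_properties(2)[OF maxS n'])
  have "fls_nth (q_expansion ?f * q_expansion ?g) 0 = fls_nth (q_expansion ?f) n + fls_nth (q_expansion ?g) m"
  proof (rule fls_constant_coeff_of_reduced_product[OF _ _ m'])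
    show "fls_nth (q_expansion ?f) j = (if j = - m then 1 else 0)" if "j \<le> r" for j
      using M.reduced_form_properties(3)[OF maxM m' that] by (simp add: f_form_def q_coeff_def)
    show "fls_nth (q_expansion ?g) j = (if j = - n then 1 else 0)" if "j \<le> - 1 - r" for j
      using S.reduced_form_properties(3)[OF maxS n' that] by (simp add: g_form_def q_coeff_def)
  qed (use n' in simp)
  then have "q_coeff ?f n + q_coeff ?g m = 0"
    using pair(2,3)[OF fM gS] by (simp add: q_coeff_def)
  then show ?thesis by (simp add: a_coeff_def b_coeff_def eq_neg_iff_add_eq_0)
qed

section \<open>Forms without zeros and their integral powers\<close>

lemma leading_lower:
  assumes f: "leading f n a" and m: "m < n" shows "leading f m 0"
proof -
  have "(qe \<longlongrightarrow> 0) at_ioo"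
  proof -
    have "filtermap qe at_ioo = at 0" using filtermap_qe[of 1] by simp
    then have "filterlim qe (at 0) at_ioo" unfolding filterlim_def by simp
    then show ?thesis by (rule filterlim_mono) (auto simp: at_within_def)
  qed
  then have "((\<lambda>z. (f z * qe z powi (- n)) * qe z ^ nat (n - m)) \<longlongrightarrow> a * 0 ^ nat (n - m)) at_ioo"
    using f unfolding leading_def by (intro tendsto_mult tendsto_power)
  moreover have "qe z powi (- n) * qe z ^ nat (n - m) = qe z powi (- m)" for z
  proof -
    have "qe z ^ nat (n - m) = qe z powi (n - m)" using m by (simp add: power_int_def)
    then show ?thesis using power_int_add[of "qe z" "- n" "n - m"] by simp
  qed
  moreover have "a * 0 ^ nat (n - m) = 0" using m by (simp add: zero_power)
  ultimately show ?thesis by (simp add: leading_def mult.assoc)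
qed

lemma leading_cong:
  assumes "leading f n a" "\<And>z. z \<in> upper_half_plane \<Longrightarrow> f z = g z" shows "leading g n a"
  unfolding leading_def
  by (rule Lim_transform_eventually[OF assms(1)[unfolded leading_def]])
     (use eventually_upper_half_plane in eventually_elim, simp add: assms(2))

lemma leading_diff: "leading f n a \<Longrightarrow> leading g n b \<Longrightarrow> leading (\<lambda>z. f z - g z) n (a - b)"
  using leading_add[of f n a "\<lambda>z. (- 1) * g z" "(- 1) * b"] leading_cmult[of g n b "- 1"] by simp

lemma leading_imp_moderate:
  assumes f: "leading f n a" shows "moderate_growth f"
proof -
  have "leading f (- int (nat \<bar>n\<bar>) - 1) 0" by (rule leading_lower[OF f]) auto
  then have "((\<lambda>z. f z * qe z powi int (nat \<bar>n\<bar> + 1)) \<longlongrightarrow> 0) at_ioo"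
    unfolding leading_def by (simp add: algebra_simps)
  from tendsto_imp_eventually_bounded[OF this] show ?thesis
    unfolding moderate_growth_def power_int_of_nat by blast
qed

text \<open>Every zero is concentrated at infinity, where the order is \<open>r\<close>. This is
  what keeps negative powers holomorphic in the upper half plane and bounded at the other
  cusps.\<close>

definition unit_form :: "int \<Rightarrow> nat \<Rightarrow> int \<Rightarrow> (complex \<Rightarrow> complex) \<Rightarrow> bool" where
  "unit_form w N r E \<longleftrightarrow> invariant_form w N E \<and> (\<forall>z\<in>upper_half_plane. E z \<noteq> 0) \<and>
     (\<forall>A\<in>SL2Z - Gamma0 N. \<exists>L. L \<noteq> 0 \<and> (slash w E A \<longlongrightarrow> L) at_ioo) \<and> (\<exists>b. b \<noteq> 0 \<and> leading E r b)"

definition form_power :: "(complex \<Rightarrow> complex) \<Rightarrow> int \<Rightarrow> complex \<Rightarrow> complex" where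
  "form_power E j z = (if z \<in> upper_half_plane then E z powi j else 0)"

lemma unit_form_power:
  assumes N: "N > 0" and E: "unit_form w N r E"
  shows "form_power E j \<in> M_sharp (w * j) N" and "\<exists>b. b \<noteq> 0 \<and> leading (form_power E j) (r * j) b"
proof -
  have inv: "invariant_form w N E" and nz: "\<And>z. z \<in> upper_half_plane \<Longrightarrow> E z \<noteq> 0"
    using E by (auto simp: unit_form_def)
  have sl: "slash (w * j) (form_power E j) A z = slash w E A z powi j" if "A \<in> SL2Z" "z \<in> upper_half_plane" for A z
    using moebius_action_in_H[OF that]
    by (simp add: slash_def form_power_def power_int_mult_distrib flip: power_int_mult)
  show *: "\<exists>b. b \<noteq> 0 \<and> leading (form_power E j) (r * j) b"
  proof -
    obtain b where b: "b \<noteq> 0" "leading E r b" using E by (auto simp: unit_form_def)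
    have "((\<lambda>z. (E z * qe z powi (- r)) powi j) \<longlongrightarrow> b powi j) at_ioo"
      using b unfolding leading_def by (intro tendsto_power_int)
    then have "((\<lambda>z. form_power E j z * qe z powi (- (r * j))) \<longlongrightarrow> b powi j) at_ioo"
    proof (rule Lim_transform_eventually)
      show "\<forall>\<^sub>F z in at_ioo. (E z * qe z powi (- r)) powi j = form_power E j z * qe z powi (- (r * j))"
        using eventually_upper_half_plane
        by eventually_elim (simp add: form_power_def power_int_mult_distrib flip: power_int_mult)
    qed
    then show ?thesis using b by (intro exI[of _ "b powi j"]) (simp add: leading_def)
  qed
  show "form_power E j \<in> M_sharp (w * j) N" unfolding M_sharp_iff[OF N]
  proof (intro conjI ballI)
    have "(\<lambda>z. E z powi j) holomorphic_on upper_half_plane"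
      using inv nz by (intro holomorphic_intros) (auto simp: invariant_form_def)
    then have "form_power E j holomorphic_on upper_half_plane"
      by (rule holomorphic_transform) (simp add: form_power_def)
    moreover have "slash (w * j) (form_power E j) A z = form_power E j z" if "A \<in> Gamma0 N" "z \<in> upper_half_plane" for A z
      using sl[OF Gamma0_SL2Z] inv that by (auto simp: invariant_form_def form_power_def)
    ultimately show "invariant_form (w * j) N (form_power E j)" by (auto simp: invariant_form_def form_power_def)
    show "moderate_growth (form_power E j)" using * leading_imp_moderate by blast
    fix A assume A: "A \<in> SL2Z - Gamma0 N"
    then obtain L where L: "L \<noteq> 0" "(slash w E A \<longlongrightarrow> L) at_ioo" using E by (auto simp: unit_form_def)
    have "((\<lambda>z. slash w E A z powi j) \<longlongrightarrow> L powi j) at_ioo" using L by (intro tendsto_power_int)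
    then have "(slash (w * j) (form_power E j) A \<longlongrightarrow> L powi j) at_ioo"
      by (rule Lim_transform_eventually) (use eventually_upper_half_plane in eventually_elim, use A sl in auto)
    then show "\<exists>L. (slash (w * j) (form_power E j) A \<longlongrightarrow> L) at_ioo" by blast
  qed
qed

lemma leading_deriv_form:
  assumes N: "N > 0" and \<phi>: "\<phi> \<in> M_sharp 0 N" "leading \<phi> (- 1) a"
  shows "leading (deriv_form \<phi>) (- 1) (- (2 * of_real pi * \<i>) * a)"
proof -
  have "(\<forall>j<(- 1). q_coeff \<phi> j = 0) \<and> q_coeff \<phi> (- 1) = a"
    using \<phi>(2) unfolding leading_def q_coeff_tendsto_iff[OF M_sharp_q_expansion[OF N \<phi>(1)]] .
  then show ?thesis
    unfolding leading_def q_coeff_tendsto_iff[OF deriv_form_S_sharp(3)[OF N \<phi>(1)]]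
    by (simp add: deriv_form_S_sharp(2)[OF N \<phi>(1)])
qed

text \<open>The generators are the power of \<open>E\<close> with exponent \<open>j\<close>, and the
  power with exponent \<open>- j\<close> times the derivative of \<open>\<phi>\<close>. The
  derivative supplies at once the weight 2, the vanishing at the other cusps and the missing order
  -1.\<close>

theorem duality_of_unit_weight_2:
  fixes N :: nat and k n0 n1 m n r :: int
  assumes N: "N > 0" and \<phi>: "\<phi> \<in> M_sharp 0 N" "leading \<phi> (- 1) a" "a \<noteq> 0"
    and E: "unit_form w N r E" and k: "k = w * j"
    and "n0 = max_order_infinity (M_sharp k N)" "n1 = max_order_infinity (S_sharp (2 - k) N)"
    and "m \<ge> - n0" "n \<ge> - n1"
  shows "a_coeff N k m n = - b_coeff N (2 - k) n m"
proof -
  obtain b where b: "b \<noteq> 0" "leading (form_power E j) (r * j) b" using unit_form_power(2)[OF N E] by blast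
  obtain c where c: "c \<noteq> 0" "leading (form_power E (- j)) (r * (- j)) c" using unit_form_power(2)[OF N E] by blast
  have "(\<lambda>z. form_power E (- j) z * deriv_form \<phi> z) \<in> S_sharp (w * (- j) + 2) N"
    by (rule M_sharp_mult_S_sharp[OF N unit_form_power(1)[OF N E] deriv_form_S_sharp(1)[OF N \<phi>(1)]])
  then have G: "(\<lambda>z. form_power E (- j) z * deriv_form \<phi> z) \<in> S_sharp (2 - k) N" by (simp add: k add.commute)
  have "leading (\<lambda>z. form_power E (- j) z * deriv_form \<phi> z) (r * (- j) + (- 1)) (c * (- (2 * of_real pi * \<i>) * a))"
    by (rule leading_mult[OF c(2) leading_deriv_form[OF N \<phi>(1,2)]])
  then have G1: "leading (\<lambda>z. form_power E (- j) z * deriv_form \<phi> z) (- 1 - r * j) (c * (- (2 * of_real pi * \<i>) * a))"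
    by (simp add: algebra_simps)
  have F: "form_power E j \<in> M_sharp k N" unfolding k by (rule unit_form_power(1)[OF N E])
  show ?thesis
    by (rule duality_of_generators[OF N \<phi> F b(2,1) G G1 _ assms(7-10)]) (use c \<phi>(3) in simp)
qed

subsection \<open>Weierstrass values at torsion points\<close>

definition torsion_wpq :: "nat \<Rightarrow> int \<Rightarrow> int \<Rightarrow> complex \<Rightarrow> complex" where
  "torsion_wpq N i j z = wpq ((of_int i * z + of_int j) / of_nat N) z"

definition torsion_index :: "nat \<Rightarrow> (int \<times> int) set" where
  "torsion_index N = {0..<int N} \<times> {0..<int N} - {(0, 0)}"

definition torsion_sum :: "nat \<Rightarrow> complex \<Rightarrow> complex" where
  "torsion_sum N z = (\<Sum>(i, j)\<in>torsion_index N. torsion_wpq N i j z)"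

text \<open>
  Subtracting the mean over all nonzero torsion points removes the quasi-modular part
  of \<open>torsion_wpq\<close>.
\<close>
definition torsion_form :: "nat \<Rightarrow> int \<Rightarrow> int \<Rightarrow> complex \<Rightarrow> complex" where
  "torsion_form N i j z = (if z \<in> upper_half_plane
     then of_nat (card (torsion_index N)) * torsion_wpq N i j z - torsion_sum N z else 0)"

lemma torsion_wpq_cong:
  assumes N: "N > 0" and i: "i mod int N = i' mod int N" and j: "j mod int N = j' mod int N"
  shows "torsion_wpq N i j z = torsion_wpq N i' j' z"
proof -
  obtain a b where ab: "i = i' + int N * a" "j = j' + int N * b"
    using i j unfolding mod_eq_dvd_iff dvd_def by (metis diff_eq_eq add.commute)
  have "(of_int i * z + of_int j) / of_nat N = (of_int i' * z + of_int j') / of_nat N + of_int a * z + of_int b"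
    using N by (simp add: ab field_simps)
  then show ?thesis by (simp only: torsion_wpq_def wpq_add_int wpq_add_tau)
qed

lemma torsion_wpq_minus: "torsion_wpq N (- i) (- j) z = torsion_wpq N i j z"
proof -
  have "(of_int (- i) * z + of_int (- j)) / of_nat N = - ((of_int i * z + of_int j) / of_nat N)"
    by (simp add: minus_divide_left)
  then show ?thesis by (simp only: torsion_wpq_def wpq_minus)
qed

lemma torsion_form_cong:
  "N > 0 \<Longrightarrow> i mod int N = i' mod int N \<Longrightarrow> j mod int N = j' mod int N \<Longrightarrow> torsion_form N i j z = torsion_form N i' j' z"
  using torsion_wpq_cong[of N i i' j j' z] by (simp add: torsion_form_def)

lemma torsion_form_minus: "torsion_form N (- i) (- j) z = torsion_form N i j z"
  by (simp add: torsion_form_def torsion_wpq_minus)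

lemma torsion_point_notin_lattice:
  assumes N: "N > 0" and z: "z \<in> upper_half_plane" and ij: "\<not> (int N dvd i \<and> int N dvd j)"
  shows "(of_int i * z + of_int j) / of_nat N \<notin> lattice z"
proof
  assume "(of_int i * z + of_int j) / of_nat N \<in> lattice z"
  then obtain m n where "(of_int i * z + of_int j) / of_nat N = of_int m * z + of_int n" by (auto simp: lattice_def)
  then have *: "of_int i * z + of_int j = of_int (m * int N) * z + of_int (n * int N)" using N by (simp add: field_simps)
  from arg_cong[OF this, of Im] have "real_of_int i * Im z = real_of_int (m * int N) * Im z" by simp
  then have "real_of_int i = real_of_int (m * int N)" using z by (simp add: upper_half_plane_def)
  then have i: "i = m * int N" by (simp only: of_int_eq_iff)
  with * have "of_int j = (of_int (n * int N) :: complex)" by simp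
  then have "j = n * int N" by (simp only: of_int_eq_iff)
  with i ij show False by simp
qed

lemma torsion_index_dvd: "(i, j) \<in> torsion_index N \<Longrightarrow> \<not> (int N dvd i \<and> int N dvd j)"
  using zdvd_not_zless[of i "int N"] zdvd_not_zless[of j "int N"]
  by (auto simp: torsion_index_def order_le_less)

lemma finite_torsion_index [simp]: "finite (torsion_index N)"
  by (simp add: torsion_index_def)

lemma torsion_wpq_holomorphic:
  assumes N: "N > 0" and ij: "\<not> (int N dvd i \<and> int N dvd j)"
  shows "torsion_wpq N i j holomorphic_on upper_half_plane"
  unfolding torsion_wpq_def [abs_def]
proof (rule wpq_holomorphic)
  fix z m assume z: "z \<in> upper_half_plane"
  show "(of_int i * z + of_int j) / of_nat N + of_int m * z \<notin> \<int>"
    by (rule notin_lattice_Ints[OF torsion_point_notin_lattice[OF N z ij]])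
qed (use N in \<open>auto intro!: holomorphic_intros simp: upper_half_plane_def open_halfspace_Im_gt\<close>)

lemma torsion_form_holomorphic:
  assumes N: "N > 0" and ij: "\<not> (int N dvd i \<and> int N dvd j)"
  shows "torsion_form N i j holomorphic_on upper_half_plane"
proof -
  have "torsion_sum N holomorphic_on upper_half_plane"
    unfolding torsion_sum_def [abs_def] case_prod_unfold
    by (intro holomorphic_on_sum torsion_wpq_holomorphic N) (use torsion_index_dvd in auto)
  then have "(\<lambda>z. of_nat (card (torsion_index N)) * torsion_wpq N i j z - torsion_sum N z) holomorphic_on upper_half_plane"
    by (intro holomorphic_intros torsion_wpq_holomorphic[OF N ij])
  then show ?thesis by (rule holomorphic_transform) (simp add: torsion_form_def)
qed

text \<open>Clearing the denominator of \<open>moebius_action A z\<close> turns the row vector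
  \<open>(i, j)\<close> into its product with \<open>A\<close>; the rest is the homogeneity of
  differences under scaling of the lattice.\<close>

lemma slash_torsion_wpq_diff:
  assumes N: "N > 0" and A: "A \<in> SL2Z" and z: "z \<in> upper_half_plane"
    and ij: "\<not> (int N dvd i \<and> int N dvd j)" and ij': "\<not> (int N dvd i' \<and> int N dvd j')"
  shows "torsion_wpq N i j (moebius_action A z) - torsion_wpq N i' j' (moebius_action A z) =
    automorphy_factor A z ^ 2 * (torsion_wpq N (i * A $ 1 $ 1 + j * A $ 2 $ 1) (i * A $ 1 $ 2 + j * A $ 2 $ 2) z -
      torsion_wpq N (i' * A $ 1 $ 1 + j' * A $ 2 $ 1) (i' * A $ 1 $ 2 + j' * A $ 2 $ 2) z)"
proof -
  let ?e = "of_int (A $ 2 $ 1) * z + of_int (A $ 2 $ 2)"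
  have e: "?e \<noteq> 0" using automorphy_factor_nonzero[OF A z] by (simp add: automorphy_factor_def)
  have det: "A $ 1 $ 1 * A $ 2 $ 2 - A $ 1 $ 2 * A $ 2 $ 1 = 1" using A by (simp add: SL2Z_iff)
  define x where "x i j = (of_int (i * A $ 1 $ 1 + j * A $ 2 $ 1) * z + of_int (i * A $ 1 $ 2 + j * A $ 2 $ 2)) / of_nat N" for i j
  have xe: "(of_int i * moebius_action A z + of_int j) / of_nat N = x i j / ?e" for i j
    using e N by (simp add: x_def moebius_action_def automorphy_factor_def field_simps)
  have nd: "\<not> (int N dvd i * A $ 1 $ 1 + j * A $ 2 $ 1 \<and> int N dvd i * A $ 1 $ 2 + j * A $ 2 $ 2)"
    if "\<not> (int N dvd i \<and> int N dvd j)" for i j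
  proof
    assume d: "int N dvd i * A $ 1 $ 1 + j * A $ 2 $ 1 \<and> int N dvd i * A $ 1 $ 2 + j * A $ 2 $ 2"
    have "i = i * (A $ 1 $ 1 * A $ 2 $ 2 - A $ 1 $ 2 * A $ 2 $ 1)" "j = j * (A $ 1 $ 1 * A $ 2 $ 2 - A $ 1 $ 2 * A $ 2 $ 1)"
      unfolding det by simp_all
    then have "i = (i * A $ 1 $ 1 + j * A $ 2 $ 1) * A $ 2 $ 2 - (i * A $ 1 $ 2 + j * A $ 2 $ 2) * A $ 2 $ 1"
      "j = (i * A $ 1 $ 2 + j * A $ 2 $ 2) * A $ 1 $ 1 - (i * A $ 1 $ 1 + j * A $ 2 $ 1) * A $ 1 $ 2"
      by (simp_all add: algebra_simps)
    then have "int N dvd i \<and> int N dvd j" using d by (metis dvd_diff dvd_mult2)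
    with that show False by simp
  qed
  have "x i j \<notin> lattice z" "x i' j' \<notin> lattice z"
    unfolding x_def by (intro torsion_point_notin_lattice N z nd ij ij')+
  from wpq_diff_moebius[OF det _ this] z
  show ?thesis unfolding torsion_wpq_def xe
    by (simp add: upper_half_plane_def moebius_action_def automorphy_factor_def x_def)
qed

lemma bij_betw_torsion_index:
  assumes N: "N > 0" and A: "A \<in> SL2Z"
  shows "bij_betw (\<lambda>(i, j). ((i * A $ 1 $ 1 + j * A $ 2 $ 1) mod int N, (i * A $ 1 $ 2 + j * A $ 2 $ 2) mod int N))
     (torsion_index N) (torsion_index N)"
proof -
  define act where "act A = (\<lambda>(i, j). ((i * A $ 1 $ 1 + j * A $ 2 $ 1) mod int N, (i * A $ 1 $ 2 + j * A $ 2 $ 2) mod int N))" for A :: "int^2^2"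
  have mult: "act B (act A p) = act (A ** B) p" for A B p
  proof -
    obtain i j where p: "p = (i, j)" by (cases p)
    have "(x mod int N * a + y mod int N * b) mod int N = (x * a + y * b) mod int N" for x y a b
      by (intro mod_add_cong mod_mult_cong) auto
    then show ?thesis by (simp add: p act_def mat2_mult_nth algebra_simps)
  qed
  have one: "act (mat 1) p = p" if "p \<in> torsion_index N" for p
    using that by (auto simp: act_def torsion_index_def mat2_one_nth)
  have zero: "act A (0, 0) = (0, 0)" for A by (simp add: act_def)
  have maps: "act A p \<in> torsion_index N" if p: "p \<in> torsion_index N" and A: "A \<in> SL2Z" for A p
  proof -
    have "act A p \<noteq> (0, 0)"
    proof
      assume "act A p = (0, 0)"
      then have "act (A ** mat2_inv A) p = (0, 0)" using mult[of "mat2_inv A" A p] zero by simp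
      then have "p = (0, 0)" using one[OF p] mat2_inv_right[OF A] by simp
      with p show False by (simp add: torsion_index_def)
    qed
    then show ?thesis using N by (auto simp: act_def torsion_index_def split: prod.splits)
  qed
  have "bij_betw (act A) (torsion_index N) (torsion_index N)"
    by (rule bij_betw_byWitness[where f' = "act (mat2_inv A)"])
       (use A SL2Z_inv[OF A] in \<open>auto simp: mult one mat2_inv_right mat2_inv_left intro!: maps\<close>)
  then show ?thesis by (simp add: act_def)
qed

text \<open>As the sum of the differences to all nonzero torsion points, the form is built from
  quantities that do transform with weight 2. Since \<open>A\<close> permutes these points, the sum
  keeps its shape.\<close>

lemma slash_torsion_form:
  assumes N: "N > 0" and A: "A \<in> SL2Z" and z: "z \<in> upper_half_plane" and ij: "\<not> (int N dvd i \<and> int N dvd j)"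
  shows "slash 2 (torsion_form N i j) A z = torsion_form N (i * A $ 1 $ 1 + j * A $ 2 $ 1) (i * A $ 1 $ 2 + j * A $ 2 $ 2) z"
proof -
  have tf: "torsion_form N i j z = (\<Sum>(i', j')\<in>torsion_index N. torsion_wpq N i j z - torsion_wpq N i' j' z)"
    if "z \<in> upper_half_plane" for i j z
    using that by (simp add: torsion_form_def torsion_sum_def sum_subtractf case_prod_unfold)
  let ?e = "automorphy_factor A z" and ?i = "i * A $ 1 $ 1 + j * A $ 2 $ 1" and ?j = "i * A $ 1 $ 2 + j * A $ 2 $ 2"
  let ?g = "\<lambda>(i', j'). ((i' * A $ 1 $ 1 + j' * A $ 2 $ 1) mod int N, (i' * A $ 1 $ 2 + j' * A $ 2 $ 2) mod int N)"
  have e: "?e \<noteq> 0" by (rule automorphy_factor_nonzero[OF A z])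
  have "torsion_form N i j (moebius_action A z) =
     (\<Sum>p\<in>torsion_index N. ?e ^ 2 * (torsion_wpq N ?i ?j z - torsion_wpq N (fst (?g p)) (snd (?g p)) z))"
    unfolding tf[OF moebius_action_in_H[OF A z]]
  proof (rule sum.cong[OF refl])
    fix p assume p: "p \<in> torsion_index N"
    obtain i' j' where ij': "p = (i', j')" by (cases p)
    have "torsion_wpq N (i' * A $ 1 $ 1 + j' * A $ 2 $ 1) (i' * A $ 1 $ 2 + j' * A $ 2 $ 2) z =
       torsion_wpq N (fst (?g p)) (snd (?g p)) z"
      unfolding ij' by (rule torsion_wpq_cong[OF N]) auto
    then show "(case p of (i', j') \<Rightarrow> torsion_wpq N i j (moebius_action A z) - torsion_wpq N i' j' (moebius_action A z)) =
       ?e ^ 2 * (torsion_wpq N ?i ?j z - torsion_wpq N (fst (?g p)) (snd (?g p)) z)"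
      using slash_torsion_wpq_diff[OF N A z ij torsion_index_dvd[OF p[unfolded ij']]] by (simp add: ij')
  qed
  also have "\<dots> = ?e ^ 2 * (\<Sum>p\<in>torsion_index N. torsion_wpq N ?i ?j z - torsion_wpq N (fst (?g p)) (snd (?g p)) z)"
    by (simp add: sum_distrib_left)
  also have "(\<Sum>p\<in>torsion_index N. torsion_wpq N ?i ?j z - torsion_wpq N (fst (?g p)) (snd (?g p)) z) =
     (\<Sum>p\<in>torsion_index N. torsion_wpq N ?i ?j z - torsion_wpq N (fst p) (snd p) z)"
    by (rule sum.reindex_bij_betw[OF bij_betw_torsion_index[OF N A]])
  also have "\<dots> = torsion_form N ?i ?j z" unfolding tf[OF z] by (simp add: case_prod_unfold)
  finally show ?thesis using e by (simp add: slash_def power_int_minus)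
qed

lemma qe_linear_tendsto_0:
  assumes "c > 0" shows "((\<lambda>z. qe (of_real c * z + d)) \<longlongrightarrow> 0) at_ioo"
proof (rule tendsto_norm_zero_cancel)
  have "((\<lambda>y. exp (- 2 * pi * (c * y + Im d))) \<longlongrightarrow> 0) at_top"
    using assms by real_asymp
  then have "((\<lambda>z. exp (- 2 * pi * (c * Im z + Im d))) \<longlongrightarrow> 0) at_ioo"
    by (rule filterlim_compose) (rule filterlim_filtercomap)
  then show "((\<lambda>z. norm (qe (of_real c * z + d))) \<longlongrightarrow> 0) at_ioo"
    by (simp add: norm_qe)
qed

lemma koebe_tendsto_0: "(f \<longlongrightarrow> 0) F \<Longrightarrow> ((\<lambda>z. koebe (f z)) \<longlongrightarrow> 0) F"
  unfolding koebe_def using tendsto_divide[of f 0 F "\<lambda>z. (1 - f z)\<^sup>2" 1]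
  by (auto intro!: tendsto_eq_intros)

lemma wpq_tendsto:
  assumes f: "\<And>z. z \<in> upper_half_plane \<Longrightarrow> 0 \<le> Im (f z) \<and> Im (f z) \<le> Im z"
    and 1: "((\<lambda>z. koebe (qe (f z))) \<longlongrightarrow> L) at_ioo" and 2: "((\<lambda>z. qe (z - f z)) \<longlongrightarrow> 0) at_ioo"
  shows "((\<lambda>z. wpq (f z) z) \<longlongrightarrow> L) at_ioo"
proof -
  have q: "((\<lambda>z. norm (qe z)) \<longlongrightarrow> 0) at_ioo"
    using tendsto_norm[OF qe_linear_tendsto_0[of 1 0]] by simp
  have "((\<lambda>z. wpq (f z) z - koebe (qe (f z)) - koebe (qe (z - f z))) \<longlongrightarrow> 0) at_ioo"
  proof (rule Lim_null_comparison)
    show "\<forall>\<^sub>F z in at_ioo. norm (wpq (f z) z - koebe (qe (f z)) - koebe (qe (z - f z))) \<le> 2 * norm (qe z) / (1 - norm (qe z)) ^ 3"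
      using eventually_upper_half_plane
      by eventually_elim (use f in \<open>auto intro!: wpq_approx simp: upper_half_plane_def\<close>)
    have "((\<lambda>z. 2 * norm (qe z) / (1 - norm (qe z)) ^ 3) \<longlongrightarrow> 2 * 0 / (1 - 0) ^ 3) at_ioo"
      by (intro tendsto_intros q) auto
    then show "((\<lambda>z. 2 * norm (qe z) / (1 - norm (qe z)) ^ 3) \<longlongrightarrow> 0) at_ioo" by simp
  qed
  from tendsto_add[OF tendsto_add[OF this 1] koebe_tendsto_0[OF 2]] show ?thesis by simp
qed

text \<open>Reducing \<open>i\<close> modulo \<open>N\<close> moves the point into the strip of
  \<open>wpq_approx\<close>. A point on the real axis keeps its Koebe term; at any other point that
  term tends to 0.\<close>

lemma torsion_wpq_tendsto:
  assumes N: "N > 0"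
  shows "(torsion_wpq N i j \<longlongrightarrow> (if int N dvd i then koebe (qe (of_int j / of_nat N)) else 0)) at_ioo"
proof -
  define i0 where "i0 = i mod int N"
  have i0: "0 \<le> i0" "i0 < int N" using N by (auto simp: i0_def)
  define c where "c = real_of_int i0 / real N"
  have c: "0 \<le> c" "c < 1" using i0 N by (auto simp: c_def)
  let ?d = "of_int j / of_nat N :: complex"
  have eq: "torsion_wpq N i j z = wpq (of_real c * z + ?d) z" for z
    using torsion_wpq_cong[OF N, of i i0 j j z] N by (simp add: i0_def torsion_wpq_def c_def add_divide_distrib)
  have "((\<lambda>z. wpq (of_real c * z + ?d) z) \<longlongrightarrow> (if int N dvd i then koebe (qe (of_int j / of_nat N)) else 0)) at_ioo"
  proof (rule wpq_tendsto)
    fix z assume "z \<in> upper_half_plane"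
    then show "0 \<le> Im (of_real c * z + ?d) \<and> Im (of_real c * z + ?d) \<le> Im z"
      using c by (auto simp: upper_half_plane_def mult_left_le_one_le)
  next
    show "((\<lambda>z. qe (z - (of_real c * z + ?d))) \<longlongrightarrow> 0) at_ioo"
      using qe_linear_tendsto_0[of "1 - c" "- ?d"] c by (simp add: algebra_simps)
    show "((\<lambda>z. koebe (qe (of_real c * z + ?d))) \<longlongrightarrow> (if int N dvd i then koebe (qe (of_int j / of_nat N)) else 0)) at_ioo"
    proof (cases "int N dvd i")
      case True
      then have "c = 0" by (simp add: c_def i0_def)
      then show ?thesis using True by simp
    next
      case False
      then have "i0 \<noteq> 0" by (simp add: i0_def mod_eq_0_iff_dvd)
      then have "c > 0" using i0 N by (simp add: c_def)
      then show ?thesis using False by (auto intro!: koebe_tendsto_0 qe_linear_tendsto_0)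
    qed
  qed
  then show ?thesis by (simp add: eq [abs_def])
qed

lemma torsion_sum_tendsto:
  assumes N: "N > 0"
  shows "\<exists>S. (torsion_sum N \<longlongrightarrow> S) at_ioo"
  unfolding torsion_sum_def [abs_def] case_prod_unfold
  by (rule exI, rule tendsto_sum, rule torsion_wpq_tendsto[OF N])

definition torsion_sum_limit :: "nat \<Rightarrow> complex" where
  "torsion_sum_limit N = (THE S. (torsion_sum N \<longlongrightarrow> S) at_ioo)"

lemma torsion_form_tendsto:
  assumes N: "N > 0"
  shows "(torsion_form N i j \<longlongrightarrow> of_nat (card (torsion_index N)) * (if int N dvd i then koebe (qe (of_int j / of_nat N)) else 0)
     - torsion_sum_limit N) at_ioo"
proof -
  obtain S where S: "(torsion_sum N \<longlongrightarrow> S) at_ioo" using torsion_sum_tendsto[OF N] by blast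
  then have "torsion_sum_limit N = S"
    unfolding torsion_sum_limit_def using tendsto_unique[OF at_ioo_neq_bot] by blast
  with S have S: "(torsion_sum N \<longlongrightarrow> torsion_sum_limit N) at_ioo" by simp
  have "((\<lambda>z. of_nat (card (torsion_index N)) * torsion_wpq N i j z - torsion_sum N z) \<longlongrightarrow>
    of_nat (card (torsion_index N)) * (if int N dvd i then koebe (qe (of_int j / of_nat N)) else 0) - torsion_sum_limit N) at_ioo"
    by (intro tendsto_intros torsion_wpq_tendsto[OF N] S)
  then show ?thesis
    by (rule Lim_transform_eventually)
       (use eventually_upper_half_plane in eventually_elim, simp add: torsion_form_def)
qed

section \<open>Sums of torsion values over residue classes\<close>

definition level_class :: "nat \<Rightarrow> nat \<Rightarrow> int \<Rightarrow> int set" where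
  "level_class N t y = {j \<in> {0..<int N}. j mod int t = y mod int t}"

text \<open>A matrix in \<open>Gamma0 N\<close> multiplies the first coordinate
  \<open>int t * x\<close> by one diagonal entry; it multiplies the second by the other and shifts
  it by a multiple of \<open>t\<close>. Summing over a class modulo \<open>t\<close> absorbs the
  shift, so that only \<open>x\<close> modulo \<open>N div t\<close> and \<open>y\<close> modulo
  \<open>t\<close> matter.\<close>

definition level_form :: "nat \<Rightarrow> nat \<Rightarrow> int \<Rightarrow> int \<Rightarrow> complex \<Rightarrow> complex" where
  "level_form N t x y z = (\<Sum>j\<in>level_class N t y. torsion_form N (int t * x) j z)"

lemma level_form_cong:
  assumes N: "N = t * M" "N > 0" and x: "x mod int M = x' mod int M" and y: "y mod int t = y' mod int t"
  shows "level_form N t x y z = level_form N t x' y' z"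
proof -
  have "(int t * x) mod int N = (int t * x') mod int N" using x N by (simp add: mod_mult_mult1)
  then show ?thesis unfolding level_form_def level_class_def y
    by (intro sum.cong refl torsion_form_cong N)
qed

lemma level_form_minus:
  assumes N: "N = t * M" "N > 0"
  shows "level_form N t (- x) (- y) z = level_form N t x y z"
proof -
  have neg: "(- j) mod int N \<in> level_class N t (- y)" if "j \<in> level_class N t y" for j y
  proof -
    have "((- j) mod int N) mod int t = (- j) mod int t" using N(1) by (simp add: mod_mod_cancel)
    also have "\<dots> = (- y) mod int t" using that by (intro mod_minus_cong) (simp add: level_class_def)
    finally show ?thesis using N by (simp add: level_class_def)
  qed
  have inv: "(- ((- j) mod int N)) mod int N = j" if "j \<in> level_class N t y" for j y
    using that by (simp add: mod_minus_eq level_class_def)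
  show ?thesis unfolding level_form_def
  proof (rule sum.reindex_bij_witness[of _ "\<lambda>j. (- j) mod int N" "\<lambda>j. (- j) mod int N"])
    fix j assume "j \<in> level_class N t (- y)"
    have "torsion_form N (int t * x) (- j mod int N) z = torsion_form N (int t * x) (- j) z"
      by (rule torsion_form_cong[OF N(2)]) auto
    also have "\<dots> = torsion_form N (int t * - x) j z"
      using torsion_form_minus[of N "int t * - x" j z] by simp
    finally show "torsion_form N (int t * x) (- j mod int N) z = torsion_form N (int t * - x) j z" .
  qed (use neg[of _ y] neg[of _ "- y"] inv in auto)
qed

lemma level_point_nondvd:
  assumes N: "N = t * M" "N > 0" and x: "\<not> int M dvd x"
  shows "\<not> (int N dvd int t * x \<and> int N dvd j)"
  using assms by auto

lemma level_form_holomorphic: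
  assumes N: "N = t * M" "N > 0" and x: "\<not> int M dvd x"
  shows "level_form N t x y holomorphic_on upper_half_plane"
  unfolding level_form_def [abs_def]
  by (intro holomorphic_on_sum torsion_form_holomorphic N level_point_nondvd[OF N x])

lemma slash_level_form:
  assumes N: "N = t * M" "N > 0" and x: "\<not> int M dvd x" and A: "A \<in> SL2Z" and z: "z \<in> upper_half_plane"
  shows "slash 2 (level_form N t x y) A z = (\<Sum>j\<in>level_class N t y.
     torsion_form N (int t * x * A $ 1 $ 1 + j * A $ 2 $ 1) (int t * x * A $ 1 $ 2 + j * A $ 2 $ 2) z)"
proof -
  have "slash 2 (level_form N t x y) A z = (\<Sum>j\<in>level_class N t y. slash 2 (torsion_form N (int t * x) j) A z)"
    by (simp add: slash_def level_form_def sum_distrib_left)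
  then show ?thesis using slash_torsion_form[OF N(2) A z level_point_nondvd[OF N x]] by simp
qed

text \<open>The map \<open>f\<close> on second coordinates is invertible because the diagonal
  entries are inverse to each other modulo \<open>N\<close>. It carries the class of
  \<open>y\<close> to that of \<open>y * A $ 2 $ 2\<close>, as its shift is divisible by
  \<open>t\<close>.\<close>

lemma slash_level_form_Gamma0:
  assumes N: "N = t * M" "N > 0" and x: "\<not> int M dvd x" and A: "A \<in> Gamma0 N" and z: "z \<in> upper_half_plane"
  shows "slash 2 (level_form N t x y) A z = level_form N t (x * A $ 1 $ 1) (y * A $ 2 $ 2) z"
proof -
  let ?a = "A $ 1 $ 1" and ?b = "A $ 1 $ 2" and ?c = "A $ 2 $ 1" and ?d = "A $ 2 $ 2"
  have AS: "A \<in> SL2Z" and c: "int N dvd ?c" and det: "?a * ?d - ?b * ?c = 1" using A by (auto simp: Gamma0_iff SL2Z_iff)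
  have "(?a * ?d - ?b * ?c) mod int N = (?a * ?d - ?b * 0) mod int N"
    using c by (intro mod_diff_cong mod_mult_cong refl) (simp add: mod_eq_0_iff_dvd)
  then have ad: "(?a * ?d) mod int N = 1 mod int N" using det by simp
  have adt: "(?a * ?d) mod int t = 1 mod int t"
    using arg_cong[OF ad, of "\<lambda>x. x mod int t"] N(1) by (simp add: mod_mod_cancel)
  let ?u = "int t * x * ?b"
  define f where "f j = (?u + j * ?d) mod int N" for j
  define g where "g j = (?a * (j - ?u)) mod int N" for j
  have mt: "(j mod int N) mod int t = j mod int t" for j using N(1) by (simp add: mod_mod_cancel)
  have gf: "g (f j) = j" if "j \<in> {0..<int N}" for j
  proof -
    have "g (f j) = (?a * ((?u + j * ?d) - ?u)) mod int N"
      unfolding g_def f_def by (intro mod_mult_cong mod_diff_cong) auto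
    also have "\<dots> = (j * (?a * ?d)) mod int N" by (simp add: algebra_simps)
    also have "\<dots> = (j * 1) mod int N" by (intro mod_mult_cong ad refl)
    finally show ?thesis using that by simp
  qed
  have fg: "f (g j) = j" if "j \<in> {0..<int N}" for j
  proof -
    have "f (g j) = (?u + (?a * (j - ?u)) * ?d) mod int N"
      unfolding g_def f_def by (intro mod_mult_cong mod_add_cong) auto
    also have "\<dots> = (?u + (?a * ?d) * (j - ?u)) mod int N" by (simp add: algebra_simps)
    also have "\<dots> = (?u + 1 * (j - ?u)) mod int N" by (intro mod_mult_cong mod_add_cong ad refl)
    finally show ?thesis using that by simp
  qed
  have fC: "f j \<in> level_class N t (y * ?d)" if "j \<in> level_class N t y" for j
  proof -
    have "f j mod int t = (?u + j * ?d) mod int t" by (simp add: f_def mt)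
    also have "\<dots> = (0 + y * ?d) mod int t"
      using that by (intro mod_add_cong mod_mult_cong) (auto simp: level_class_def)
    finally show ?thesis using N by (simp add: level_class_def f_def)
  qed
  have gC: "g j \<in> level_class N t y" if "j \<in> level_class N t (y * ?d)" for j
  proof -
    have "g j mod int t = (?a * (j - ?u)) mod int t" by (simp add: g_def mt)
    also have "\<dots> = (?a * (y * ?d - 0)) mod int t"
      using that by (intro mod_diff_cong mod_mult_cong) (auto simp: level_class_def)
    also have "\<dots> = (y * (?a * ?d)) mod int t" by (simp add: algebra_simps)
    also have "\<dots> = (y * 1) mod int t" by (intro mod_mult_cong adt refl)
    finally show ?thesis using N by (simp add: level_class_def g_def)
  qed
  have "slash 2 (level_form N t x y) A z = (\<Sum>j\<in>level_class N t y.
     torsion_form N (int t * x * ?a + j * ?c) (?u + j * ?d) z)"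
    by (rule slash_level_form[OF N x AS z])
  also have "\<dots> = (\<Sum>j\<in>level_class N t (y * ?d). torsion_form N (int t * (x * ?a)) j z)"
  proof (rule sum.reindex_bij_witness[of _ g f])
    fix j assume "j \<in> level_class N t y"
    show "torsion_form N (int t * (x * ?a)) (f j) z = torsion_form N (int t * x * ?a + j * ?c) (?u + j * ?d) z"
    proof (rule torsion_form_cong[OF N(2)])
      have "(int t * x * ?a + j * ?c) mod int N = (int t * x * ?a + j * 0) mod int N"
        using c by (intro mod_add_cong mod_mult_cong refl) (simp add: mod_eq_0_iff_dvd)
      then show "int t * (x * ?a) mod int N = (int t * x * ?a + j * ?c) mod int N" by (simp add: mult.assoc)
    qed (simp add: f_def)
  qed (use fC gC gf fg in \<open>auto simp: level_class_def\<close>)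
  finally show ?thesis by (simp add: level_form_def)
qed

lemma bij_betw_level_class:
  assumes N: "N = t * M" "N > 0" and y: "0 \<le> y" "y < int t"
  shows "bij_betw (\<lambda>k. y + int t * int k) {..<M} (level_class N t y)"
proof (rule bij_betw_byWitness[where f' = "\<lambda>j. nat (j div int t)"])
  have t: "t > 0" using N by (cases t) auto
  show "\<forall>k\<in>{..<M}. nat ((y + int t * int k) div int t) = k" using y t by simp
  show "\<forall>j\<in>level_class N t y. y + int t * int (nat (j div int t)) = j"
  proof
    fix j assume "j \<in> level_class N t y"
    then have "j \<ge> 0" "j mod int t = y" using y by (auto simp: level_class_def)
    then show "y + int t * int (nat (j div int t)) = j"
      using mod_mult_div_eq[of j "int t"] t by (simp add: pos_imp_zdiv_nonneg_iff)
  qed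
  show "(\<lambda>k. y + int t * int k) ` {..<M} \<subseteq> level_class N t y"
  proof clarsimp
    fix k assume "k < M"
    then have "int t * (int k + 1) \<le> int t * int M" by (intro mult_left_mono) auto
    then show "y + int t * int k \<in> level_class N t y" using y N by (simp add: level_class_def algebra_simps)
  qed
  show "(\<lambda>j. nat (j div int t)) ` level_class N t y \<subseteq> {..<M}"
  proof clarsimp
    fix j assume "j \<in> level_class N t y"
    then have "j < int M * int t" "0 \<le> j" using N by (auto simp: level_class_def mult.commute)
    moreover have "j div int t * int t \<le> j" using t by (simp flip: minus_mod_eq_div_mult)
    ultimately have "j div int t * int t < int M * int t" by linarith
    then have "j div int t < int M" by (rule mult_right_less_imp_less) simp
    then show "nat (j div int t) < M" using \<open>0 \<le> j\<close> t by (simp add: nat_less_iff pos_imp_zdiv_nonneg_iff)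
  qed
qed

text \<open>With \<open>j = y + t * k\<close> the torsion points become
  \<open>(x * z + y / t + k) / M\<close>, and \<open>wpq_mult\<close> sums over \<open>k\<close>.
  Leading terms can be read off this form; the term with \<open>torsion_sum\<close> is the same for
  all \<open>x\<close> and \<open>y\<close> and cancels in suitable combinations.\<close>

lemma level_form_eq_wpq:
  assumes N: "N = t * M" "N > 0" and x: "\<not> int M dvd x" and y: "0 \<le> y" "y < int t" and z: "z \<in> upper_half_plane"
  shows "level_form N t x y z = of_nat (card (torsion_index N)) * (of_nat M ^ 2 * wpq (of_int x * z + of_int y / of_nat t) (of_nat M * z))
     - of_nat M * torsion_sum N z"
proof -
  have t: "t > 0" and M: "M > 0" using N by (cases t; cases M; auto)+
  let ?C = "of_nat (card (torsion_index N)) :: complex"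
  let ?w = "of_int x * z + of_int y / of_nat t"
  have "level_form N t x y z = (\<Sum>k<M. torsion_form N (int t * x) (y + int t * int k) z)"
    unfolding level_form_def by (rule sum.reindex_bij_betw[OF bij_betw_level_class[OF N y], symmetric])
  also have "\<dots> = (\<Sum>k<M. ?C * wpq ((?w + of_nat k) / of_nat M) z - torsion_sum N z)"
  proof (rule sum.cong[OF refl])
    fix k
    have "(of_int (int t * x) * z + of_int (y + int t * int k)) / of_nat N = (?w + of_nat k) / of_nat M"
      using t M by (simp add: N field_simps)
    then show "torsion_form N (int t * x) (y + int t * int k) z = ?C * wpq ((?w + of_nat k) / of_nat M) z - torsion_sum N z"
      using z by (simp add: torsion_form_def torsion_wpq_def)
  qed
  also have "\<dots> = ?C * (\<Sum>k<M. wpq ((?w + of_nat k) / of_nat M) z) - of_nat M * torsion_sum N z"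
    by (simp add: sum_subtractf sum_distrib_left)
  also have "(\<Sum>k<M. wpq ((?w + of_nat k) / of_nat M) z) = of_nat M ^ 2 * wpq ?w (of_nat M * z)"
  proof (rule wpq_mult[OF M])
    show "Im z > 0" using z by (simp add: upper_half_plane_def)
    fix m show "?w + of_int m * (of_nat M * z) \<notin> \<int>"
    proof
      assume "?w + of_int m * (of_nat M * z) \<in> \<int>"
      then obtain n where n: "?w + of_int m * (of_nat M * z) = of_int n" by (elim Ints_cases)
      have "real_of_int (x + m * int M) * Im z = 0" using arg_cong[OF n, of Im] by (simp add: algebra_simps)
      then have "real_of_int (x + m * int M) = 0" using z by (simp add: upper_half_plane_def)
      then have "x + m * int M = 0" by (simp only: of_int_eq_0_iff)
      then have "x = int M * (- m)" by (simp add: mult.commute eq_neg_iff_add_eq_0)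
      with x show False by (metis dvd_triv_left)
    qed
  qed
  finally show ?thesis .
qed

lemma level_form_zero_outside: "z \<notin> upper_half_plane \<Longrightarrow> level_form N t x y z = 0"
  by (simp add: level_form_def torsion_form_def)

lemma slash_level_form_tendsto:
  assumes N: "N = t * M" "N > 0" and x: "\<not> int M dvd x" and A: "A \<in> SL2Z"
  shows "\<exists>L. (slash 2 (level_form N t x y) A \<longlongrightarrow> L) at_ioo"
proof -
  have "\<exists>L. ((\<lambda>z. \<Sum>j\<in>level_class N t y.
     torsion_form N (int t * x * A $ 1 $ 1 + j * A $ 2 $ 1) (int t * x * A $ 1 $ 2 + j * A $ 2 $ 2) z) \<longlongrightarrow> L) at_ioo"
    by (rule exI, rule tendsto_sum, rule torsion_form_tendsto[OF N(2)])
  then obtain L where L: "((\<lambda>z. \<Sum>j\<in>level_class N t y.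
     torsion_form N (int t * x * A $ 1 $ 1 + j * A $ 2 $ 1) (int t * x * A $ 1 $ 2 + j * A $ 2 $ 2) z) \<longlongrightarrow> L) at_ioo" by blast
  have "(slash 2 (level_form N t x y) A \<longlongrightarrow> L) at_ioo"
    by (rule Lim_transform_eventually[OF L])
       (use eventually_upper_half_plane in eventually_elim, simp add: slash_level_form[OF N x A])
  then show ?thesis by blast
qed

subsection \<open>Values at the cusps\<close>

text \<open>Up to a factor and an additive constant, the value of the form with \<open>t = 1\<close>
  at the cusp of a matrix with lower left entry \<open>c\<close>. The index \<open>s\<close> runs
  through the second coordinates of those points that the matrix moves to the real axis modulo the
  lattice.\<close>

definition csc_sum :: "nat \<Rightarrow> int \<Rightarrow> int \<Rightarrow> real" where
  "csc_sum N x c = (\<Sum>s | s \<in> {0..<int N} \<and> int N dvd c * s + x. 1 / (sin (pi * of_int s / of_nat N))\<^sup>2)"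

lemma koebe_qe_of_real:
  assumes "sin (pi * s) \<noteq> 0"
  shows "koebe (qe (of_real s)) = - of_real (1 / (sin (pi * s))\<^sup>2) / 4"
proof -
  define v where "v = exp (\<i> * of_real (pi * s))"
  have [simp]: "v \<noteq> 0" by (simp add: v_def)
  have q: "qe (of_real s) = v^2" by (simp add: qe_def v_def power2_eq_square mult_ac flip: exp_add)
  have s: "of_real (sin (pi * s)) = (v - inverse v) / (2 * \<i>)"
    by (simp add: sin_exp_eq v_def exp_minus flip: sin_of_real)
  also have "\<dots> = (v^2 - 1) / (2 * \<i> * v)" by (simp add: field_simps power2_eq_square)
  finally have s: "of_real (sin (pi * s)) = (v^2 - 1) / (2 * \<i> * v)" .
  then have "v^2 - 1 \<noteq> 0" using assms by (metis div_0 of_real_eq_0_iff)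
  then have "koebe (v^2) = - (1 / ((v^2 - 1) / (2 * \<i> * v))\<^sup>2) / 4"
    by (simp add: koebe_def power_divide power_mult_distrib power2_commute[of 1 "v\<^sup>2"])
  then show ?thesis unfolding q s[symmetric] by simp
qed

lemma sin_pi_frac_nonzero:
  assumes "0 < s" "s < int N" shows "sin (pi * of_int s / of_nat N) > 0"
proof (rule sin_gt_zero)
  show "0 < pi * of_int s / of_nat N" using assms by simp
  have "pi * of_int s < pi * of_nat N" using assms by (simp add: of_int_less_iff[symmetric] del: of_int_less_iff)
  then show "pi * of_int s / of_nat N < pi" using assms by (simp add: field_simps)
qed

text \<open>Only points whose first coordinate becomes divisible by \<open>N\<close> have a nonzero
  limit. Their second coordinates \<open>s\<close> are characterised by a congruence in which, of
  \<open>A\<close>, only the lower left entry appears.\<close>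

lemma slash_level_form_1_tendsto:
  assumes N: "N > 0" and x: "\<not> int N dvd x" and A: "A \<in> SL2Z"
  shows "(slash 2 (level_form N 1 x 0) A \<longlongrightarrow> - of_nat (card (torsion_index N)) * of_real (csc_sum N x (A $ 2 $ 1)) / 4
     - of_nat N * torsion_sum_limit N) at_ioo"
proof -
  let ?a = "A $ 1 $ 1" and ?b = "A $ 1 $ 2" and ?c = "A $ 2 $ 1" and ?d = "A $ 2 $ 2"
  let ?C = "of_nat (card (torsion_index N)) :: complex"
  have det: "?a * ?d - ?b * ?c = 1" using A by (simp add: SL2Z_iff)
  have N1: "N = 1 * N" by simp
  have cl: "level_class N 1 0 = {0..<int N}" by (auto simp: level_class_def)
  let ?T = "\<lambda>j. if int N dvd x * ?a + j * ?c then koebe (qe (of_int (x * ?b + j * ?d) / of_nat N)) else 0"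
  have "((\<lambda>z. \<Sum>j\<in>{0..<int N}. torsion_form N (x * ?a + j * ?c) (x * ?b + j * ?d) z) \<longlongrightarrow>
     (\<Sum>j\<in>{0..<int N}. ?C * ?T j - torsion_sum_limit N)) at_ioo"
    by (rule tendsto_sum, rule torsion_form_tendsto[OF N])
  then have lim: "(slash 2 (level_form N 1 x 0) A \<longlongrightarrow> (\<Sum>j\<in>{0..<int N}. ?C * ?T j - torsion_sum_limit N)) at_ioo"
  proof (rule Lim_transform_eventually)
    show "\<forall>\<^sub>F z in at_ioo. (\<Sum>j\<in>{0..<int N}. torsion_form N (x * ?a + j * ?c) (x * ?b + j * ?d) z) = slash 2 (level_form N 1 x 0) A z"
      using eventually_upper_half_plane by eventually_elim (simp add: slash_level_form[OF N1 N x A] cl del: One_nat_def)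
  qed
  have "(\<Sum>j\<in>{0..<int N}. ?T j) = (\<Sum>j | j \<in> {0..<int N} \<and> int N dvd x * ?a + j * ?c. koebe (qe (of_int (x * ?b + j * ?d) / of_nat N)))"
    by (rule sum.inter_filter[symmetric]) simp
  also have "\<dots> = (\<Sum>s | s \<in> {0..<int N} \<and> int N dvd ?c * s + x. - of_real (1 / (sin (pi * of_int s / of_nat N))\<^sup>2) / 4)"
  \<comment> \<open>The inverse of \<open>A\<close> is applied to the point \<open>(0, s)\<close>
    modulo \<open>N\<close>, which recovers \<open>j\<close> as \<open>?a * s\<close>.\<close>
  proof (rule sum.reindex_bij_witness[of _ "\<lambda>s. (?a * s) mod int N" "\<lambda>j. (x * ?b + j * ?d) mod int N"])
    fix j assume j: "j \<in> {j. j \<in> {0..<int N} \<and> int N dvd x * ?a + j * ?c}"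
    have e: "?a * (x * ?b + j * ?d) = (?a * ?d - ?b * ?c) * j + ?b * (x * ?a + j * ?c)" by (simp add: algebra_simps)
    have "(?a * ((x * ?b + j * ?d) mod int N)) mod int N = (?a * (x * ?b + j * ?d)) mod int N" by (simp add: mod_mult_right_eq)
    also have "\<dots> = (j + ?b * 0) mod int N" unfolding e det
      using j by (intro mod_add_cong mod_mult_cong) (auto simp: mod_eq_0_iff_dvd)
    finally show "?a * ((x * ?b + j * ?d) mod int N) mod int N = j" using j by simp
    have e2: "?c * (x * ?b + j * ?d) + (?a * ?d - ?b * ?c) * x = ?d * (x * ?a + j * ?c)" by (simp add: algebra_simps)
    have "(?c * ((x * ?b + j * ?d) mod int N) + x) mod int N = (?c * (x * ?b + j * ?d) + x) mod int N"
      by (intro mod_add_cong mod_mult_cong) auto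
    also have "\<dots> = 0" using e2 j unfolding det by (simp add: mod_eq_0_iff_dvd)
    finally have dv: "int N dvd ?c * ((x * ?b + j * ?d) mod int N) + x" by (simp add: mod_eq_0_iff_dvd)
    then show "(x * ?b + j * ?d) mod int N \<in> {s. s \<in> {0..<int N} \<and> int N dvd ?c * s + x}" using N by simp
    define s r where "s = (x * ?b + j * ?d) mod int N" and "r = (x * ?b + j * ?d) div int N"
    have "s \<noteq> 0" using dv x by (intro notI) (simp add: s_def)
    moreover have "0 \<le> s" "s < int N" using N by (simp_all add: s_def)
    ultimately have "sin (pi * (of_int s / of_nat N)) \<noteq> 0" using sin_pi_frac_nonzero[of s N] by simp
    from koebe_qe_of_real[OF this]
    have k: "koebe (qe (of_real (of_int s / of_nat N))) = - of_real (1 / (sin (pi * of_int s / of_nat N))\<^sup>2) / 4"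
      by (simp only: times_divide_eq_right)
    have "x * ?b + j * ?d = s + int N * r" by (simp add: s_def r_def)
    then have "of_int (x * ?b + j * ?d) / of_nat N = (of_real (of_int s / of_nat N) + of_int r :: complex)"
      using N by (simp add: add_divide_distrib)
    then have "qe (of_int (x * ?b + j * ?d) / of_nat N) = qe (of_real (of_int s / of_nat N))"
      by (simp only: qe_add_int)
    with k show "- of_real (1 / (sin (pi * of_int ((x * ?b + j * ?d) mod int N) / of_nat N))\<^sup>2) / 4 = koebe (qe (of_int (x * ?b + j * ?d) / of_nat N))"
      unfolding s_def[symmetric] by simp
  next
    fix s assume s: "s \<in> {s. s \<in> {0..<int N} \<and> int N dvd ?c * s + x}"
    have e: "x * ?b + (?a * s) * ?d = (?a * ?d - ?b * ?c) * s + ?b * (?c * s + x)" by (simp add: algebra_simps)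
    have "(x * ?b + (?a * s) mod int N * ?d) mod int N = (x * ?b + (?a * s) * ?d) mod int N"
      by (intro mod_add_cong mod_mult_cong) auto
    also have "\<dots> = (s + ?b * 0) mod int N" unfolding e det
      using s by (intro mod_add_cong mod_mult_cong) (auto simp: mod_eq_0_iff_dvd)
    finally show "(x * ?b + (?a * s) mod int N * ?d) mod int N = s" using s by simp
    have e2: "x * ?a + (?a * s) * ?c = ?a * (?c * s + x)" by (simp add: algebra_simps)
    have "(x * ?a + (?a * s) mod int N * ?c) mod int N = (x * ?a + (?a * s) * ?c) mod int N"
      by (intro mod_add_cong mod_mult_cong) auto
    also have "\<dots> = 0" unfolding e2 using s by (simp add: mod_eq_0_iff_dvd)
    finally show "?a * s mod int N \<in> {j. j \<in> {0..<int N} \<and> int N dvd x * ?a + j * ?c}"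
      using N by (simp add: mod_eq_0_iff_dvd)
  qed
  also have "\<dots> = - of_real (csc_sum N x ?c) / 4"
    by (simp add: csc_sum_def sum_negf sum_divide_distrib)
  finally have T: "(\<Sum>j\<in>{0..<int N}. ?T j) = - of_real (csc_sum N x ?c) / 4" .
  have "(\<Sum>j\<in>{0..<int N}. ?C * ?T j - torsion_sum_limit N) = ?C * (\<Sum>j\<in>{0..<int N}. ?T j) - of_nat N * torsion_sum_limit N"
    by (simp only: sum_subtractf sum_distrib_left) simp
  then show ?thesis using lim unfolding T by simp
qed

subsection \<open>Leading terms\<close>

lemma leading_0_iff: "leading f 0 a \<longleftrightarrow> (f \<longlongrightarrow> a) at_ioo"
  by (simp add: leading_def)

lemma leading_qe: "x > 0 \<Longrightarrow> leading (\<lambda>z. qe (of_int x * z + y)) x (qe y)"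
proof -
  have "qe (of_int x * z + y) * qe z powi (- x) = qe y" for z
    by (simp add: qe_add qe_of_int_mult power_int_minus)
  then show ?thesis by (simp add: leading_def)
qed

lemma qe_tendsto_0: "x > 0 \<Longrightarrow> ((\<lambda>z. qe (of_int x * z + y)) \<longlongrightarrow> 0) at_ioo"
  using leading_lower[OF leading_qe, of x 0 y] by (simp add: leading_0_iff)

lemma koebe_expansion: "u \<noteq> 1 \<Longrightarrow> koebe u = (\<Sum>i\<le>n. of_nat i * u ^ i) + u ^ Suc n * ((of_nat (Suc n) - of_nat n * u) / (1 - u)\<^sup>2)"
proof (induction n)
  case 0
  then show ?case by (simp add: koebe_def)
next
  case (Suc n)
  then have nz: "(1 - u)\<^sup>2 \<noteq> 0" by simp
  define R where "R n = (of_nat (Suc n) - of_nat n * u) / (1 - u)\<^sup>2" for n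
  have R: "R n = of_nat (Suc n) + u * R (Suc n)"
    unfolding R_def using nz by (simp add: field_simps) (simp add: power2_eq_square algebra_simps)
  have "koebe u = (\<Sum>i\<le>n. of_nat i * u ^ i) + u ^ Suc n * R n" using Suc by (simp add: R_def)
  then have "koebe u = (\<Sum>i\<le>Suc n. of_nat i * u ^ i) + u ^ Suc (Suc n) * R (Suc n)"
    unfolding R by (simp add: algebra_simps)
  then show ?case by (simp only: R_def)
qed

lemma leading_koebe_remainder:
  assumes x: "x > 0" and s: "s < int (Suc n) * x"
  shows "leading (\<lambda>z. koebe (qe (of_int x * z + of_real y)) - (\<Sum>i\<le>n. of_nat i * qe (of_int x * z + of_real y) ^ i)) s 0"
proof -
  let ?u = "\<lambda>z. qe (of_int x * z + of_real y)"
  have "((\<lambda>z. (of_nat (Suc n) - of_nat n * ?u z) / (1 - ?u z)\<^sup>2) \<longlongrightarrow> (of_nat (Suc n) - of_nat n * 0) / (1 - 0)\<^sup>2) at_ioo"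
    by (intro tendsto_intros qe_tendsto_0 x) auto
  then have "leading (\<lambda>z. (of_nat (Suc n) - of_nat n * ?u z) / (1 - ?u z)\<^sup>2) 0 (of_nat (Suc n))"
    by (simp add: leading_0_iff)
  from leading_mult[OF leading_power[OF leading_qe[OF x, of "of_real y"], of "Suc n"] this]
  have "leading (\<lambda>z. ?u z ^ Suc n * ((of_nat (Suc n) - of_nat n * ?u z) / (1 - ?u z)\<^sup>2)) (int (Suc n) * x) (qe (of_real y) ^ Suc n * of_nat (Suc n))"
    by simp
  then have "leading (\<lambda>z. ?u z ^ Suc n * ((of_nat (Suc n) - of_nat n * ?u z) / (1 - ?u z)\<^sup>2)) s 0"
    by (rule leading_lower[OF _ s])
  then show ?thesis
  proof (rule leading_cong)
    fix z assume z: "z \<in> upper_half_plane"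
    have "norm (?u z) < 1" using z x by (simp add: norm_qe upper_half_plane_def)
    then have "?u z \<noteq> 1" by auto
    from koebe_expansion[OF this, of n]
    show "?u z ^ Suc n * ((of_nat (Suc n) - of_nat n * ?u z) / (1 - ?u z)\<^sup>2) = koebe (?u z) - (\<Sum>i\<le>n. of_nat i * ?u z ^ i)"
      by simp
  qed
qed

lemma leading_koebe:
  assumes x: "x > 0"
  shows "leading (\<lambda>z. koebe (qe (of_int x * z + of_real y))) x (qe (of_real y))"
proof -
  have "leading (\<lambda>z. koebe (qe (of_int x * z + of_real y)) - (\<Sum>i\<le>1. of_nat i * qe (of_int x * z + of_real y) ^ i)) x 0"
    by (rule leading_koebe_remainder) (use x in auto)
  from leading_add[OF this leading_qe[OF x, of "of_real y"]] show ?thesis by simp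
qed

text \<open>For the lattice of \<open>of_nat M * z\<close> the error in \<open>wpq_approx\<close>
  has order \<open>M\<close> in \<open>qe z\<close>, so below that order only the two Koebe terms,
  of exponents \<open>x\<close> and \<open>int M - x\<close>, are visible.\<close>

lemma leading_wpq_remainder:
  assumes M: "M > 0" and x: "0 \<le> x" "x \<le> int M" and s: "s < int M"
  shows "leading (\<lambda>z. wpq (of_int x * z + of_real y) (of_nat M * z) - koebe (qe (of_int x * z + of_real y))
     - koebe (qe (of_int (int M - x) * z + of_real (- y)))) s 0"
  unfolding leading_def
proof (rule Lim_null_comparison)
  define e where "e = nat (int M - s)"
  have e: "e > 0" using s by (simp add: e_def)
  have q: "((\<lambda>z. norm (qe z)) \<longlongrightarrow> 0) at_ioo"
    using tendsto_norm[OF qe_tendsto_0[of 1 0]] by simp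
  show "\<forall>\<^sub>F z in at_ioo. norm ((wpq (of_int x * z + of_real y) (of_nat M * z) - koebe (qe (of_int x * z + of_real y))
     - koebe (qe (of_int (int M - x) * z + of_real (- y)))) * qe z powi - s) \<le> 2 * norm (qe z) ^ e / (1 - norm (qe z) ^ M) ^ 3"
    using eventually_upper_half_plane
  proof eventually_elim
    case (elim z)
    then have z: "Im z > 0" by (simp add: upper_half_plane_def)
    let ?w = "of_int x * z + of_real y"
    have "of_int x * Im z \<le> of_int (int M) * Im z" using x z by (intro mult_right_mono) (auto simp del: of_int_of_nat_eq)
    then have b: "0 \<le> Im ?w" "Im ?w \<le> Im (of_nat M * z)" "Im (of_nat M * z) > 0" using x z M by auto
    have eq: "of_nat M * z - ?w = of_int (int M - x) * z + of_real (- y)" by (simp add: algebra_simps)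
    have "norm (qe z powi - s) * norm (qe z) ^ M = norm (qe z) ^ e"
    proof -
      have "qe z powi - s * qe z ^ M = qe z powi (- s + int M)" by (subst power_int_add) auto
      also have "\<dots> = qe z powi (int e)" using s by (simp add: e_def)
      finally have "qe z powi - s * qe z ^ M = qe z ^ e" by simp
      then show ?thesis by (metis norm_mult norm_power)
    qed
    moreover have "norm (wpq ?w (of_nat M * z) - koebe (qe ?w) - koebe (qe (of_nat M * z - ?w))) * norm (qe z powi - s) \<le>
      2 * norm (qe (of_nat M * z)) / (1 - norm (qe (of_nat M * z))) ^ 3 * norm (qe z powi - s)"
      by (intro mult_right_mono wpq_approx b) auto
    ultimately show ?case unfolding eq qe_of_nat_mult norm_mult norm_power
      by (simp add: mult_ac)
  qed
  show "((\<lambda>z. 2 * norm (qe z) ^ e / (1 - norm (qe z) ^ M) ^ 3) \<longlongrightarrow> 0) at_ioo"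
  proof -
    have "((\<lambda>z. 2 * norm (qe z) ^ e / (1 - norm (qe z) ^ M) ^ 3) \<longlongrightarrow> 2 * 0 ^ e / (1 - 0 ^ M) ^ 3) at_ioo"
      using M by (intro tendsto_intros q) (auto simp: zero_power)
    then show ?thesis using e by (simp add: zero_power)
  qed
qed

lemma leading_wpq:
  assumes x: "0 < x" "2 * x < int M"
  shows "leading (\<lambda>z. wpq (of_int x * z + of_real y) (of_nat M * z)) x (qe (of_real y))"
proof -
  have M: "M > 0" using x by (cases M) auto
  have "leading (\<lambda>z. koebe (qe (of_int (int M - x) * z + of_real (- y)))) x 0"
    by (rule leading_lower[OF leading_koebe]) (use x in auto)
  moreover have "leading (\<lambda>z. wpq (of_int x * z + of_real y) (of_nat M * z) - koebe (qe (of_int x * z + of_real y))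
     - koebe (qe (of_int (int M - x) * z + of_real (- y)))) x 0"
    by (rule leading_wpq_remainder[OF M]) (use x in auto)
  ultimately have "leading (\<lambda>z. wpq (of_int x * z + of_real y) (of_nat M * z) - koebe (qe (of_int x * z + of_real y))
     - koebe (qe (of_int (int M - x) * z + of_real (- y))) + koebe (qe (of_int (int M - x) * z + of_real (- y))) + koebe (qe (of_int x * z + of_real y)))
     x (0 + 0 + qe (of_real y))"
    by (intro leading_add leading_koebe x)
  then show ?thesis by simp
qed

text \<open>At the half period both Koebe terms have the same exponent, hence the coefficient
  2.\<close>

lemma leading_wpq_half:
  assumes x: "0 < x" "2 * x = int M"
  shows "leading (\<lambda>z. wpq (of_int x * z) (of_nat M * z)) x 2"
proof -
  have M: "M > 0" using x by (cases M) auto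
  have e: "int M - x = x" using x by simp
  have "leading (\<lambda>z. wpq (of_int x * z + of_real 0) (of_nat M * z) - koebe (qe (of_int x * z + of_real 0))
     - koebe (qe (of_int (int M - x) * z + of_real (- 0)))) x 0"
    by (rule leading_wpq_remainder[OF M]) (use x in auto)
  then have "leading (\<lambda>z. wpq (of_int x * z) (of_nat M * z) - koebe (qe (of_int x * z)) - koebe (qe (of_int x * z))) x 0"
    by (simp add: e)
  moreover have "leading (\<lambda>z. koebe (qe (of_int x * z))) x 1" using leading_koebe[OF x(1), of 0] by simp
  ultimately have "leading (\<lambda>z. wpq (of_int x * z) (of_nat M * z) - koebe (qe (of_int x * z)) - koebe (qe (of_int x * z))
      + koebe (qe (of_int x * z)) + koebe (qe (of_int x * z))) x (0 + 1 + 1)"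
    by (intro leading_add)
  then show ?thesis by simp
qed

section \<open>Differences with the value at a half period\<close>

abbreviation full_form :: "nat \<Rightarrow> int \<Rightarrow> complex \<Rightarrow> complex" where
  "full_form N x \<equiv> level_form N 1 x 0"

definition wpq_multiple :: "nat \<Rightarrow> int \<Rightarrow> complex \<Rightarrow> complex" where
  "wpq_multiple N x z = wpq (of_int x * z) (of_nat N * z)"

definition full_form_const :: "nat \<Rightarrow> complex" where
  "full_form_const N = of_nat (card (torsion_index N) * N ^ 2)"

lemma full_form_const_nonzero:
  assumes "N > 1" shows "full_form_const N \<noteq> 0"
proof -
  have "(0, 1) \<in> torsion_index N" using assms by (simp add: torsion_index_def)
  then have "card (torsion_index N) \<noteq> 0" by (auto simp only: card_eq_0_iff finite_torsion_index)
  then show ?thesis using assms unfolding full_form_const_def of_nat_eq_0_iff by simp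
qed

lemma full_form_eq:
  assumes N: "N > 0" and x: "\<not> int N dvd x" and z: "z \<in> upper_half_plane"
  shows "full_form N x z = full_form_const N * wpq_multiple N x z - of_nat N * torsion_sum N z"
  using level_form_eq_wpq[of N 1 N x 0 z] assms by (simp add: full_form_const_def wpq_multiple_def mult.assoc)

lemma full_form_diff:
  assumes N: "N > 0" and x: "\<not> int N dvd x" "\<not> int N dvd x'" and z: "z \<in> upper_half_plane"
  shows "full_form N x z - full_form N x' z = full_form_const N * (wpq_multiple N x z - wpq_multiple N x' z)"
  unfolding full_form_eq[OF N x(1) z] full_form_eq[OF N x(2) z] by (simp add: algebra_simps)

lemma leading_wpq_multiple: "0 < x \<Longrightarrow> 2 * x < int N \<Longrightarrow> leading (wpq_multiple N x) x 1"
  using leading_wpq[of x N 0] by (simp add: wpq_multiple_def [abs_def])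

lemma leading_wpq_multiple_half: "0 < x \<Longrightarrow> 2 * x = int N \<Longrightarrow> leading (wpq_multiple N x) x 2"
  using leading_wpq_half[of x N] by (simp add: wpq_multiple_def [abs_def])

lemma not_dvd_of_less: "0 < x \<Longrightarrow> x < n \<Longrightarrow> \<not> n dvd (x :: int)"
  using zdvd_not_zless by blast

lemma leading_full_form_diff:
  assumes x: "0 < x" "x < x'" "2 * x' \<le> int N"
  shows "leading (\<lambda>z. full_form N x z - full_form N x' z) x (full_form_const N)"
proof -
  have N: "N > 0" using x by (cases N) auto
  have "leading (wpq_multiple N x') x 0"
  proof (cases "2 * x' = int N")
    case True
    then show ?thesis using x leading_lower[OF leading_wpq_multiple_half[of x' N], of x] by simp
  next
    case False
    then show ?thesis using x leading_lower[OF leading_wpq_multiple[of x' N], of x] by simp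
  qed
  then have "leading (\<lambda>z. full_form_const N * (wpq_multiple N x z - wpq_multiple N x' z)) x (full_form_const N * (1 - 0))"
    using x by (intro leading_cmult leading_diff leading_wpq_multiple) auto
  then have "leading (\<lambda>z. full_form N x z - full_form N x' z) x (full_form_const N * (1 - 0))"
  proof (rule leading_cong)
    fix z assume z: "z \<in> upper_half_plane"
    show "full_form_const N * (wpq_multiple N x z - wpq_multiple N x' z) = full_form N x z - full_form N x' z"
      by (rule full_form_diff[OF N _ _ z, symmetric]) (use x not_dvd_of_less[of x "int N"] not_dvd_of_less[of x' "int N"] in auto)
  qed
  then show ?thesis by simp
qed

text \<open>The condition \<open>2 * x' = int N\<close> makes the second point a half period of the
  lattice generated by \<open>of_nat N * z\<close> and 1, so this is
  \<open>wpq_half_period_unique\<close> for each fixed \<open>z\<close>.\<close>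

lemma full_form_nonzero_diff:
  assumes x: "0 < x" "x < x'" "2 * x' = int N" and z: "z \<in> upper_half_plane"
  shows "full_form N x z - full_form N x' z \<noteq> 0"
proof -
  have N: "N > 1" using x by linarith
  let ?t = "of_nat N * z"
  have t: "Im ?t > 0" using z N by (simp add: upper_half_plane_def)
  have nl: "of_int y * z \<notin> lattice ?t" if "\<not> int N dvd y" for y
  proof
    assume "of_int y * z \<in> lattice ?t"
    then obtain m n where e: "of_int y * z = of_int m * ?t + of_int n" by (auto simp: lattice_def)
    have "real_of_int y * Im z = real_of_int (m * int N) * Im z" using arg_cong[OF e, of Im] by simp
    then have "real_of_int y = real_of_int (m * int N)" using z by (simp add: upper_half_plane_def)
    then have "y = m * int N" by (simp only: of_int_eq_iff)
    with that show False by simp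
  qed
  have half: "of_int x' * z = ?t / 2"
  proof -
    have "of_nat N = (of_int (2 * x') :: complex)" using x(3) by (metis of_int_of_nat_eq)
    then show ?thesis by simp
  qed
  have d: "\<not> int N dvd x" "\<not> int N dvd x'" "\<not> int N dvd x - x'"
    using not_dvd_of_less[of x "int N"] not_dvd_of_less[of x' "int N"] not_dvd_of_less[of "x' - x" "int N"] x
    by (auto simp: dvd_diff_commute)
  have "of_int x * z - ?t / 2 = of_int (x - x') * z" using half by (simp add: algebra_simps)
  then have "wpq_multiple N x z \<noteq> wpq_multiple N x' z"
    unfolding wpq_multiple_def half
    using wpq_half_period_unique[OF t, of "of_int x * z"] nl d by metis
  then show ?thesis using full_form_diff[OF _ d(1,2) z] full_form_const_nonzero[OF N] N by simp
qed

lemma full_form_diff_tendsto: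
  assumes N: "N > 0" and x: "\<not> int N dvd x" "\<not> int N dvd x'" and A: "A \<in> SL2Z"
  shows "(slash 2 (\<lambda>z. full_form N x z - full_form N x' z) A \<longlongrightarrow>
     of_nat (card (torsion_index N)) * of_real (csc_sum N x' (A $ 2 $ 1) - csc_sum N x (A $ 2 $ 1)) / 4) at_ioo"
proof -
  have "slash 2 (\<lambda>z. full_form N x z - full_form N x' z) A = (\<lambda>z. slash 2 (full_form N x) A z - slash 2 (full_form N x') A z)"
    by (simp add: slash_def fun_eq_iff algebra_simps)
  moreover have "((\<lambda>z. slash 2 (full_form N x) A z - slash 2 (full_form N x') A z) \<longlongrightarrow>
     (- of_nat (card (torsion_index N)) * of_real (csc_sum N x (A $ 2 $ 1)) / 4 - of_nat N * torsion_sum_limit N) -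
     (- of_nat (card (torsion_index N)) * of_real (csc_sum N x' (A $ 2 $ 1)) / 4 - of_nat N * torsion_sum_limit N)) at_ioo"
    by (intro tendsto_diff slash_level_form_1_tendsto N x A)
  ultimately show ?thesis by (simp add: algebra_simps diff_divide_distrib)
qed

subsection \<open>Separating the values at the cusps\<close>

definition csc_at :: "nat \<Rightarrow> nat \<Rightarrow> real" where
  "csc_at N s = 1 / (sin (pi * real s / real N))\<^sup>2"

text \<open>With \<open>c\<close> reduced modulo \<open>N\<close> and the sum spelled out as a list,
  each level becomes a finite case distinction for the simplifier.\<close>

lemma csc_sum_list:
  "csc_sum N x c = (\<Sum>s\<leftarrow>[0..<N]. if int N dvd (c mod int N) * int s + x then csc_at N s else 0)"
proof -
  have dv: "int N dvd c * int s + x \<longleftrightarrow> int N dvd (c mod int N) * int s + x" for s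
  proof -
    have "(c * int s + x) mod int N = ((c mod int N) * int s + x) mod int N"
      by (intro mod_add_cong mod_mult_cong) auto
    then show ?thesis by (simp only: dvd_eq_mod_eq_0)
  qed
  have "csc_sum N x c = (\<Sum>s\<in>{0..<int N}. if int N dvd c * s + x then 1 / (sin (pi * of_int s / of_nat N))\<^sup>2 else 0)"
    unfolding csc_sum_def by (rule sum.inter_filter) simp
  also have "{0..<int N} = int ` {0..<N}" by (simp add: image_int_atLeastLessThan)
  also have "(\<Sum>s\<in>int ` {0..<N}. if int N dvd c * s + x then 1 / (sin (pi * of_int s / of_nat N))\<^sup>2 else 0)
     = (\<Sum>s\<in>{0..<N}. if int N dvd (c mod int N) * int s + x then csc_at N s else 0)"
    by (subst sum.reindex) (auto simp: csc_at_def dv intro!: sum.cong)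
  also have "\<dots> = (\<Sum>s\<leftarrow>[0..<N]. if int N dvd (c mod int N) * int s + x then csc_at N s else 0)"
    by (simp add: sum_list_distinct_conv_sum_set)
  finally show ?thesis .
qed

lemma csc_at_gt_1:
  assumes "0 < s" "s < N" "2 * s \<noteq> N" shows "csc_at N s > 1"
proof -
  let ?x = "pi * real s / real N"
  have "sin ?x > 0" using sin_pi_frac_nonzero[of "int s" N] assms by simp
  then have "(sin ?x)\<^sup>2 > 0" by simp
  moreover have "cos ?x \<noteq> 0"
  proof
    assume "cos ?x = 0"
    then have "cos ?x = cos (pi / 2)" by simp
    moreover have "real s / real N \<le> 1" using assms by simp
    then have "?x \<le> pi" using mult_left_mono[of "real s / real N" 1 pi] by simp
    moreover have "0 \<le> ?x" by simp
    moreover have "0 \<le> pi / 2" "pi / 2 \<le> pi" by simp_all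
    ultimately have "?x = pi / 2" using cos_inj_pi[of ?x "pi / 2"] by blast
    then have "pi * (real s / real N) = pi * (1 / 2)" by simp
    then have "real s / real N = 1 / 2" unfolding mult_cancel_left by simp
    then have "real (2 * s) = real N" using assms by (simp add: divide_eq_eq)
    with assms(3) show False by (simp only: of_nat_eq_iff)
  qed
  then have "(cos ?x)\<^sup>2 > 0" by simp
  then have "(sin ?x)\<^sup>2 < 1" using sin_cos_squared_add[of ?x] by linarith
  ultimately show ?thesis by (simp add: csc_at_def)
qed

lemma csc_at_half: "s > 0 \<Longrightarrow> csc_at (2 * s) s = 1"
  by (simp add: csc_at_def)

text \<open>The distribution relation of \<open>koebe\<close> on the unit circle. It serves the
  cases where both sums to be compared have several terms, which bounds on the single terms cannot
  order.\<close>

lemma csc_at_mult: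
  assumes s: "0 < s" "s < n" and g: "g > 0"
  shows "(\<Sum>k<g. csc_at (g * n) (s + n * k)) = real g ^ 2 * csc_at n s"
proof -
  define z where "z = real s / real n"
  have k: "koebe (qe (of_real (real i / real m))) = - of_real (csc_at m i) / 4" if "0 < i" "i < m" for i m
    using koebe_qe_of_real[of "real i / real m"] sin_pi_frac_nonzero[of "int i" m] that
    by (simp add: csc_at_def)
  have lt: "s + n * k < g * n" if "k < g" for k
  proof -
    have "n * (k + 1) \<le> n * g" using that by (intro mult_le_mono2) simp
    then show ?thesis using s by (simp add: algebra_simps)
  qed
  have "complex_of_real z \<notin> \<int>"
  proof
    assume "complex_of_real z \<in> \<int>"
    then obtain m where "complex_of_real z = of_int m" by (elim Ints_cases)
    then have "z = of_int m" by (metis of_real_of_int_eq of_real_eq_iff)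
    moreover have "0 < z" "z < 1" using s by (auto simp: z_def)
    ultimately show False by simp
  qed
  from koebe_qe_mult[OF this g]
  have "(\<Sum>k<g. koebe (qe ((of_real z + of_nat k) / of_nat g))) = of_nat g ^ 2 * koebe (qe (of_real z))" .
  also have "(\<Sum>k<g. koebe (qe ((of_real z + of_nat k) / of_nat g))) = (\<Sum>k<g. - of_real (csc_at (g * n) (s + n * k)) / 4)"
  proof (rule sum.cong[OF refl])
    fix i assume i: "i \<in> {..<g}"
    have "(of_real z + of_nat i) / of_nat g = complex_of_real (real (s + n * i) / real (g * n))"
      using s g by (simp add: z_def field_simps)
    then show "koebe (qe ((of_real z + of_nat i) / of_nat g)) = - of_real (csc_at (g * n) (s + n * i)) / 4"
      using k[of "s + n * i" "g * n"] lt i s by simp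
  qed
  also have "\<dots> = - of_real (\<Sum>k<g. csc_at (g * n) (s + n * k)) / 4"
    by (simp add: sum_negf sum_divide_distrib)
  also have "koebe (qe (of_real z)) = - of_real (csc_at n s) / 4" unfolding z_def by (rule k[OF s])
  finally have "complex_of_real (\<Sum>k<g. csc_at (g * n) (s + n * k)) = of_real (real g ^ 2 * csc_at n s)" by simp
  then show ?thesis by (simp only: of_real_eq_iff)
qed

text \<open>For each residue of \<open>c\<close>, either exactly one of the sums is empty, or the
  second is the single term at the middle point \<open>s = 3\<close>, whose value 1 is smaller than
  that of any other term.\<close>

lemma csc_sum_neq_6:
  assumes "\<not> 6 dvd c" shows "csc_sum 6 2 c \<noteq> csc_sum 6 3 c"
proof -
  have c: "c mod 6 = 1 \<or> c mod 6 = 2 \<or> c mod 6 = 3 \<or> c mod 6 = 4 \<or> c mod 6 = 5" using assms by presburger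
  have u: "[0..<6] = [0, 1, 2, 3, 4, 5]" by (simp add: upt_rec)
  have h: "csc_at 6 3 = 1" using csc_at_half[of 3] by simp
  note f = csc_at_gt_1[of 1 6] csc_at_gt_1[of 2 6] csc_at_gt_1[of 4 6] csc_at_gt_1[of 5 6]
  show ?thesis
    using c by (elim disjE) (use f h in \<open>auto simp: csc_sum_list u\<close>)
qed

lemma csc_sum_neq_10:
  assumes "\<not> 10 dvd c" shows "csc_sum 10 4 c \<noteq> csc_sum 10 5 c" "csc_sum 10 2 c \<noteq> csc_sum 10 5 c"
proof -
  have c: "c mod 10 = 1 \<or> c mod 10 = 2 \<or> c mod 10 = 3 \<or> c mod 10 = 4 \<or> c mod 10 = 5 \<or> c mod 10 = 6
     \<or> c mod 10 = 7 \<or> c mod 10 = 8 \<or> c mod 10 = 9" using assms by presburger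
  have u: "[0..<10] = [0, 1, 2, 3, 4, 5, 6, 7, 8, 9]" by (simp add: upt_rec)
  have h: "csc_at 10 5 = 1" using csc_at_half[of 5] by simp
  note f = csc_at_gt_1[of 1 10] csc_at_gt_1[of 2 10] csc_at_gt_1[of 3 10] csc_at_gt_1[of 4 10]
    csc_at_gt_1[of 6 10] csc_at_gt_1[of 7 10] csc_at_gt_1[of 8 10] csc_at_gt_1[of 9 10]
  show "csc_sum 10 4 c \<noteq> csc_sum 10 5 c"
    using c by (elim disjE) (use f h in \<open>auto simp: csc_sum_list u\<close>)
  show "csc_sum 10 2 c \<noteq> csc_sum 10 5 c"
    using c by (elim disjE) (use f h in \<open>auto simp: csc_sum_list u\<close>)
qed

lemma csc_sum_neq_12:
  assumes "\<not> 12 dvd c" shows "csc_sum 12 4 c \<noteq> csc_sum 12 6 c"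
proof -
  have c: "c mod 12 = 1 \<or> c mod 12 = 2 \<or> c mod 12 = 3 \<or> c mod 12 = 4 \<or> c mod 12 = 5 \<or> c mod 12 = 6
     \<or> c mod 12 = 7 \<or> c mod 12 = 8 \<or> c mod 12 = 9 \<or> c mod 12 = 10 \<or> c mod 12 = 11" using assms by presburger
  have u: "[0..<12] = [0, 1, 2, 3, 4, 5, 6, 7, 8, 9, 10, 11]" by (simp add: upt_rec)
  have h: "csc_at 12 6 = 1" "csc_at 6 3 = 1" using csc_at_half[of 6] csc_at_half[of 3] by simp_all
  \<comment> \<open>When \<open>c\<close> is 2 or 10 modulo 12, both sums have two terms. They
    collapse to multiples of values at level 6, to be compared with the middle value
    \<open>csc_at 6 3 = 1\<close>.\<close>
  have m: "csc_at 12 2 + csc_at 12 8 = 4 * csc_at 6 2" "csc_at 12 3 + csc_at 12 9 = 4 * csc_at 6 3"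
     "csc_at 12 4 + csc_at 12 10 = 4 * csc_at 6 4"
    using csc_at_mult[of 2 6 2] csc_at_mult[of 3 6 2] csc_at_mult[of 4 6 2] by (simp_all add: numeral_2_eq_2)
  note f = csc_at_gt_1[of 1 12] csc_at_gt_1[of 2 12] csc_at_gt_1[of 3 12] csc_at_gt_1[of 4 12] csc_at_gt_1[of 5 12]
    csc_at_gt_1[of 7 12] csc_at_gt_1[of 8 12] csc_at_gt_1[of 9 12] csc_at_gt_1[of 10 12] csc_at_gt_1[of 11 12]
    csc_at_gt_1[of 2 6] csc_at_gt_1[of 4 6]
  show ?thesis
    using c by (elim disjE) (use f h m in \<open>auto simp: csc_sum_list u\<close>)
qed

lemma csc_sum_neq_18:
  assumes "\<not> 18 dvd c" shows "csc_sum 18 6 c \<noteq> csc_sum 18 9 c"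
proof -
  have c: "c mod 18 = 1 \<or> c mod 18 = 2 \<or> c mod 18 = 3 \<or> c mod 18 = 4 \<or> c mod 18 = 5 \<or> c mod 18 = 6
     \<or> c mod 18 = 7 \<or> c mod 18 = 8 \<or> c mod 18 = 9 \<or> c mod 18 = 10 \<or> c mod 18 = 11 \<or> c mod 18 = 12
     \<or> c mod 18 = 13 \<or> c mod 18 = 14 \<or> c mod 18 = 15 \<or> c mod 18 = 16 \<or> c mod 18 = 17" using assms by presburger
  have u: "[0..<18] = [0, 1, 2, 3, 4, 5, 6, 7, 8, 9, 10, 11, 12, 13, 14, 15, 16, 17]" by (simp add: upt_rec)
  have h: "csc_at 18 9 = 1" "csc_at 6 3 = 1" using csc_at_half[of 9] csc_at_half[of 3] by simp_all
  have s3: "(\<Sum>k<3. f k) = f 0 + f 1 + f 2" for f :: "nat \<Rightarrow> real"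
    by (simp add: numeral_3_eq_3 numeral_2_eq_2)
  \<comment> \<open>The residues 3 and 15 give three terms in each sum, which again collapse to
    values at level 6.\<close>
  have m: "csc_at 18 2 + csc_at 18 8 + csc_at 18 14 = 9 * csc_at 6 2"
     "csc_at 18 3 + csc_at 18 9 + csc_at 18 15 = 9 * csc_at 6 3"
     "csc_at 18 4 + csc_at 18 10 + csc_at 18 16 = 9 * csc_at 6 4"
    using csc_at_mult[of 2 6 3] csc_at_mult[of 3 6 3] csc_at_mult[of 4 6 3] by (simp_all add: s3 flip: numeral_2_eq_2)
  note f = csc_at_gt_1[of 1 18] csc_at_gt_1[of 2 18] csc_at_gt_1[of 3 18] csc_at_gt_1[of 4 18] csc_at_gt_1[of 5 18]
    csc_at_gt_1[of 6 18] csc_at_gt_1[of 7 18] csc_at_gt_1[of 8 18] csc_at_gt_1[of 10 18] csc_at_gt_1[of 11 18]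
    csc_at_gt_1[of 12 18] csc_at_gt_1[of 13 18] csc_at_gt_1[of 14 18] csc_at_gt_1[of 15 18] csc_at_gt_1[of 16 18]
    csc_at_gt_1[of 17 18] csc_at_gt_1[of 2 6] csc_at_gt_1[of 4 6]
  show ?thesis
    using c by (elim disjE) (use f h m in \<open>auto simp: csc_sum_list u\<close>)
qed

subsection \<open>Levels 6, 12 and 18\<close>

lemma Gamma0_diagonal_not_dvd:
  assumes A: "A \<in> Gamma0 N" and p: "p dvd int N" "\<not> p dvd 1"
  shows "\<not> p dvd A $ 1 $ 1" "\<not> p dvd A $ 2 $ 2"
proof -
  have c: "p dvd A $ 2 $ 1" and det: "A $ 1 $ 1 * A $ 2 $ 2 - A $ 1 $ 2 * A $ 2 $ 1 = 1"
    using A p by (auto simp: Gamma0_iff SL2Z_iff intro: dvd_trans)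
  have "p dvd 1" if "p dvd A $ 1 $ 1 \<or> p dvd A $ 2 $ 2"
    unfolding det[symmetric] using that c by (intro dvd_diff) auto
  with p show "\<not> p dvd A $ 1 $ 1" "\<not> p dvd A $ 2 $ 2" by auto
qed

lemma full_form_pm_cong:
  assumes N: "N > 0" and x: "x' mod int N = x mod int N \<or> x' mod int N = (- x) mod int N"
  shows "full_form N x' z = full_form N x z"
proof -
  have N1: "N = 1 * N" by simp
  from x show ?thesis
  proof
    assume "x' mod int N = x mod int N"
    then show ?thesis by (rule level_form_cong[OF N1 N]) simp
  next
    assume "x' mod int N = (- x) mod int N"
    then have "full_form N x' z = full_form N (- x) z" by (rule level_form_cong[OF N1 N]) simp
    also have "\<dots> = full_form N x z" using level_form_minus[OF N1 N, of x 0 z] by simp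
    finally show ?thesis .
  qed
qed

lemma slash_full_form_Gamma0:
  assumes "N > 0" "\<not> int N dvd x" "A \<in> Gamma0 N" "z \<in> upper_half_plane"
  shows "slash 2 (full_form N x) A z = full_form N (x * A $ 1 $ 1) z"
  using slash_level_form_Gamma0[of N 1 N x A z 0] assms by simp

lemma level_form_M_sharp:
  assumes N: "N = t * M" "N > 0" and x: "\<not> int M dvd x"
    and inv: "\<And>A z. A \<in> Gamma0 N \<Longrightarrow> z \<in> upper_half_plane \<Longrightarrow> slash 2 (level_form N t x y) A z = level_form N t x y z"
  shows "level_form N t x y \<in> M_sharp 2 N"
  unfolding M_sharp_iff[OF N(2)]
proof (intro conjI ballI)
  show "invariant_form 2 N (level_form N t x y)"
    using inv level_form_holomorphic[OF N x] by (auto simp: invariant_form_def level_form_zero_outside)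
  obtain L where "(slash 2 (level_form N t x y) (mat 1) \<longlongrightarrow> L) at_ioo"
    using slash_level_form_tendsto[OF N x SL2Z_one] by blast
  then have "leading (level_form N t x y) 0 L" by (simp add: leading_0_iff slash_one [abs_def])
  then show "moderate_growth (level_form N t x y)" by (rule leading_imp_moderate)
  fix A assume "A \<in> SL2Z - Gamma0 N"
  then show "\<exists>L. (slash 2 (level_form N t x y) A \<longlongrightarrow> L) at_ioo"
    using slash_level_form_tendsto[OF N x] by blast
qed

lemma full_form_M_sharp:
  assumes N: "N > 0" and x: "\<not> int N dvd x"
    and pm: "\<And>A. A \<in> Gamma0 N \<Longrightarrow> (x * A $ 1 $ 1) mod int N = x mod int N \<or> (x * A $ 1 $ 1) mod int N = (- x) mod int N"
  shows "full_form N x \<in> M_sharp 2 N"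
proof (rule level_form_M_sharp[of N 1 N])
  fix A z assume "A \<in> Gamma0 N" "z \<in> upper_half_plane"
  then show "slash 2 (full_form N x) A z = full_form N x z"
    using slash_full_form_Gamma0[OF N x] full_form_pm_cong[OF N pm] by simp
qed (use N x in auto)

lemma M_sharp_diff:
  assumes "N > 0" "f \<in> M_sharp k N" "g \<in> M_sharp k N"
  shows "(\<lambda>z. f z - g z) \<in> M_sharp k N"
  using M_sharp_add_cmult[OF assms, of "- 1"] by simp

text \<open>The half period \<open>x'\<close> excludes zeros in the upper half plane. At the other
  cusps the additive constants of the two values cancel, so that \<open>csc\<close> excludes the
  limit 0. All zeros are then at infinity, where the smaller index \<open>x\<close> is the
  order.\<close>

lemma unit_form_full_form_diff:
  assumes x: "0 < x" "x < x'" "2 * x' = int N"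
    and M: "full_form N x \<in> M_sharp 2 N" "full_form N x' \<in> M_sharp 2 N"
    and csc: "\<And>c. \<not> int N dvd c \<Longrightarrow> csc_sum N x c \<noteq> csc_sum N x' c"
  shows "unit_form 2 N x (\<lambda>z. full_form N x z - full_form N x' z)"
  unfolding unit_form_def
proof (intro conjI ballI)
  have N: "N > 1" using x by linarith
  have d: "\<not> int N dvd x" "\<not> int N dvd x'"
    using x not_dvd_of_less[of x "int N"] not_dvd_of_less[of x' "int N"] by auto
  show "invariant_form 2 N (\<lambda>z. full_form N x z - full_form N x' z)"
    using M_sharp_diff[OF _ M] N by (simp add: M_sharp_iff)
  show "\<exists>b. b \<noteq> 0 \<and> leading (\<lambda>z. full_form N x z - full_form N x' z) x b"
    using leading_full_form_diff[of x x' N] full_form_const_nonzero[OF N] x by auto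
  show "full_form N x z - full_form N x' z \<noteq> 0" if "z \<in> upper_half_plane" for z
    by (rule full_form_nonzero_diff[OF x that])
  fix A assume A: "A \<in> SL2Z - Gamma0 N"
  then have "\<not> int N dvd A $ 2 $ 1" by (simp add: Gamma0_iff)
  from csc[OF this] have "csc_sum N x' (A $ 2 $ 1) - csc_sum N x (A $ 2 $ 1) \<noteq> 0" by simp
  moreover have "of_nat (card (torsion_index N)) \<noteq> (0 :: complex)"
    using full_form_const_nonzero[OF N] by (simp add: full_form_const_def)
  ultimately have "of_nat (card (torsion_index N)) * of_real (csc_sum N x' (A $ 2 $ 1) - csc_sum N x (A $ 2 $ 1)) / 4 \<noteq> (0 :: complex)"
    by (simp only: divide_eq_0_iff mult_eq_0_iff of_real_eq_0_iff) simp
  then show "\<exists>L. L \<noteq> 0 \<and> (slash 2 (\<lambda>z. full_form N x z - full_form N x' z) A \<longlongrightarrow> L) at_ioo"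
    using full_form_diff_tendsto[OF _ d, of A] A N by blast
qed

lemma hauptmodul_of_quotient:
  assumes N: "N > 0" and E: "unit_form w N r E" and W: "W \<in> M_sharp w N" "leading W (r - 1) a" "a \<noteq> 0"
  obtains \<phi> b where "\<phi> \<in> M_sharp 0 N" "leading \<phi> (- 1) b" "b \<noteq> 0"
proof -
  obtain b where b: "b \<noteq> 0" "leading (form_power E (- 1)) (r * - 1) b" using unit_form_power(2)[OF N E] by blast
  have "(\<lambda>z. W z * form_power E (- 1) z) \<in> M_sharp (w + w * (- 1)) N"
    by (rule M_sharp_mult[OF N W(1) unit_form_power(1)[OF N E]])
  moreover have "leading (\<lambda>z. W z * form_power E (- 1) z) (r - 1 + r * (- 1)) (a * b)"
    by (rule leading_mult[OF W(2) b(2)])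
  ultimately show ?thesis using W(3) b(1) by (intro that[of "\<lambda>z. W z * form_power E (- 1) z" "a * b"]) auto
qed

lemma full_form_M_sharp_6:
  assumes "x \<in> {1, 2, 3}" shows "full_form 6 x \<in> M_sharp 2 6"
proof (rule full_form_M_sharp)
  fix A assume A: "A \<in> Gamma0 6"
  have "\<not> 2 dvd A $ 1 $ 1" "\<not> 3 dvd A $ 1 $ 1"
    using Gamma0_diagonal_not_dvd(1)[OF A, of 2] Gamma0_diagonal_not_dvd(1)[OF A, of 3] by auto
  then show "(x * A $ 1 $ 1) mod int 6 = x mod int 6 \<or> (x * A $ 1 $ 1) mod int 6 = (- x) mod int 6"
    using assms by (elim insertE emptyE; simp; presburger)
qed (use assms in auto)

lemma full_form_M_sharp_12:
  assumes "x \<in> {3, 4, 6}" shows "full_form 12 x \<in> M_sharp 2 12"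
proof (rule full_form_M_sharp)
  fix A assume A: "A \<in> Gamma0 12"
  have "\<not> 2 dvd A $ 1 $ 1" "\<not> 3 dvd A $ 1 $ 1"
    using Gamma0_diagonal_not_dvd(1)[OF A, of 2] Gamma0_diagonal_not_dvd(1)[OF A, of 3] by auto
  then show "(x * A $ 1 $ 1) mod int 12 = x mod int 12 \<or> (x * A $ 1 $ 1) mod int 12 = (- x) mod int 12"
    using assms by (elim insertE emptyE; simp; presburger)
qed (use assms in auto)

lemma full_form_M_sharp_18:
  assumes "x \<in> {6, 9}" shows "full_form 18 x \<in> M_sharp 2 18"
proof (rule full_form_M_sharp)
  fix A assume A: "A \<in> Gamma0 18"
  have "\<not> 2 dvd A $ 1 $ 1" "\<not> 3 dvd A $ 1 $ 1"
    using Gamma0_diagonal_not_dvd(1)[OF A, of 2] Gamma0_diagonal_not_dvd(1)[OF A, of 3] by auto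
  \<comment> \<open>A unit modulo 18 need not be congruent to 1 or -1, but modulo 6 it is, and that
    suffices for multiples of 3.\<close>
  then have "6 dvd A $ 1 $ 1 - 1 \<or> 6 dvd A $ 1 $ 1 + 1" by presburger
  moreover have "3 dvd x" using assms by auto
  ultimately have "3 * 6 dvd x * (A $ 1 $ 1 - 1) \<or> 3 * 6 dvd x * (A $ 1 $ 1 + 1)"
    by (blast intro: mult_dvd_mono)
  then show "(x * A $ 1 $ 1) mod int 18 = x mod int 18 \<or> (x * A $ 1 $ 1) mod int 18 = (- x) mod int 18"
    by (simp add: mod_eq_dvd_iff algebra_simps)
qed (use assms in auto)

definition duality :: "nat \<Rightarrow> int \<Rightarrow> bool" where
  "duality N k \<longleftrightarrow> (\<forall>m n. m \<ge> - max_order_infinity (M_sharp k N) \<longrightarrow> n \<ge> - max_order_infinity (S_sharp (2 - k) N) \<longrightarrow>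
     a_coeff N k m n = - b_coeff N (2 - k) n m)"

lemma duality_of_quotient:
  assumes N: "N > 0" and E: "unit_form w N r E" and W: "W \<in> M_sharp w N" "leading W (r - 1) a" "a \<noteq> 0" and k: "k = w * j"
  shows "duality N k"
proof -
  obtain \<phi> b where \<phi>: "\<phi> \<in> M_sharp 0 N" "leading \<phi> (- 1) b" "b \<noteq> 0"
    using hauptmodul_of_quotient[OF N E W] by blast
  show ?thesis unfolding duality_def
    using duality_of_unit_weight_2[OF N \<phi> E k refl refl] by blast
qed

lemma duality_6:
  assumes "even k" shows "duality 6 k"
proof -
  obtain j where k: "k = 2 * j" using assms by auto
  have "unit_form 2 6 2 (\<lambda>z. full_form 6 2 z - full_form 6 3 z)"
    by (rule unit_form_full_form_diff) (use full_form_M_sharp_6 csc_sum_neq_6 in auto)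
  moreover have "(\<lambda>z. full_form 6 1 z - full_form 6 3 z) \<in> M_sharp 2 6"
    by (intro M_sharp_diff full_form_M_sharp_6) auto
  moreover have "leading (\<lambda>z. full_form 6 1 z - full_form 6 3 z) (2 - 1) (full_form_const 6)"
    using leading_full_form_diff[of 1 3 6] by simp
  ultimately show ?thesis by (rule duality_of_quotient[OF _ _ _ _ full_form_const_nonzero k, rotated 1]) auto
qed

lemma duality_12:
  assumes "even k" shows "duality 12 k"
proof -
  obtain j where k: "k = 2 * j" using assms by auto
  have "unit_form 2 12 4 (\<lambda>z. full_form 12 4 z - full_form 12 6 z)"
    by (rule unit_form_full_form_diff) (use full_form_M_sharp_12 csc_sum_neq_12 in auto)
  moreover have "(\<lambda>z. full_form 12 3 z - full_form 12 6 z) \<in> M_sharp 2 12"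
    by (intro M_sharp_diff full_form_M_sharp_12) auto
  moreover have "leading (\<lambda>z. full_form 12 3 z - full_form 12 6 z) (4 - 1) (full_form_const 12)"
    using leading_full_form_diff[of 3 6 12] by simp
  ultimately show ?thesis by (rule duality_of_quotient[OF _ _ _ _ full_form_const_nonzero k, rotated 1]) auto
qed

text \<open>The units modulo 18 permute 1, 5 and 7 up to sign, so \<open>full_form 18 5\<close> is
  not invariant and a form of order 5 has to come from \<open>t = 3\<close>. There \<open>A\<close>
  acts by one diagonal entry modulo 6 and by the other modulo 3; both are 1 or both are -1, and
  \<open>level_form_minus\<close> removes the sign.\<close>

lemma level_form_18_M_sharp:
  assumes x: "\<not> 6 dvd x" shows "level_form 18 3 x y \<in> M_sharp 2 18"
proof (rule level_form_M_sharp[of 18 3 6])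
  fix A z assume A: "A \<in> Gamma0 18" and z: "z \<in> upper_half_plane"
  let ?a = "A $ 1 $ 1" and ?d = "A $ 2 $ 2"
  have N: "(18 :: nat) = 3 * 6" "(18 :: nat) > 0" by auto
  have "\<not> 2 dvd ?a" "\<not> 3 dvd ?a"
    using Gamma0_diagonal_not_dvd(1)[OF A, of 2] Gamma0_diagonal_not_dvd(1)[OF A, of 3] by auto
  then have a: "6 dvd ?a - 1 \<or> 6 dvd ?a + 1" by presburger
  have "18 dvd A $ 2 $ 1" and det: "?a * ?d - A $ 1 $ 2 * A $ 2 $ 1 = 1" using A by (auto simp: Gamma0_iff SL2Z_iff)
  then have "3 dvd A $ 2 $ 1" by (auto intro: dvd_trans[of 3 18])
  moreover have "?a * ?d - 1 = A $ 1 $ 2 * A $ 2 $ 1" using det by simp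
  ultimately have ad: "3 dvd ?a * ?d - 1" by simp
  have sl: "slash 2 (level_form 18 3 x y) A z = level_form 18 3 (x * ?a) (y * ?d) z"
    by (rule slash_level_form_Gamma0[OF N _ A z]) (use x in simp)
  from a show "slash 2 (level_form 18 3 x y) A z = level_form 18 3 x y z"
  proof
    assume a: "6 dvd ?a - 1"
    then have "3 dvd ?a - 1" by presburger
    then have "3 dvd (?a * ?d - 1) - (?a - 1) * ?d" by (rule dvd_diff[OF ad dvd_mult2])
    then have d: "3 dvd ?d - 1" by (simp add: algebra_simps)
    have "6 dvd x * (?a - 1)" "3 dvd y * (?d - 1)" using a d by simp_all
    then show ?thesis unfolding sl
      by (intro level_form_cong[OF N]) (simp_all add: mod_eq_dvd_iff algebra_simps)
  next
    assume a: "6 dvd ?a + 1"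
    then have "3 dvd ?a + 1" by presburger
    then have "3 dvd (?a + 1) * ?d - (?a * ?d - 1)" by (rule dvd_diff[OF dvd_mult2 ad])
    then have d: "3 dvd ?d + 1" by (simp add: algebra_simps)
    have "6 dvd x * (?a + 1)" "3 dvd y * (?d + 1)" using a d by simp_all
    then have "level_form 18 3 (x * ?a) (y * ?d) z = level_form 18 3 (- x) (- y) z"
      by (intro level_form_cong[OF N]) (simp_all add: mod_eq_dvd_iff algebra_simps)
    then show ?thesis unfolding sl level_form_minus[OF N] .
  qed
qed (use x in auto)

text \<open>
  The combination is chosen so that only exponents congruent to 2 modulo 3 survive in the
  \<open>q\<close>-expansion, and the coefficients of \<open>q\<^sup>2\<close> cancel.
\<close>
definition numerator_18 :: "complex \<Rightarrow> complex" where
  "numerator_18 z = (let w = qe (1 / 3) in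
     level_form 18 3 1 0 z + w * level_form 18 3 1 1 z + w\<^sup>2 * level_form 18 3 1 2 z +
     (- 2) * level_form 18 3 2 0 z + (- 2 * w\<^sup>2) * level_form 18 3 2 1 z + (- 2 * w) * level_form 18 3 2 2 z)"

lemma numerator_18_M_sharp: "numerator_18 \<in> M_sharp 2 18"
  unfolding numerator_18_def [abs_def] Let_def
  by (intro M_sharp_add_cmult level_form_18_M_sharp) auto

lemma qe_third: "(qe (1 / 3))\<^sup>2 + qe (1 / 3) + 1 = 0" "qe (1 / 3) ^ 3 = 1"
proof -
  let ?w = "qe (1 / 3)"
  show c: "?w ^ 3 = 1" using qe_of_nat_mult[of 3 "1 / 3"] qe_of_int[of 1] by simp
  have "?w \<noteq> 1"
  proof
    assume "?w = 1"
    then obtain n :: int where "(1 / 3 :: complex) = of_int n" by (auto simp: qe_eq_1_iff elim: Ints_cases)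
    then have "(of_int (3 * n) :: complex) = of_int 1" by (simp add: divide_eq_eq mult.commute)
    then have "3 * n = 1" by (simp only: of_int_eq_iff)
    then show False by presburger
  qed
  moreover have "(?w - 1) * (?w\<^sup>2 + ?w + 1) = 0" using c by (simp add: algebra_simps power2_eq_square power3_eq_cube)
  ultimately show "?w\<^sup>2 + ?w + 1 = 0" by simp
qed

lemma leading_numerator_18: "\<exists>a. a \<noteq> 0 \<and> leading numerator_18 5 a"
proof -
  define w where "w = qe (1 / 3)"
  have w: "w\<^sup>2 + w + 1 = 0" "w ^ 3 = 1" using qe_third by (auto simp: w_def)
  define K where "K = (of_nat (card (torsion_index 18)) :: complex)"
  have K0: "K \<noteq> 0" using full_form_const_nonzero[of 18] by (simp add: K_def full_form_const_def)
  define W where "W x y z = wpq (of_int x * z + of_real (real_of_int y / 3)) (of_nat 6 * z)" for x y :: int and z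
  define u where "u x y z = qe (of_int x * z + of_real (real_of_int y / 3))" for x y :: int and z
  define S where "S n v = (\<Sum>i\<le>n. of_nat i * v ^ i)" for n and v :: complex
  have uq: "u x y z = qe z ^ nat x * w ^ nat y" if "x \<ge> 0" "y \<ge> 0" for x y z
  proof -
    have "u x y z = qe (of_nat (nat x) * z) * qe (of_nat (nat y) * (1 / 3))"
      using that by (simp add: u_def flip: qe_add)
    then show ?thesis by (simp only: qe_of_nat_mult w_def)
  qed
  have uq': "u x (- y) z = qe z ^ nat x * w ^ (2 * nat y)" if "x \<ge> 0" "y \<ge> 0" for x y z
  proof -
    have "of_int x * z + of_real (real_of_int (- y) / 3) = (of_int x * z + of_real (real_of_int (2 * y) / 3)) + of_int (- y)"
      by (simp add: field_simps)
    then have "u x (- y) z = u x (2 * y) z" unfolding u_def by (simp only: qe_add_int)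
    then show ?thesis using uq[of x "2 * y" z] that by (simp add: nat_mult_distrib)
  qed
  \<comment> \<open>What remains of a Weierstrass value after truncating the series of its two Koebe
    terms. The lengths used below, 5 and 1 for \<open>x = 1\<close>, and 2 and 1 for
    \<open>x = 2\<close>, are the least that leave nothing up to exponent 5.\<close>
  define e where "e x m n y z = W x y z - S m (u x y z) - S n (u (6 - x) (- y) z)" for x y :: int and m n z
  have e: "leading (e x m n y) 5 0" if x: "0 < x" "x < 6" and mn: "5 < int (Suc m) * x" "5 < int (Suc n) * (6 - x)" for x y m n
  proof -
    have "leading (\<lambda>z. W x y z - koebe (u x y z) - koebe (u (6 - x) (- y) z)) 5 0"
      using leading_wpq_remainder[of 6 x 5 "real_of_int y / 3"] x by (simp add: W_def u_def)
    moreover have "leading (\<lambda>z. koebe (u x y z) - S m (u x y z)) 5 0"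
      unfolding u_def S_def by (rule leading_koebe_remainder[OF x(1) mn(1)])
    moreover have "leading (\<lambda>z. koebe (u (6 - x) (- y) z) - S n (u (6 - x) (- y) z)) 5 0"
      unfolding u_def S_def by (rule leading_koebe_remainder[OF _ mn(2)]) (use x in simp)
    ultimately have "leading (\<lambda>z. (W x y z - koebe (u x y z) - koebe (u (6 - x) (- y) z)) + (koebe (u x y z) - S m (u x y z))
      + (koebe (u (6 - x) (- y) z) - S n (u (6 - x) (- y) z))) 5 (0 + 0 + 0)" by (intro leading_add)
    from leading_cong[OF this, of "e x m n y"] show ?thesis by (simp add: e_def)
  qed
  let ?e1 = "\<lambda>y. e 1 5 1 y" and ?e2 = "\<lambda>y. e 2 2 1 y"
  have S1: "S 1 v = v" and S2: "S 2 v = v + 2 * v\<^sup>2" and S5: "S 5 v = v + 2 * v\<^sup>2 + 3 * v ^ 3 + 4 * v ^ 4 + 5 * v ^ 5" for v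
    by (simp_all add: S_def numeral_eq_Suc)
  \<comment> \<open>Summed against the powers of \<open>w\<close>, all exponents not congruent to 2
    modulo 3 cancel. For \<open>q\<^sup>2\<close> the contributions are 6 and -6, for
    \<open>q ^ 5\<close> they are 15 and 3.\<close>
  have poly: "(q + 2 * q\<^sup>2 + 3 * q ^ 3 + 4 * q ^ 4 + 5 * q ^ 5 + q ^ 5) +
      w * ((q * w) + 2 * (q * w)\<^sup>2 + 3 * (q * w) ^ 3 + 4 * (q * w) ^ 4 + 5 * (q * w) ^ 5 + q ^ 5 * w\<^sup>2) +
      w\<^sup>2 * ((q * w\<^sup>2) + 2 * (q * w\<^sup>2)\<^sup>2 + 3 * (q * w\<^sup>2) ^ 3 + 4 * (q * w\<^sup>2) ^ 4 + 5 * (q * w\<^sup>2) ^ 5 + q ^ 5 * w ^ 4) +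
      (- 2) * (q\<^sup>2 + 2 * (q\<^sup>2)\<^sup>2 + q ^ 4) +
      (- 2 * w\<^sup>2) * (q\<^sup>2 * w + 2 * (q\<^sup>2 * w)\<^sup>2 + q ^ 4 * w\<^sup>2) +
      (- 2 * w) * (q\<^sup>2 * w\<^sup>2 + 2 * (q\<^sup>2 * w\<^sup>2)\<^sup>2 + q ^ 4 * w ^ 4) = 18 * q ^ 5" for q
    using w by algebra
  have "leading (\<lambda>z. K * 36 * (18 * qe z ^ 5 + (?e1 0 z + w * ?e1 1 z + w\<^sup>2 * ?e1 2 z + (- 2) * ?e2 0 z
     + (- 2 * w\<^sup>2) * ?e2 1 z + (- 2 * w) * ?e2 2 z))) 5 (K * 36 * (18 * 1 ^ 5 + (0 + w * 0 + w\<^sup>2 * 0 + (- 2) * 0 + (- 2 * w\<^sup>2) * 0 + (- 2 * w) * 0)))"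
  proof -
    have "leading qe 1 1" using leading_qe[of 1 0] by simp
    from leading_power[OF this, of 5] have "leading (\<lambda>z. qe z ^ 5) 5 (1 ^ 5)" by simp
    then show ?thesis by (intro leading_cmult leading_add e) auto
  qed
  then have "leading numerator_18 5 (K * 36 * (18 * 1 ^ 5 + (0 + w * 0 + w\<^sup>2 * 0 + (- 2) * 0 + (- 2 * w\<^sup>2) * 0 + (- 2 * w) * 0)))"
  proof (rule leading_cong)
    fix z assume z: "z \<in> upper_half_plane"
    define q where "q = qe z"
    define T where "T = 6 * torsion_sum 18 z"
    have L: "level_form 18 3 x y z = K * (36 * W x y z) - T" if "\<not> 6 dvd x" "0 \<le> y" "y < 3" for x y
      using level_form_eq_wpq[of 18 3 6 x y z] that z by (simp add: K_def W_def T_def)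
    have W1: "W 1 y z = ?e1 y z + S 5 (u 1 y z) + u 5 (- y) z" for y by (simp add: e_def S1 del: One_nat_def)
    have W2: "W 2 y z = ?e2 y z + S 2 (u 2 y z) + u 4 (- y) z" for y by (simp add: e_def S1 del: One_nat_def)
    have us: "u 1 0 z = q" "u 1 1 z = q * w" "u 1 2 z = q * w\<^sup>2" "u 2 0 z = q\<^sup>2" "u 2 1 z = q\<^sup>2 * w" "u 2 2 z = q\<^sup>2 * w\<^sup>2"
      "u 5 (- 0) z = q ^ 5" "u 5 (- 1) z = q ^ 5 * w\<^sup>2" "u 5 (- 2) z = q ^ 5 * w ^ 4"
      "u 4 (- 0) z = q ^ 4" "u 4 (- 1) z = q ^ 4 * w\<^sup>2" "u 4 (- 2) z = q ^ 4 * w ^ 4"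
      using uq[of 1 0 z] uq[of 1 1 z] uq[of 1 2 z] uq[of 2 0 z] uq[of 2 1 z] uq[of 2 2 z]
        uq'[of 5 0 z] uq'[of 5 1 z] uq'[of 5 2 z] uq'[of 4 0 z] uq'[of 4 1 z] uq'[of 4 2 z] by (simp_all add: q_def)
    \<comment> \<open>The term \<open>T\<close>, common to all six values, is collected with a
      multiple of \<open>w\<^sup>2 + w + 1\<close>, which is 0.\<close>
    have "numerator_18 z = K * 36 * (W 1 0 z + w * W 1 1 z + w\<^sup>2 * W 1 2 z + (- 2) * W 2 0 z + (- 2 * w\<^sup>2) * W 2 1 z + (- 2 * w) * W 2 2 z)
       - T * ((w\<^sup>2 + w + 1) * (- 1))"
      unfolding numerator_18_def Let_def w_def[symmetric] by (simp add: L algebra_simps)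
    also have "\<dots> = K * 36 * (W 1 0 z + w * W 1 1 z + w\<^sup>2 * W 1 2 z + (- 2) * W 2 0 z + (- 2 * w\<^sup>2) * W 2 1 z + (- 2 * w) * W 2 2 z)"
      unfolding w by simp
    also have "W 1 0 z + w * W 1 1 z + w\<^sup>2 * W 1 2 z + (- 2) * W 2 0 z + (- 2 * w\<^sup>2) * W 2 1 z + (- 2 * w) * W 2 2 z =
      18 * q ^ 5 + (?e1 0 z + w * ?e1 1 z + w\<^sup>2 * ?e1 2 z + (- 2) * ?e2 0 z + (- 2 * w\<^sup>2) * ?e2 1 z + (- 2 * w) * ?e2 2 z)"
      unfolding W1 W2 S2 S5 us poly[of q, symmetric] by (simp only: algebra_simps)
    finally show "K * 36 * (18 * qe z ^ 5 + (?e1 0 z + w * ?e1 1 z + w\<^sup>2 * ?e1 2 z + (- 2) * ?e2 0 z + (- 2 * w\<^sup>2) * ?e2 1 z + (- 2 * w) * ?e2 2 z)) = numerator_18 z"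
      by (simp only: q_def)
  qed
  then show ?thesis using K0 by (intro exI[of _ "648 * K"]) (simp add: mult.commute)
qed

lemma duality_18:
  assumes "even k" shows "duality 18 k"
proof -
  obtain j where k: "k = 2 * j" using assms by auto
  obtain a where a: "a \<noteq> 0" "leading numerator_18 (6 - 1) a" using leading_numerator_18 by auto
  have "unit_form 2 18 6 (\<lambda>z. full_form 18 6 z - full_form 18 9 z)"
    by (rule unit_form_full_form_diff) (use full_form_M_sharp_18 csc_sum_neq_18 in auto)
  from duality_of_quotient[OF _ this numerator_18_M_sharp a(2,1) k] show ?thesis by simp
qed

subsection \<open>Level 10\<close>

lemma M_sharpI:
  assumes N: "N > 0" and "f holomorphic_on upper_half_plane" "\<And>z. z \<notin> upper_half_plane \<Longrightarrow> f z = 0"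
    and "\<And>A z. A \<in> Gamma0 N \<Longrightarrow> z \<in> upper_half_plane \<Longrightarrow> slash k f A z = f z"
    and l: "leading f n a" and "\<And>A. A \<in> SL2Z - Gamma0 N \<Longrightarrow> \<exists>L. (slash k f A \<longlongrightarrow> L) at_ioo"
  shows "f \<in> M_sharp k N"
  using assms leading_imp_moderate[OF l] by (auto simp: M_sharp_iff[OF N] invariant_form_def)

text \<open>The units modulo 10 form a group of order 2 up to sign. Unlike at level 6, single
  differences are therefore not invariant, and only combinations symmetric under the exchange will
  be used.\<close>

lemma full_form_10_Gamma0:
  assumes A: "A \<in> Gamma0 10" and z: "z \<in> upper_half_plane"
  shows "(\<forall>x\<in>{1, 2, 3, 4, 5}. slash 2 (full_form 10 x) A z = full_form 10 x z) \<or>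
    (slash 2 (full_form 10 1) A z = full_form 10 3 z \<and> slash 2 (full_form 10 2) A z = full_form 10 4 z \<and>
     slash 2 (full_form 10 3) A z = full_form 10 1 z \<and> slash 2 (full_form 10 4) A z = full_form 10 2 z \<and>
     slash 2 (full_form 10 5) A z = full_form 10 5 z)"
proof -
  let ?a = "A $ 1 $ 1"
  have "\<not> 2 dvd ?a" "\<not> 5 dvd ?a"
    using Gamma0_diagonal_not_dvd(1)[OF A, of 2] Gamma0_diagonal_not_dvd(1)[OF A, of 5] by auto
  then have a: "?a mod 10 = 1 \<or> ?a mod 10 = 3 \<or> ?a mod 10 = 7 \<or> ?a mod 10 = 9" by presburger
  have s: "slash 2 (full_form 10 x) A z = full_form 10 y z"
    if "\<not> 10 dvd x" "(x * (?a mod 10)) mod 10 = y mod 10 \<or> (x * (?a mod 10)) mod 10 = (- y) mod 10" for x y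
  proof -
    have "slash 2 (full_form 10 x) A z = full_form 10 (x * ?a) z"
      by (rule slash_full_form_Gamma0[OF _ _ A z]) (use that in simp_all)
    also have "\<dots> = full_form 10 y z"
      by (rule full_form_pm_cong) (use that in \<open>simp_all add: mod_mult_right_eq\<close>)
    finally show ?thesis .
  qed
  from a consider "?a mod 10 = 1 \<or> ?a mod 10 = 9" | "?a mod 10 = 3 \<or> ?a mod 10 = 7" by blast
  then show ?thesis
  proof cases
    case 1
    then have "\<forall>x\<in>{1, 2, 3, 4, 5}. slash 2 (full_form 10 x) A z = full_form 10 x z"
      by (intro ballI s) (elim disjE; auto)+
    then show ?thesis by blast
  next
    case 2
    have "slash 2 (full_form 10 1) A z = full_form 10 3 z" by (rule s) (use 2 in auto)
    moreover have "slash 2 (full_form 10 2) A z = full_form 10 4 z" by (rule s) (use 2 in auto)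
    moreover have "slash 2 (full_form 10 3) A z = full_form 10 1 z" by (rule s) (use 2 in auto)
    moreover have "slash 2 (full_form 10 4) A z = full_form 10 2 z" by (rule s) (use 2 in auto)
    moreover have "slash 2 (full_form 10 5) A z = full_form 10 5 z" by (rule s) (use 2 in auto)
    ultimately show ?thesis by blast
  qed
qed

section \<open>Symmetric combinations of weights 4 and 2\<close>

definition diff_10 :: "int \<Rightarrow> int \<Rightarrow> complex \<Rightarrow> complex" where
  "diff_10 x y z = full_form 10 x z - full_form 10 y z"

lemma diff_10_holomorphic:
  assumes "\<not> 10 dvd x" "\<not> 10 dvd y" shows "diff_10 x y holomorphic_on upper_half_plane"
  unfolding diff_10_def [abs_def] using assms by (intro holomorphic_intros level_form_holomorphic[of 10 1 10]) auto

lemma diff_10_zero_outside: "z \<notin> upper_half_plane \<Longrightarrow> diff_10 x y z = 0"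
  by (simp add: diff_10_def level_form_zero_outside)

lemma slash_diff_10: "slash 2 (diff_10 x y) A z = slash 2 (full_form 10 x) A z - slash 2 (full_form 10 y) A z"
  by (simp add: slash_def diff_10_def algebra_simps)

lemma slash_diff_10_tendsto:
  assumes "\<not> 10 dvd x" "\<not> 10 dvd y" "A \<in> SL2Z"
  shows "(slash 2 (diff_10 x y) A \<longlongrightarrow> of_nat (card (torsion_index 10)) * of_real (csc_sum 10 y (A $ 2 $ 1) - csc_sum 10 x (A $ 2 $ 1)) / 4) at_ioo"
  using full_form_diff_tendsto[of 10 x y A] assms by (simp add: diff_10_def [abs_def])

lemma leading_diff_10: "0 < x \<Longrightarrow> x < y \<Longrightarrow> y \<le> 5 \<Longrightarrow> leading (diff_10 x y) x (full_form_const 10)"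
  using leading_full_form_diff[of x y 10] by (simp add: diff_10_def [abs_def])

text \<open>The product over the orbit of one difference. Weight 2 cannot suffice:
  \<open>mat2 3 (- 1) 10 (- 3)\<close> lies in \<open>Gamma0 10\<close> and fixes a point of the
  upper half plane where its automorphy factor is \<open>\<i>\<close>, so every invariant form of
  weight 2 vanishes there.\<close>

definition unit_10 :: "complex \<Rightarrow> complex" where
  "unit_10 z = diff_10 4 5 z * diff_10 2 5 z"

lemma unit_10: "unit_form 4 10 6 unit_10"
  unfolding unit_form_def
proof (intro conjI ballI)
  have C: "full_form_const 10 \<noteq> 0" using full_form_const_nonzero[of 10] by simp
  have sl: "slash 4 unit_10 A z = slash 2 (diff_10 4 5) A z * slash 2 (diff_10 2 5) A z" if "A \<in> SL2Z" "z \<in> upper_half_plane" for A z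
    using slash_prod[OF that, of 2 2] by (simp add: unit_10_def [abs_def])
  have inv: "slash 4 unit_10 A z = unit_10 z" if A: "A \<in> Gamma0 10" and z: "z \<in> upper_half_plane" for A z
    unfolding sl[OF Gamma0_SL2Z[OF A] z] slash_diff_10
    using full_form_10_Gamma0[OF A z] by (auto simp: unit_10_def diff_10_def)
  have "unit_10 holomorphic_on upper_half_plane"
    unfolding unit_10_def [abs_def] by (intro holomorphic_intros diff_10_holomorphic) auto
  then show "invariant_form 4 10 unit_10"
    using inv by (auto simp: invariant_form_def unit_10_def diff_10_zero_outside)
  have "leading unit_10 (4 + 2) (full_form_const 10 * full_form_const 10)"
    unfolding unit_10_def [abs_def] by (intro leading_mult leading_diff_10) auto
  then show "\<exists>b. b \<noteq> 0 \<and> leading unit_10 6 b" using C by (intro exI[of _ "full_form_const 10 * full_form_const 10"]) auto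
  show "unit_10 z \<noteq> 0" if "z \<in> upper_half_plane" for z
    using full_form_nonzero_diff[of 4 5 10 z] full_form_nonzero_diff[of 2 5 10 z] that by (simp add: unit_10_def diff_10_def)
  fix A assume A: "A \<in> SL2Z - Gamma0 10"
  then have c: "\<not> 10 dvd A $ 2 $ 1" by (simp add: Gamma0_iff)
  have K: "of_nat (card (torsion_index 10)) \<noteq> (0 :: complex)" using C by (simp add: full_form_const_def)
  define L where "L x = of_nat (card (torsion_index 10)) * complex_of_real (csc_sum 10 5 (A $ 2 $ 1) - csc_sum 10 x (A $ 2 $ 1)) / 4" for x
  have L0: "L 4 \<noteq> 0" "L 2 \<noteq> 0" using csc_sum_neq_10[OF c] K unfolding L_def by (simp_all del: of_real_diff)
  have "((\<lambda>z. slash 2 (diff_10 4 5) A z * slash 2 (diff_10 2 5) A z) \<longlongrightarrow> L 4 * L 2) at_ioo"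
    unfolding L_def using A by (intro tendsto_mult slash_diff_10_tendsto) auto
  then have "(slash 4 unit_10 A \<longlongrightarrow> L 4 * L 2) at_ioo"
    by (rule Lim_transform_eventually) (use eventually_upper_half_plane in eventually_elim, use A sl in auto)
  then show "\<exists>L. L \<noteq> 0 \<and> (slash 4 unit_10 A \<longlongrightarrow> L) at_ioo" using L0 by (intro exI[of _ "L 4 * L 2"]) auto
qed

text \<open>
  Multiplication by 3 modulo 10 and up to sign exchanges 1 with 3 and 2 with 4, so it
  permutes the factors of each product. The \<open>q\<^sup>4\<close> terms of the two products cancel.
\<close>
definition numerator_10 :: "complex \<Rightarrow> complex" where
  "numerator_10 z = diff_10 1 5 z * diff_10 3 5 z - diff_10 1 2 z * diff_10 3 4 z"

lemma leading_numerator_10: "leading numerator_10 5 (full_form_const 10 ^ 2 * 2)"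
proof -
  let ?w = "wpq_multiple 10"
  have 1: "leading (?w 1) 1 1" "leading (?w 2) 2 1" "leading (?w 3) 3 1" "leading (?w 4) 4 1" "leading (?w 5) 5 2"
    using leading_wpq_multiple[of _ 10] leading_wpq_multiple_half[of 5 10] by simp_all
  \<comment> \<open>After expansion the product of the values at 1 and 3 occurs with both signs and
    cancels. Of the remaining products only those at 1 and 4 and at 2 and 3 have order 5, hence the
    factor 2; the others have order at least 6.\<close>
  have e: "leading (\<lambda>z. ?w 1 z * ?w 4 z) 5 (1 * 1)" "leading (\<lambda>z. ?w 2 z * ?w 3 z) 5 (1 * 1)"
    using leading_mult[OF 1(1) 1(4)] leading_mult[OF 1(2) 1(3)] by simp_all
  have o: "leading (\<lambda>z. ?w 1 z * ?w 5 z) 5 0" "leading (\<lambda>z. ?w 3 z * ?w 5 z) 5 0" "leading (\<lambda>z. ?w 2 z * ?w 4 z) 5 0" "leading (\<lambda>z. ?w 5 z * ?w 5 z) 5 0"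
    using leading_lower[OF leading_mult[OF 1(1) 1(5)], of 5] leading_lower[OF leading_mult[OF 1(3) 1(5)], of 5]
     leading_lower[OF leading_mult[OF 1(2) 1(4)], of 5] leading_lower[OF leading_mult[OF 1(5) 1(5)], of 5] by simp_all
  have "leading (\<lambda>z. full_form_const 10 ^ 2 * (?w 1 z * ?w 4 z + ?w 2 z * ?w 3 z - ?w 1 z * ?w 5 z - ?w 3 z * ?w 5 z - ?w 2 z * ?w 4 z + ?w 5 z * ?w 5 z))
    5 (full_form_const 10 ^ 2 * (1 * 1 + 1 * 1 - 0 - 0 - 0 + 0))"
    by (intro leading_cmult leading_add leading_diff e o)
  then have "leading numerator_10 5 (full_form_const 10 ^ 2 * (1 * 1 + 1 * 1 - 0 - 0 - 0 + 0))"
  proof (rule leading_cong)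
    fix z assume z: "z \<in> upper_half_plane"
    have d: "diff_10 x y z = full_form_const 10 * (?w x z - ?w y z)" if "\<not> 10 dvd x" "\<not> 10 dvd y" for x y
      using full_form_diff[OF _ _ _ z, of 10 x y] that by (simp add: diff_10_def)
    show "full_form_const 10 ^ 2 * (?w 1 z * ?w 4 z + ?w 2 z * ?w 3 z - ?w 1 z * ?w 5 z - ?w 3 z * ?w 5 z - ?w 2 z * ?w 4 z + ?w 5 z * ?w 5 z) = numerator_10 z"
      unfolding numerator_10_def by (simp add: d) algebra
  qed
  then show ?thesis by simp
qed

lemma numerator_10_M_sharp: "numerator_10 \<in> M_sharp 4 10"
proof (rule M_sharpI[OF _ _ _ _ leading_numerator_10])
  have sl: "slash 4 numerator_10 A z = slash 2 (diff_10 1 5) A z * slash 2 (diff_10 3 5) A z - slash 2 (diff_10 1 2) A z * slash 2 (diff_10 3 4) A z"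
    if "A \<in> SL2Z" "z \<in> upper_half_plane" for A z
  proof -
    have "slash 4 numerator_10 A z
      = slash 4 (\<lambda>z. diff_10 1 5 z * diff_10 3 5 z) A z - slash 4 (\<lambda>z. diff_10 1 2 z * diff_10 3 4 z) A z"
      by (simp add: numerator_10_def [abs_def] slash_def algebra_simps)
    then show ?thesis
      using slash_prod[OF that, of 2 2 "diff_10 1 5" "diff_10 3 5"] slash_prod[OF that, of 2 2 "diff_10 1 2" "diff_10 3 4"]
      by simp
  qed
  show "numerator_10 holomorphic_on upper_half_plane"
    unfolding numerator_10_def [abs_def] by (intro holomorphic_intros diff_10_holomorphic) auto
  show "slash 4 numerator_10 A z = numerator_10 z" if A: "A \<in> Gamma0 10" and z: "z \<in> upper_half_plane" for A z
    unfolding sl[OF Gamma0_SL2Z[OF A] z] slash_diff_10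
    using full_form_10_Gamma0[OF A z] by (auto simp: numerator_10_def diff_10_def)
  fix A assume A: "A \<in> SL2Z - Gamma0 10"
  have lim: "\<exists>L. (slash 2 (diff_10 x y) A \<longlongrightarrow> L) at_ioo" if "\<not> 10 dvd x" "\<not> 10 dvd y" for x y
    using slash_diff_10_tendsto[OF that] A by blast
  obtain a b c d where "(slash 2 (diff_10 1 5) A \<longlongrightarrow> a) at_ioo" "(slash 2 (diff_10 3 5) A \<longlongrightarrow> b) at_ioo"
    "(slash 2 (diff_10 1 2) A \<longlongrightarrow> c) at_ioo" "(slash 2 (diff_10 3 4) A \<longlongrightarrow> d) at_ioo"
    using lim[of 1 5] lim[of 3 5] lim[of 1 2] lim[of 3 4] by auto
  then have "((\<lambda>z. slash 2 (diff_10 1 5) A z * slash 2 (diff_10 3 5) A z - slash 2 (diff_10 1 2) A z * slash 2 (diff_10 3 4) A z) \<longlongrightarrow> a * b - c * d) at_ioo"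
    by (intro tendsto_intros)
  then have "(slash 4 numerator_10 A \<longlongrightarrow> a * b - c * d) at_ioo"
    by (rule Lim_transform_eventually) (use eventually_upper_half_plane in eventually_elim, use A sl in auto)
  then show "\<exists>L. (slash 4 numerator_10 A \<longlongrightarrow> L) at_ioo" by blast
qed (auto simp: numerator_10_def diff_10_zero_outside)

text \<open>The sum over the orbit used in \<open>unit_10\<close>. A form of weight 2 has 3 zeros at
  level 10, of which the two elliptic points claim half a zero each, so order 2 at infinity is the
  largest possible.\<close>

definition weight_2_form_10 :: "complex \<Rightarrow> complex" where
  "weight_2_form_10 z = diff_10 2 5 z + diff_10 4 5 z"

lemma leading_weight_2_form_10: "leading weight_2_form_10 2 (full_form_const 10)"
proof -
  have "leading (diff_10 4 5) 2 0" by (rule leading_lower[OF leading_diff_10]) auto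
  from leading_add[OF leading_diff_10[of 2 5] this] show ?thesis by (simp add: weight_2_form_10_def [abs_def])
qed

lemma weight_2_form_10_M_sharp: "weight_2_form_10 \<in> M_sharp 2 10"
proof (rule M_sharpI[OF _ _ _ _ leading_weight_2_form_10])
  have sl: "slash 2 weight_2_form_10 A z = slash 2 (diff_10 2 5) A z + slash 2 (diff_10 4 5) A z" for A z
    by (simp add: weight_2_form_10_def [abs_def] slash_def algebra_simps)
  show "weight_2_form_10 holomorphic_on upper_half_plane"
    unfolding weight_2_form_10_def [abs_def] by (intro holomorphic_intros diff_10_holomorphic) auto
  show "slash 2 weight_2_form_10 A z = weight_2_form_10 z" if A: "A \<in> Gamma0 10" and z: "z \<in> upper_half_plane" for A z
    unfolding sl slash_diff_10
    using full_form_10_Gamma0[OF A z] by (auto simp: weight_2_form_10_def diff_10_def)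
  fix A assume A: "A \<in> SL2Z - Gamma0 10"
  have lim: "\<exists>L. (slash 2 (diff_10 x y) A \<longlongrightarrow> L) at_ioo" if "\<not> 10 dvd x" "\<not> 10 dvd y" for x y
    using slash_diff_10_tendsto[OF that] A by blast
  obtain a b where "(slash 2 (diff_10 2 5) A \<longlongrightarrow> a) at_ioo" "(slash 2 (diff_10 4 5) A \<longlongrightarrow> b) at_ioo"
    using lim[of 2 5] lim[of 4 5] by auto
  then have "((\<lambda>z. slash 2 (diff_10 2 5) A z + slash 2 (diff_10 4 5) A z) \<longlongrightarrow> a + b) at_ioo"
    by (intro tendsto_intros)
  then show "\<exists>L. (slash 2 weight_2_form_10 A \<longlongrightarrow> L) at_ioo" unfolding sl [abs_def] by blast
qed (auto simp: weight_2_form_10_def diff_10_zero_outside)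

text \<open>The condition says that \<open>A\<close> is an element of \<open>Gamma0 10\<close> times
  \<open>mat2 1 0 g 1\<close> times the translation by \<open>n\<close>; the three values of
  \<open>g\<close> belong to the cusps 1, 1/2 and 1/5. Only the bottom row modulo 10 enters, so
  evaluation over all residues decides it.\<close>

lemma cusp_representative_10:
  assumes A: "A \<in> SL2Z - Gamma0 10"
  shows "\<exists>g\<in>{1, 2, 5}. \<exists>n. 10 dvd A $ 2 $ 1 - g * (A $ 2 $ 2 - n * A $ 2 $ 1)"
proof -
  let ?c = "A $ 2 $ 1" and ?d = "A $ 2 $ 2"
  \<comment> \<open>Coprimality of the bottom row matters only at 2 and 5, the primes dividing the
    level.\<close>
  have all: "\<forall>c\<in>set [1..9]. \<forall>d\<in>set [0..9]. (even c \<longrightarrow> odd d) \<longrightarrow> (5 dvd c \<longrightarrow> \<not> 5 dvd d) \<longrightarrow>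
      (\<exists>g\<in>set [1, 2, 5]. \<exists>n\<in>set [0..9]. (10 :: int) dvd c - g * (d - n * c))"
    by code_simp
  have det: "A $ 1 $ 1 * ?d - A $ 1 $ 2 * ?c = 1" and nc: "\<not> 10 dvd ?c" using A by (auto simp: SL2Z_iff Gamma0_iff)
  have np: "p dvd 1" if "p dvd ?c" "p dvd ?d" for p
    unfolding det[symmetric] using that by (intro dvd_diff) auto
  have "?c mod 10 \<in> set [1..9]" using nc by (simp add: dvd_eq_mod_eq_0) presburger
  moreover have "?d mod 10 \<in> set [0..9]" by simp
  moreover have "even (?c mod 10) \<longrightarrow> odd (?d mod 10)" using np[of 2] by (auto simp: dvd_mod_iff)
  moreover have "5 dvd ?c mod 10 \<longrightarrow> \<not> 5 dvd ?d mod 10" using np[of 5] by (auto simp: dvd_mod_iff)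
  ultimately obtain g n where gn: "g \<in> set [1, 2, 5]" "(10 :: int) dvd ?c mod 10 - g * (?d mod 10 - n * (?c mod 10))"
    using all by blast
  have "(?c - g * (?d - n * ?c)) mod 10 = (?c mod 10 - g * (?d mod 10 - n * (?c mod 10))) mod 10"
    by (intro mod_diff_cong mod_mult_cong) auto
  then have "10 dvd ?c - g * (?d - n * ?c)" using gn by (simp only: dvd_eq_mod_eq_0)
  then show ?thesis using gn(1) by auto
qed

lemma tendsto_at_ioo_translate:
  assumes "(f \<longlongrightarrow> L) at_ioo"
  shows "((\<lambda>z. f (z + of_int n)) \<longlongrightarrow> L) at_ioo"
proof (rule filterlim_compose[OF assms])
  show "filterlim (\<lambda>z. z + of_int n) at_ioo at_ioo"
    unfolding filterlim_iff eventually_at_ioo by (metis complex_Im_of_int add.right_neutral plus_complex.sel(2))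
qed

text \<open>Invariance absorbs the factor in \<open>Gamma0 10\<close>, and a translation does not
  change a limit at infinity, so a function of weight 0 has only three limits at the cusps other
  than infinity.\<close>

lemma slash_0_tendsto_10:
  assumes f: "f \<in> M_sharp 0 10" and A: "A \<in> SL2Z - Gamma0 10"
  shows "\<exists>g\<in>{1, 2, 5}. \<forall>L. (slash 0 f (mat2 1 0 g 1) \<longlongrightarrow> L) at_ioo \<longrightarrow> (slash 0 f A \<longlongrightarrow> L) at_ioo"
proof -
  obtain g n where g: "g \<in> {1, 2, 5}" and d: "10 dvd A $ 2 $ 1 - g * (A $ 2 $ 2 - n * A $ 2 $ 1)"
    using cusp_representative_10[OF A] by blast
  let ?G = "mat2 1 0 g 1" and ?T = "mat2 1 n 0 1"
  have S: "?G \<in> SL2Z" "?T \<in> SL2Z" "A \<in> SL2Z" using A by (auto simp: SL2Z_iff)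
  define C where "C = A ** mat2_inv ?T ** mat2_inv ?G"
  have C: "C \<in> Gamma0 10"
    using d S by (auto simp: Gamma0_iff C_def mat2_mult_nth mat2_inv_def algebra_simps intro!: SL2Z_mult) (auto simp: SL2Z_iff)
  have AC: "A = C ** (?G ** ?T)"
  proof -
    have "C ** (?G ** ?T) = A ** mat2_inv ?T ** (mat2_inv ?G ** ?G) ** ?T" by (simp only: C_def matrix_mul_assoc)
    also have "\<dots> = A ** (mat2_inv ?T ** ?T)" by (simp add: mat2_inv_left[OF S(1)] matrix_mul_assoc)
    finally show ?thesis by (simp add: mat2_inv_left[OF S(2)])
  qed
  have inv: "invariant_form 0 10 f" using f by (simp add: M_sharp_iff)
  have eq: "slash 0 f A z = slash 0 f ?G (z + of_int n)" if z: "z \<in> upper_half_plane" for z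
  proof -
    have "slash 0 f A z = slash 0 f (?G ** ?T) z"
      unfolding AC by (rule invariant_form_slash_coset[OF inv SL2Z_mult[OF S(1,2)] C z])
    also have "\<dots> = slash 0 (slash 0 f ?G) ?T z" by (rule slash_mult[OF S(1,2) z])
    finally show ?thesis by (simp add: slash_translation)
  qed
  have "(slash 0 f A \<longlongrightarrow> L) at_ioo" if "(slash 0 f ?G \<longlongrightarrow> L) at_ioo" for L
    by (rule Lim_transform_eventually[OF tendsto_at_ioo_translate[OF that, of n]])
       (use eventually_upper_half_plane in eventually_elim, simp add: eq)
  then show ?thesis using g by blast
qed

text \<open>
  Besides infinity there are three cusps, hence three factors \<open>\<phi> - L\<close>.
\<close>
lemma S_sharp_0_order_3_10:
  assumes \<phi>: "\<phi> \<in> M_sharp 0 10" "leading \<phi> (- 1) b" "b \<noteq> 0"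
  shows "\<exists>f a. f \<in> S_sharp 0 10 \<and> leading f (- 3) a \<and> a \<noteq> 0"
proof -
  have N: "(10 :: nat) > 0" by simp
  \<comment> \<open>The constant 1 on the upper half plane, taken as a zeroth power because its
    membership is then already known.\<close>
  define one where "one = form_power unit_10 0"
  have one: "one \<in> M_sharp 0 10" using unit_form_power(1)[OF N unit_10, of 0] by (simp add: one_def)
  have one_eq: "one z = 1" if "z \<in> upper_half_plane" for z using that by (simp add: one_def form_power_def)
  have cusp: "mat2 1 0 g 1 \<in> SL2Z - Gamma0 10" if "g \<in> {1, 2, 5}" for g
    using that by (auto simp: SL2Z_iff Gamma0_iff)
  have "\<exists>L. (slash 0 \<phi> (mat2 1 0 g 1) \<longlongrightarrow> L) at_ioo" if "g \<in> {1, 2, 5}" for g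
    using \<phi>(1) cusp[OF that] unfolding M_sharp_iff[OF N] by blast
  then obtain L where L: "\<And>g. g \<in> {1, 2, 5} \<Longrightarrow> (slash 0 \<phi> (mat2 1 0 g 1) \<longlongrightarrow> L g) at_ioo" by metis
  define \<psi> where "\<psi> g z = \<phi> z + (- L g) * one z" for g z
  have \<psi>M: "\<psi> g \<in> M_sharp 0 10" for g unfolding \<psi>_def [abs_def] by (rule M_sharp_add_cmult[OF N \<phi>(1) one])
  have "leading one (- 1) 0"
  proof (rule leading_lower)
    have "leading (\<lambda>z. 1) 0 1" by (simp add: leading_0_iff)
    then show "leading one 0 1" by (rule leading_cong) (simp add: one_eq)
  qed simp
  then have \<psi>l: "leading (\<psi> g) (- 1) b" for g
    using leading_add[OF \<phi>(2) leading_cmult[of one "- 1" 0 "- L g"]] by (simp add: \<psi>_def [abs_def])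
  have \<psi>t: "(slash 0 (\<psi> g) A \<longlongrightarrow> l - L g) at_ioo" if A: "A \<in> SL2Z" and l: "(slash 0 \<phi> A \<longlongrightarrow> l) at_ioo" for A l g
  proof (rule Lim_transform_eventually[OF tendsto_diff[OF l tendsto_const]])
    show "\<forall>\<^sub>F z in at_ioo. slash 0 \<phi> A z - L g = slash 0 (\<psi> g) A z"
      using eventually_upper_half_plane
      by eventually_elim (simp add: slash_def \<psi>_def one_eq moebius_action_in_H[OF A])
  qed
  define f where "f z = \<psi> 1 z * (\<psi> 2 z * \<psi> 5 z)" for z
  have fM: "f \<in> M_sharp 0 10"
    using M_sharp_mult[OF N \<psi>M[of 1] M_sharp_mult[OF N \<psi>M[of 2] \<psi>M[of 5]]] by (simp add: f_def [abs_def])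
  have "(slash 0 f A \<longlongrightarrow> 0) at_ioo" if A: "A \<in> SL2Z - Gamma0 10" for A
  proof -
    obtain g where g: "g \<in> {1, 2, 5}" "(slash 0 \<phi> A \<longlongrightarrow> L g) at_ioo"
      using slash_0_tendsto_10[OF \<phi>(1) A] L by blast
    have AS: "A \<in> SL2Z" using A by simp
    note t = \<psi>t[OF AS g(2)]
    have "(slash (0 + (0 + 0)) f A \<longlongrightarrow> (L g - L 1) * ((L g - L 2) * (L g - L 5))) at_ioo"
      unfolding f_def [abs_def] by (intro tendsto_slash_prod AS t)
    moreover have "(L g - L 1) * ((L g - L 2) * (L g - L 5)) = 0" using g(1) by auto
    ultimately show ?thesis by simp
  qed
  then have "f \<in> S_sharp 0 10" using fM by (simp add: S_sharp_iff M_sharp_iff)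
  moreover have "leading f (- 3) (b * (b * b))"
    using leading_mult[OF \<psi>l[of 1] leading_mult[OF \<psi>l[of 2] \<psi>l[of 5]]] by (simp add: f_def [abs_def])
  ultimately show ?thesis using \<phi>(3) by (intro exI[of _ f] exI[of _ "b * (b * b)"]) auto
qed

lemma duality_10:
  assumes "even k" shows "duality 10 k"
proof -
  have N: "(10 :: nat) > 0" by simp
  have C: "full_form_const 10 \<noteq> 0" using full_form_const_nonzero[of 10] by simp
  have W: "leading numerator_10 (6 - 1) (full_form_const 10 ^ 2 * 2)" using leading_numerator_10 by simp
  have "k mod 4 = 0 \<or> k mod 4 = 2" using assms by presburger
  then show ?thesis
  proof
    assume "k mod 4 = 0"
    then obtain j where k: "k = 4 * j" by (auto simp: mod_eq_0_iff_dvd elim: dvdE)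
    show ?thesis by (rule duality_of_quotient[OF N unit_10 numerator_10_M_sharp W _ k]) (use C in simp)
  next
    assume "k mod 4 = 2"
    then have "4 dvd k - 2" by presburger
    then obtain j where "k - 2 = 4 * j" by (elim dvdE)
    then have k: "k = 4 * j + 2" by simp
    obtain \<phi> b where \<phi>: "\<phi> \<in> M_sharp 0 10" "leading \<phi> (- 1) b" "b \<noteq> 0"
      using hauptmodul_of_quotient[OF N unit_10 numerator_10_M_sharp W] C by auto
    obtain f a where f: "f \<in> S_sharp 0 10" "leading f (- 3) a" "a \<noteq> 0" using S_sharp_0_order_3_10[OF \<phi>] by blast
    obtain c where c: "c \<noteq> 0" "leading (form_power unit_10 j) (6 * j) c" using unit_form_power(2)[OF N unit_10] by blast
    obtain d where d: "d \<noteq> 0" "leading (form_power unit_10 (- j)) (6 * (- j)) d" using unit_form_power(2)[OF N unit_10] by blast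
    \<comment> \<open>The form of order 2 accounts for the weight 2, so the other side has weight
      \<open>- 4 * j\<close> and takes its extra factor from weight 0. The orders
      \<open>6 * j + 2\<close> and \<open>- 6 * j - 3\<close> add up to -1, as the pairing
      requires.\<close>
    have F: "(\<lambda>z. form_power unit_10 j z * weight_2_form_10 z) \<in> M_sharp k 10"
      unfolding k by (rule M_sharp_mult[OF N unit_form_power(1)[OF N unit_10] weight_2_form_10_M_sharp])
    have Fl: "leading (\<lambda>z. form_power unit_10 j z * weight_2_form_10 z) (6 * j + 2) (c * full_form_const 10)"
      by (rule leading_mult[OF c(2) leading_weight_2_form_10])
    have "(\<lambda>z. form_power unit_10 (- j) z * f z) \<in> S_sharp (4 * (- j) + 0) 10"
      by (rule M_sharp_mult_S_sharp[OF N unit_form_power(1)[OF N unit_10] f(1)])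
    then have G: "(\<lambda>z. form_power unit_10 (- j) z * f z) \<in> S_sharp (2 - k) 10" by (simp add: k)
    have "leading (\<lambda>z. form_power unit_10 (- j) z * f z) (6 * (- j) + (- 3)) (d * a)"
      by (rule leading_mult[OF d(2) f(2)])
    then have Gl: "leading (\<lambda>z. form_power unit_10 (- j) z * f z) (- 1 - (6 * j + 2)) (d * a)" by (simp add: algebra_simps)
    have nz: "c * full_form_const 10 \<noteq> 0" "d * a \<noteq> 0" using c d f C by auto
    show ?thesis unfolding duality_def
      using duality_of_generators[OF N \<phi> F Fl nz(1) G Gl nz(2) refl refl] by blast
  qed
qed

theorem theorem1p1:
  fixes N :: nat and k n0 n1 m n :: int
  assumes "N \<in> {6, 10, 12, 18}"
    and "even k"
    and "n0 = max_order_infinity (M_sharp k N)"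
    and "n1 = max_order_infinity (S_sharp (2 - k) N)"
    and "m \<ge> - n0"
    and "n \<ge> - n1"
  shows "a_coeff N k m n = - b_coeff N (2 - k) n m"
proof -
  have "duality N k"
    using assms(1) duality_6[OF assms(2)] duality_10[OF assms(2)] duality_12[OF assms(2)] duality_18[OF assms(2)] by auto
  then show ?thesis using assms(3-6) by (simp add: duality_def)
qed

end
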